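(* For every positive integer $d$ there exist constants $c_d, C_d > 0$ depending only on $d$ such that for every positive integer $N$, \[ c_d N^{\frac{d}{2d+2}} \le \operatorname{disc}(\mathcal{A}_d) \le C_d N^{\frac{d}{2d+2}}, \] i.e. $\operatorname{disc}(\mathcal{A}_d)=\Theta_d(N^{\frac{d}{2d+2}})$.
   Context: For $N\in\mathbb{N}$ write $[N]=\{1,\dots,N\}$. An arithmetic progression in $d$ dimensions is a set $\{\mathbf{a}+i\mathbf{b}: i=0,1,\dots,l-1\}$ with $\mathbf{a},\mathbf{b}\in\mathbb{Z}^d$, $\mathbf{b}\neq\mathbf{0}$, $l\in\mathbb{N}$. $\mathcal{A}_d$ is the family of all arithmetic progressions in $d$ dimensions contained in $[N]^d$. For a coloring $\chi:[N]^d\to\{1,-1\}$ and $A\subseteq[N]^d$, $\chi(A)=\sum_{x\in A}\chi(x)$, and $\operatorname{disc}(\mathcal{A}_d)=\min_{\chi}\max_{A\in\mathcal{A}_d}|\chi(A)|$, the minimum over all colorings $\chi:[N]^d\to\{1,-1\}$. *)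

theory Defs
  imports "HOL-Analysis.Analysis"
begin

text \<open>Points of Z^d are represented as functions nat => int vanishing at
coordinates >= d (explicit carrier, since d varies).\<close>

definition grid :: "nat \<Rightarrow> nat \<Rightarrow> (nat \<Rightarrow> int) set" where
  "grid d N = {x. (\<forall>i<d. 1 \<le> x i \<and> x i \<le> int N) \<and> (\<forall>i\<ge>d. x i = 0)}"

definition zvec :: "nat \<Rightarrow> (nat \<Rightarrow> int) set" where
  "zvec d = {x. \<forall>i\<ge>d. x i = 0}"

definition ap :: "(nat \<Rightarrow> int) \<Rightarrow> (nat \<Rightarrow> int) \<Rightarrow> nat \<Rightarrow> (nat \<Rightarrow> int) set" where
  "ap a b l = {(\<lambda>k. a k + int i * b k) | i. i < l}"

definition APs :: "nat \<Rightarrow> nat \<Rightarrow> (nat \<Rightarrow> int) set set" where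
  "APs d N = {ap a b l | a b l. a \<in> zvec d \<and> b \<in> zvec d \<and> b \<noteq> (\<lambda>_. 0) \<and> l \<ge> 1
                              \<and> ap a b l \<subseteq> grid d N}"

definition colorings :: "nat \<Rightarrow> nat \<Rightarrow> ((nat \<Rightarrow> int) \<Rightarrow> int) set" where
  "colorings d N = {col. (\<forall>x\<in>grid d N. col x \<in> {1, -1}) \<and> (\<forall>x. x \<notin> grid d N \<longrightarrow> col x = 0)}"

definition disc_AP :: "nat \<Rightarrow> nat \<Rightarrow> int" where
  "disc_AP d N = Min ((\<lambda>col. Max ((\<lambda>A. \<bar>\<Sum>x\<in>A. col x\<bar>) ` APs d N)) ` colorings d N)"

end

theory Submission
  imports Defs
begin

text \<open>Lower bound (Roth's argument). Let \<open>G b y\<close> be the sum of the coloring over the progression of length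
  \<open>L\<close>, about \<open>N powr (d / (d + 1))\<close>, from \<open>y\<close> in direction \<open>b\<close>, where \<open>b\<close> ranges over the nonzero vectors
  of sup norm at most \<open>N / L\<close>. By Parseval on \<open>(Z/P) ^ d\<close> and Dirichlet's pigeonhole, each frequency is amplified by
  some \<open>b\<close>, so the mean square of \<open>G\<close> is of order \<open>L\<close>.

  Upper bound. The coloring is built by iterated partial colorings, as in the work of Matousek and Spencer.
  For an uncolored set \<open>X\<close>, every line of direction \<open>b\<close> is cut into dyadic blocks of \<open>2 ^ j\<close> consecutive points of
  \<open>X\<close>, and a progression meets \<open>X\<close> in a difference of two unions of at most one block per level. The
  trivial count gives \<open>card X * (K / s) ^ (d + 1)\<close> blocks of size \<open>s\<close>, with \<open>K = N powr (d / (d + 1))\<close>, hence a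
  cost \<open>sqrt K\<close> per round and a logarithmic loss in total. The loss disappears since sparse sets have fewer rich
  blocks: if \<open>X\<close> has density \<open>\<theta>\<close>, the count improves by a power of \<open>\<theta>\<close>. To see this, count the pairs
  \<open>x, x + k b\<close> in \<open>X\<close>. Cauchy--Schwarz in a coordinate where the rows of \<open>X\<close> are sparse reduces this to counting pairs
  \<open>x, x + k j\<close> in sparse one-dimensional sets, and a second Cauchy--Schwarz to the solutions of \<open>k j - k' j' = v\<close>,
  which are few unless \<open>gcd j j'\<close> is large. The costs of the rounds then form a geometric series.\<close>

text \<open>The entropy argument only asks for a total cost of at most \<open>card X / 4\<close>, so
  a round is governed by one critical block size: the \<open>Q\<close> at which the number of blocks
  is comparable to \<open>card X\<close>. Much smaller blocks get a tolerance well above the square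
  root of their size, much larger ones a tolerance below it, and both tails sum geometrically. A
  factor \<zeta> saved in the block count thus acts as a shift of \<open>Q\<close> from
  \<open>K\<close> to \<open>\<xi> * K\<close>, where \<open>\<xi> ^ (d + 2) = \<zeta>\<close>. A
  sparse set may have full rows in all coordinates but one, as a thin slab does. No coordinate can
  be fixed beforehand, so the set is divided according to a coordinate in which its rows are sparse.
  The exponent 16 pays for the losses of the count: rows of size \<open>\<zeta> ^ 16 * N\<close>
  against a gcd threshold of order \<open>1 / \<zeta> ^ 8\<close> leave \<open>\<zeta> ^ 8\<close>,
  two square roots leave \<open>\<zeta> ^ 2\<close>, and one factor \<zeta> is spent because only
  directions of norm above \<open>\<zeta> * R\<close> are counted this way, which makes multipliers
  up to \<open>s / \<zeta>\<close> possible.\<close>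

section \<open>Partial colorings\<close>

text \<open>Gibbs' inequality for the distribution of \<open>v\<close> against an arbitrary \<open>q\<close>. With a product
  weight \<open>q\<close> this replaces the subadditivity of entropy.\<close>

lemma gibbs_pigeonhole:
  fixes v :: "'a \<Rightarrow> 'b" and q :: "'b \<Rightarrow> real"
  assumes fin: "finite \<Omega>" and ne: "\<Omega> \<noteq> {}"
    and pos: "\<And>w. w \<in> \<Omega> \<Longrightarrow> q (v w) > 0"
    and le1: "(\<Sum>u\<in>v ` \<Omega>. q u) \<le> 1"
  obtains w0 where "w0 \<in> \<Omega>"
    "ln (card \<Omega>) + (\<Sum>w\<in>\<Omega>. ln (q (v w))) / card \<Omega> \<le> ln (card {w \<in> \<Omega>. v w = v w0})"
proof -
  define n where "n w = real (card {w' \<in> \<Omega>. v w' = v w})" for w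
  define T where "T = real (card \<Omega>)"
  have T: "T > 0" using fin ne by (simp add: T_def card_gt_0_iff)
  have n: "n w > 0" if "w \<in> \<Omega>" for w
    using that fin by (auto simp: n_def card_gt_0_iff)
  have "(\<Sum>w\<in>\<Omega>. q (v w) / n w) = (\<Sum>u\<in>v ` \<Omega>. \<Sum>w\<in>{w \<in> \<Omega>. v w = u}. q (v w) / n w)"
    using sum.image_gen[OF fin, of "\<lambda>w. q (v w) / n w" v] by simp
  also have "\<dots> = (\<Sum>u\<in>v ` \<Omega>. q u)"
  proof (rule sum.cong[OF refl])
    fix u assume "u \<in> v ` \<Omega>"
    then obtain w0 where w0: "w0 \<in> \<Omega>" "u = v w0" by auto
    have "(\<Sum>w\<in>{w \<in> \<Omega>. v w = u}. q (v w) / n w) = (\<Sum>w\<in>{w \<in> \<Omega>. v w = u}. q u / n w0)"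
      by (rule sum.cong) (auto simp: n_def w0)
    also have "\<dots> = n w0 * (q u / n w0)" by (simp add: n_def w0)
    finally show "(\<Sum>w\<in>{w \<in> \<Omega>. v w = u}. q (v w) / n w) = q u"
      using n[OF w0(1)] by simp
  qed
  finally have s1: "(\<Sum>w\<in>\<Omega>. q (v w) / n w) \<le> 1" using le1 by simp
  have "(\<Sum>w\<in>\<Omega>. ln T + ln (q (v w)) - ln (n w)) \<le> (\<Sum>w\<in>\<Omega>. T * (q (v w) / n w) - 1)"
  proof (rule sum_mono)
    fix w assume w: "w \<in> \<Omega>"
    have "ln T + ln (q (v w)) - ln (n w) = ln (T * (q (v w) / n w))"
      using pos[OF w] n[OF w] T by (simp add: ln_mult ln_div)
    also have "\<dots> \<le> T * (q (v w) / n w) - 1"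
      using pos[OF w] n[OF w] T by (intro ln_le_minus_one) auto
    finally show "ln T + ln (q (v w)) - ln (n w) \<le> T * (q (v w) / n w) - 1" .
  qed
  also have "\<dots> = T * (\<Sum>w\<in>\<Omega>. q (v w) / n w) - T"
    by (simp add: sum_subtractf sum_distrib_left T_def)
  also have "\<dots> \<le> 0" using s1 T by simp
  finally have main: "(\<Sum>w\<in>\<Omega>. ln T + ln (q (v w)) - ln (n w)) \<le> 0" .
  have "\<exists>w\<in>\<Omega>. ln T + (\<Sum>w\<in>\<Omega>. ln (q (v w))) / T \<le> ln (n w)"
  proof (rule ccontr)
    assume "\<not> ?thesis"
    then have "(\<Sum>w\<in>\<Omega>. ln (n w)) < (\<Sum>w\<in>\<Omega>. ln T + (\<Sum>w\<in>\<Omega>. ln (q (v w))) / T)"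
      by (intro sum_strict_mono fin ne) auto
    also have "\<dots> = T * ln T + (\<Sum>w\<in>\<Omega>. ln (q (v w)))"
      using T by (simp add: T_def[symmetric] distrib_left)
    finally show False using main
      by (simp add: sum.distrib sum_subtractf T_def[symmetric])
  qed
  then show ?thesis using that by (auto simp: T_def n_def)
qed

section \<open>Random signs: Hamming balls, moments of signed sums, entropy of their
  roundings\<close>

definition signs :: "'a set \<Rightarrow> ('a \<Rightarrow> int) set" where
  "signs X = PiE X (\<lambda>_. {1, -1})"

lemma finite_signs: "finite X \<Longrightarrow> finite (signs X)"
  unfolding signs_def by (rule finite_PiE) auto

lemma card_signs: "finite X \<Longrightarrow> card (signs X) = 2 ^ card X"
  unfolding signs_def by (subst card_PiE) (auto simp: numeral_2_eq_2)

lemma sum_signs_prod: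
  fixes f :: "'a \<Rightarrow> int \<Rightarrow> real"
  assumes "finite X"
  shows "(\<Sum>c\<in>signs X. \<Prod>x\<in>X. f x (c x)) = (\<Prod>x\<in>X. f x 1 + f x (-1))"
  unfolding signs_def
  by (subst prod_sum_PiE[symmetric]) (use assms in auto)

text \<open>Markov's inequality for the weight \<open>(1/4) ^ distance\<close>, whose total over all
  sign vectors factorizes into \<open>(1 + 1/4) ^ card X\<close>. Inside the ball every weight is at
  least \<open>4 powr (- (card X / 10))\<close>.\<close>

lemma card_hamming_ball:
  assumes X: "finite X" and c0: "c0 \<in> signs X"
  shows "real (card {c \<in> signs X. 10 * card {x \<in> X. c x \<noteq> c0 x} \<le> card X})
           \<le> (5/4) ^ card X * 4 powr (card X / 10)"
proof -
  let ?D = "\<lambda>c. card {x \<in> X. c x \<noteq> c0 x}"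
  let ?H = "{c \<in> signs X. 10 * ?D c \<le> card X}"
  have c0v: "c0 x = 1 \<or> c0 x = -1" if "x \<in> X" for x
    using c0 that by (auto simp: signs_def)
  have pr: "(\<Prod>x\<in>X. if c x \<noteq> c0 x then 1/4 else (1::real)) = (1/4) ^ ?D c" for c
    using X by (simp add: prod.If_cases Int_def)
  have "(\<Sum>c\<in>signs X. (1/4::real) ^ ?D c) = (\<Prod>x\<in>X. 5/4)"
    unfolding pr[symmetric] sum_signs_prod[OF X, of "\<lambda>x s. if s \<noteq> c0 x then 1/4 else 1"]
    by (rule prod.cong) (use c0v in force)+
  also have "\<dots> = (5/4) ^ card X" by simp
  finally have tot: "(\<Sum>c\<in>signs X. (1/4::real) ^ ?D c) = (5/4) ^ card X" .
  have "real (card ?H) * 4 powr (- (card X / 10)) = (\<Sum>c\<in>?H. 4 powr (- (card X / 10)))"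
    by simp
  also have "\<dots> \<le> (\<Sum>c\<in>?H. (1/4) ^ ?D c)"
  proof (rule sum_mono)
    fix c assume "c \<in> ?H"
    then have "real (?D c) \<le> card X / 10" by auto
    then have "4 powr (- (card X / 10)) \<le> 4 powr (- real (?D c))" by simp
    also have "\<dots> = (1/4) ^ ?D c" by (simp add: powr_minus powr_realpow power_divide inverse_eq_divide)
    finally show "4 powr (- (card X / 10)) \<le> (1/4) ^ ?D c" .
  qed
  also have "\<dots> \<le> (\<Sum>c\<in>signs X. (1/4) ^ ?D c)"
    using finite_signs[OF X] by (intro sum_mono2) auto
  finally have "real (card ?H) * 4 powr (- (card X / 10)) \<le> (5/4) ^ card X" using tot by simp
  then show ?thesis
    by (simp add: powr_minus field_simps)
qed

text \<open>Termwise comparison of power series, by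
  \<open>2 ^ n * fact n \<le> fact (2 * n)\<close>. This is the subgaussian bound for a single
  random sign.\<close>

lemma cosh_le_exp_half_square: "cosh x \<le> exp (x\<^sup>2 / 2)" for x :: real
proof -
  have f: "(\<lambda>n. if even n then x ^ n /\<^sub>R fact n else 0) sums cosh x"
    using cosh_converges[of x] by simp
  have ev: "(\<lambda>n. x ^ (2*n) /\<^sub>R fact (2*n)) sums cosh x"
  proof -
    have "strict_mono (\<lambda>n::nat. 2*n)" by (auto simp: strict_mono_def)
    moreover have "(if even n then x ^ n /\<^sub>R fact n else 0) = 0" if "n \<notin> range (\<lambda>n::nat. 2*n)" for n
      using that by (auto elim: evenE)
    ultimately show ?thesis
      using sums_mono_reindex[of "\<lambda>n::nat. 2*n" "\<lambda>n. if even n then x ^ n /\<^sub>R fact n else 0" "cosh x"] f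
      by simp
  qed
  have ex: "(\<lambda>n. (x\<^sup>2/2) ^ n /\<^sub>R fact n) sums exp (x\<^sup>2/2)" by (rule exp_converges)
  have fc: "(2::real)^n * fact n \<le> fact (2*n)" for n
  proof (induction n)
    case (Suc n)
    have "(2::real)^Suc n * fact (Suc n) = 2 * real (Suc n) * (2^n * fact n)"
      by (simp add: algebra_simps)
    also have "\<dots> \<le> 2 * real (Suc n) * fact (2*n)" by (intro mult_left_mono Suc) auto
    also have "\<dots> \<le> fact (2 * Suc n)"
    proof -
      have "fact (2 * Suc n) = real (2*n+2) * (real (2*n+1) * fact (2*n))" by (simp add: algebra_simps)
      moreover have "real (2*n+2) * (1 * fact (2*n)) \<le> real (2*n+2) * (real (2*n+1) * fact (2*n))"
        by (intro mult_left_mono mult_right_mono) auto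
      ultimately show ?thesis by (simp add: algebra_simps)
    qed
    finally show ?case .
  qed simp
  show ?thesis
  proof (rule sums_le[OF _ ev ex])
    fix n
    have "x ^ (2*n) / fact (2*n) \<le> x ^ (2*n) / (2^n * fact n)"
      using fc[of n] by (intro divide_left_mono) (auto simp: power_mult)
    also have "\<dots> = (x\<^sup>2/2) ^ n / fact n"
      by (simp add: power_divide power_mult)
    finally show "x ^ (2*n) /\<^sub>R fact (2*n) \<le> (x\<^sup>2/2) ^ n /\<^sub>R fact n"
      by (simp only: real_scaleR_def divide_inverse mult.commute)
  qed
qed

lemma power_le_fact_exp: "x ^ p \<le> fact p * exp x" if "x \<ge> 0" for x :: real
proof -
  have "(\<Sum>n\<in>{p}. x ^ n /\<^sub>R fact n) \<le> (\<Sum>n. x ^ n /\<^sub>R fact n)"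
    by (rule sum_le_suminf) (use that summable_exp_generic[of x] in auto)
  also have "\<dots> = exp x" by (simp add: exp_def)
  finally show ?thesis by (simp add: field_simps)
qed

text \<open>Exponential moments at the natural scale \<open>t = 1 / sqrt (card S)\<close>: there
  \<open>cosh t ^ card S\<close> is at most \<open>exp (1/2) \<le> 2\<close>, and a power is
  dominated by \<open>fact p\<close> times an exponential. The factor 4 is this 2, taken for both
  signs of \<open>t\<close>.\<close>

lemma sign_sum_moment:
  assumes X: "finite X" and S: "S \<subseteq> X" "S \<noteq> {}"
  shows "(\<Sum>c\<in>signs X. \<bar>real_of_int (\<Sum>x\<in>S. c x)\<bar> ^ p)
           \<le> 2 ^ card X * (4 * fact p * sqrt (card S) ^ p)"
proof -
  define t where "t = 1 / sqrt (card S)"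
  have fS: "finite S" using S X finite_subset by auto
  have t: "t > 0" using S fS by (simp add: t_def card_gt_0_iff)
  define Z where "Z c = real_of_int (\<Sum>x\<in>S. c x)" for c
  have mgf: "(\<Sum>c\<in>signs X. exp (e * Z c)) \<le> 2 ^ card X * 2" if e: "e\<^sup>2 = t\<^sup>2" for e
  proof -
    have "exp (e * Z c) = (\<Prod>x\<in>X. if x \<in> S then exp (e * c x) else 1)" for c
    proof -
      have "exp (e * Z c) = (\<Prod>x\<in>S. exp (e * c x))"
        by (simp add: Z_def sum_distrib_left exp_sum fS)
      also have "\<dots> = (\<Prod>x\<in>X. if x \<in> S then exp (e * c x) else 1)"
        using S X by (intro prod.mono_neutral_cong_left) auto
      finally show ?thesis .
    qed
    then have "(\<Sum>c\<in>signs X. exp (e * Z c)) =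
        (\<Prod>x\<in>X. (if x \<in> S then exp (e * real_of_int 1) else 1) + (if x \<in> S then exp (e * real_of_int (-1)) else 1))"
      using sum_signs_prod[OF X, of "\<lambda>x s. if x \<in> S then exp (e * real_of_int s) else 1"] by simp
    also have "\<dots> = (\<Prod>x\<in>X. 2 * (if x \<in> S then cosh e else 1))"
      by (rule prod.cong) (auto simp: cosh_def)
    also have "\<dots> = 2 ^ card X * cosh e ^ card S"
      using S X by (simp add: prod.distrib prod.If_cases Int_absorb1 Int_def[symmetric])
    also have "cosh e ^ card S \<le> exp (e\<^sup>2 / 2) ^ card S"
      by (intro power_mono cosh_le_exp_half_square cosh_real_nonneg)
    also have "exp (e\<^sup>2 / 2) ^ card S = exp (1/2)"
      using S fS by (simp add: e t_def exp_of_nat_mult[symmetric] power_divide card_gt_0_iff)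
    also have "exp (1/2::real) \<le> 2"
    proof -
      have "exp (1/2::real) ^ 2 = exp 1" by (simp add: exp_of_nat_mult[symmetric])
      also have "\<dots> \<le> 2\<^sup>2" using exp_le by simp
      finally show ?thesis by (rule power2_le_imp_le) simp
    qed
    finally show ?thesis by simp
  qed
  have "(\<Sum>c\<in>signs X. \<bar>Z c\<bar> ^ p) \<le> (\<Sum>c\<in>signs X. fact p / t ^ p * (exp (t * Z c) + exp ((- t) * Z c)))"
  proof (rule sum_mono)
    fix c
    have "(t * \<bar>Z c\<bar>) ^ p \<le> fact p * exp (t * \<bar>Z c\<bar>)" using t by (intro power_le_fact_exp) auto
    also have "exp (t * \<bar>Z c\<bar>) \<le> exp (t * Z c) + exp ((- t) * Z c)"
      by (cases "Z c \<ge> 0") auto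
    finally show "\<bar>Z c\<bar> ^ p \<le> fact p / t ^ p * (exp (t * Z c) + exp ((- t) * Z c))"
      using t by (simp add: power_mult_distrib field_simps)
  qed
  also have "\<dots> = fact p / t ^ p * ((\<Sum>c\<in>signs X. exp (t * Z c)) + (\<Sum>c\<in>signs X. exp ((- t) * Z c)))"
    by (simp only: sum_distrib_left[symmetric] sum.distrib)
  also have "\<dots> \<le> fact p / t ^ p * (2 ^ card X * 2 + 2 ^ card X * 2)"
    using t by (intro mult_left_mono add_mono mgf) auto
  also have "\<dots> = 2 ^ card X * (4 * fact p * sqrt (card S) ^ p)"
    by (simp add: t_def power_divide field_simps)
  finally show ?thesis by (simp add: Z_def)
qed

text \<open>The weight \<open>q\<close> is a probability distribution on the integers with mass
  \<epsilon> away from 0, hence admissible in Gibbs' inequality. As \<open>- ln (q k)\<close> grows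
  only linearly in \<open>k\<close>, moments of the rounded value control its cost.\<close>

lemma two_sided_geometric_sum:
  fixes \<epsilon> :: real
  defines "q \<equiv> \<lambda>k::int. if k = 0 then 1 - \<epsilon> else \<epsilon> / 2 * (1/2) ^ nat \<bar>k\<bar>"
  shows "(\<Sum>k\<in>{- int n..int n}. q k) = 1 - \<epsilon> * (1/2) ^ n"
proof (induction n)
  case (Suc n)
  have "{- int (Suc n)..int (Suc n)} = insert (- int (Suc n)) (insert (int (Suc n)) {- int n..int n})"
    by auto
  then have "(\<Sum>k\<in>{- int (Suc n)..int (Suc n)}. q k)
      = q (- int (Suc n)) + (q (int (Suc n)) + (\<Sum>k\<in>{- int n..int n}. q k))"
    by simp
  also have "\<dots> = 1 - \<epsilon> * (1/2) ^ Suc n"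
    unfolding Suc by (simp add: q_def field_simps nat_add_distrib)
  finally show ?case .
qed (simp add: q_def)

text \<open>The 13 is what tolerances below one standard deviation produce; the other summand
  collects the moment of order \<open>p + 1\<close> used for larger tolerances.\<close>

definition round_const :: "nat \<Rightarrow> real" where
  "round_const p = 13 + 4 * (3 + p) * fact (p + 1)"

lemma round_const_pos: "round_const p > 0"
  by (simp add: round_const_def add_pos_nonneg)

text \<open>Here \<open>v\<close> rounds to the nearest multiple of \<open>2 * \<Delta>\<close>, and
  \<open>l\<close> is the tolerance in standard deviations. For large \<open>l\<close> the rounding
  is mostly 0, so a weight concentrated at 0 is cheap. For small \<open>l\<close> the bound
  \<open>1 / l\<close> is cruder than a logarithm, but it is only summed over dyadic sizes.\<close>

lemma rounding_cost:
  assumes X: "finite X" and S: "S \<subseteq> X" "S \<noteq> {}" and D: "\<Delta> > 0" and p: "p \<ge> 1"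
  defines "l \<equiv> \<Delta> / sqrt (card S)"
  defines "v \<equiv> \<lambda>c. \<lfloor>real_of_int (\<Sum>x\<in>S. c x) / (2 * \<Delta>) + 1/2\<rfloor>"
  obtains q :: "int \<Rightarrow> real" where "\<And>k. q k > 0" "\<And>F. finite F \<Longrightarrow> sum q F \<le> 1"
    "(\<Sum>c\<in>signs X. - ln (q (v c)))
       \<le> 2 ^ card X * (if l \<le> 1 then round_const p / l else round_const p / l ^ p)"
proof -
  have fS: "finite S" using S X finite_subset by auto
  have l: "l > 0" using S fS D by (simp add: l_def card_gt_0_iff)
  \<comment> \<open>The value 0 costs about \<epsilon>, so for \<open>l > 1\<close> the mass off
    zero is given the order \<open>1 / l ^ p\<close> that the conclusion allows.\<close>
  define \<epsilon> where "\<epsilon> = (if l \<le> 1 then 1/2 else 1 / (2 * l ^ p))"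
  have lp: "l ^ p \<ge> 1" if "\<not> l \<le> 1" using that by simp
  have e: "0 < \<epsilon>" "\<epsilon> \<le> 1/2" using l lp by (auto simp: \<epsilon>_def field_simps)
  define q where "q = (\<lambda>k::int. if k = 0 then 1 - \<epsilon> else \<epsilon> / 2 * (1/2) ^ nat \<bar>k\<bar>)"
  have qpos: "q k > 0" for k using e by (auto simp: q_def)
  have qsum: "sum q F \<le> 1" if F: "finite F" for F
  proof -
    define n where "n = (\<Sum>k\<in>F. nat \<bar>k\<bar>)"
    have "F \<subseteq> {- int n..int n}"
    proof
      fix k assume "k \<in> F"
      then have "nat \<bar>k\<bar> \<le> n" unfolding n_def using F by (intro member_le_sum) auto
      then show "k \<in> {- int n..int n}" by auto
    qed
    then have "sum q F \<le> (\<Sum>k\<in>{- int n..int n}. q k)"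
      by (intro sum_mono2) (use qpos less_imp_le in auto)
    also have "\<dots> = 1 - \<epsilon> * (1/2) ^ n" unfolding q_def by (rule two_sided_geometric_sum)
    also have "\<dots> \<le> 1" using e by simp
    finally show ?thesis .
  qed
  define Z where "Z c = real_of_int (\<Sum>x\<in>S. c x)" for c
  have v: "v c = \<lfloor>Z c / (2 * \<Delta>) + 1/2\<rfloor>" for c by (simp add: v_def Z_def)
  \<comment> \<open>A nonzero rounding forces \<open>\<bar>Z c\<bar> \<ge> \<Delta>\<close>, so
    raising the ratio to the power \<open>r\<close> only enlarges it. Thus a moment of any order
    bounds the mean of \<open>\<bar>v c\<bar>\<close>.\<close>
  have vle: "\<bar>real_of_int (v c)\<bar> \<le> (\<bar>Z c\<bar> / \<Delta>) ^ r" if r: "r \<ge> 1" for c r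
  proof (cases "v c = 0")
    case False
    define z where "z = Z c / (2 * \<Delta>)"
    have vz: "v c = \<lfloor>z + 1/2\<rfloor>" by (simp add: v z_def)
    have b: "real_of_int (v c) \<le> z + 1/2" "z + 1/2 < real_of_int (v c) + 1"
      unfolding vz by linarith+
    have "v c \<ge> 1 \<or> v c \<le> -1" using False by linarith
    then have 1: "1 \<le> 2 * \<bar>z\<bar> \<and> \<bar>real_of_int (v c)\<bar> \<le> 2 * \<bar>z\<bar>"
      using b by (auto simp: abs_if)
    have z2: "2 * \<bar>z\<bar> = \<bar>Z c\<bar> / \<Delta>" using D by (simp add: z_def abs_divide abs_mult)
    have "\<bar>real_of_int (v c)\<bar> \<le> \<bar>Z c\<bar> / \<Delta>" "1 \<le> \<bar>Z c\<bar> / \<Delta>" using 1 z2 by auto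
    moreover have "\<bar>Z c\<bar> / \<Delta> \<le> (\<bar>Z c\<bar> / \<Delta>) ^ r"
      using \<open>1 \<le> \<bar>Z c\<bar> / \<Delta>\<close> r by (intro self_le_power) auto
    ultimately show ?thesis by linarith
  qed (use D in auto)
  have avg: "(\<Sum>c\<in>signs X. \<bar>real_of_int (v c)\<bar>) \<le> 2 ^ card X * (4 * fact r / l ^ r)" if r: "r \<ge> 1" for r
  proof -
    have "(\<Sum>c\<in>signs X. \<bar>real_of_int (v c)\<bar>) \<le> (\<Sum>c\<in>signs X. \<bar>Z c\<bar> ^ r / \<Delta> ^ r)"
      using vle[OF r] by (intro sum_mono) (simp add: power_divide)
    also have "\<dots> = (\<Sum>c\<in>signs X. \<bar>Z c\<bar> ^ r) / \<Delta> ^ r" by (simp add: sum_divide_distrib)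
    also have "\<dots> \<le> 2 ^ card X * (4 * fact r * sqrt (card S) ^ r) / \<Delta> ^ r"
      unfolding Z_def using D sign_sum_moment[OF X S] by (intro divide_right_mono) auto
    also have "\<dots> = 2 ^ card X * (4 * fact r / l ^ r)"
      using D by (simp add: l_def power_divide)
    finally show ?thesis .
  qed
  have lnq: "- ln (q k) \<le> 2 * \<epsilon> + (ln (2 / \<epsilon>) + 1) * \<bar>real_of_int k\<bar>" for k
  proof (cases "k = 0")
    case True
    have "- \<epsilon> - 2 * \<epsilon>\<^sup>2 \<le> ln (1 - \<epsilon>)" using e by (intro ln_one_minus_pos_lower_bound) auto
    moreover have "2 * \<epsilon>\<^sup>2 \<le> \<epsilon>" using e by (simp add: power2_eq_square)
    ultimately show ?thesis using True by (simp add: q_def)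
  next
    case False
    have "ln (q k) = ln (\<epsilon> / 2) + ln ((1/2) ^ nat \<bar>k\<bar>)"
    proof -
      have "ln (\<epsilon> / 2 * (1/2) ^ nat \<bar>k\<bar>) = ln (\<epsilon> / 2) + ln ((1/2) ^ nat \<bar>k\<bar>)"
        using e by (intro ln_mult_pos) auto
      then show ?thesis using False by (simp add: q_def)
    qed
    also have "ln ((1/2::real) ^ nat \<bar>k\<bar>) = - (\<bar>real_of_int k\<bar> * ln 2)"
      by (simp add: ln_realpow ln_div)
    also have "ln (\<epsilon> / 2) = - ln (2 / \<epsilon>)" using e by (simp add: ln_div)
    finally have 1: "- ln (q k) = ln (2 / \<epsilon>) + \<bar>real_of_int k\<bar> * ln 2" by simp
    have k1: "1 \<le> \<bar>real_of_int k\<bar>" using False by linarith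
    have "0 \<le> ln (2 / \<epsilon>)" using e by (intro ln_ge_zero) (auto simp: field_simps)
    then have "ln (2 / \<epsilon>) * 1 \<le> ln (2 / \<epsilon>) * \<bar>real_of_int k\<bar>" using k1 by (intro mult_left_mono)
    moreover have "\<bar>real_of_int k\<bar> * ln 2 \<le> \<bar>real_of_int k\<bar> * 1"
      using ln_2_less_1 by (intro mult_left_mono) auto
    ultimately have "ln (2 / \<epsilon>) + \<bar>real_of_int k\<bar> * ln 2
        \<le> ln (2 / \<epsilon>) * \<bar>real_of_int k\<bar> + 1 * \<bar>real_of_int k\<bar>" by linarith
    then show ?thesis unfolding 1 distrib_right using e by linarith
  qed
  have ln4: "ln (4::real) \<le> 2"
    using ln_realpow[of 2 2] ln_2_less_1 by simp
  have tot: "(\<Sum>c\<in>signs X. - ln (q (v c)))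
      \<le> 2 ^ card X * (2 * \<epsilon>) + (ln (2 / \<epsilon>) + 1) * (\<Sum>c\<in>signs X. \<bar>real_of_int (v c)\<bar>)"
  proof -
    have "(\<Sum>c\<in>signs X. - ln (q (v c))) \<le> (\<Sum>c\<in>signs X. 2 * \<epsilon> + (ln (2 / \<epsilon>) + 1) * \<bar>real_of_int (v c)\<bar>)"
      by (intro sum_mono lnq)
    then show ?thesis by (simp add: sum.distrib sum_distrib_left card_signs X)
  qed
  have fin: "(\<Sum>c\<in>signs X. - ln (q (v c)))
       \<le> 2 ^ card X * (if l \<le> 1 then round_const p / l else round_const p / l ^ p)"
  proof (cases "l \<le> 1")
    case True
    then have e2: "\<epsilon> = 1/2" by (simp add: \<epsilon>_def)
    have "(\<Sum>c\<in>signs X. - ln (q (v c))) \<le> 2 ^ card X * 1 + (ln 4 + 1) * (2 ^ card X * (4 / l))"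
    proof -
      have "(ln 4 + 1) * (\<Sum>c\<in>signs X. \<bar>real_of_int (v c)\<bar>) \<le> (ln 4 + 1) * (2 ^ card X * (4 / l))"
        using avg[of 1] by (intro mult_left_mono) auto
      then show ?thesis using tot by (simp add: e2)
    qed
    also have "\<dots> \<le> 2 ^ card X * (1 / l) + 3 * (2 ^ card X * (4 / l))"
      using True l ln4 by (intro add_mono mult_left_mono mult_right_mono) auto
    also have "\<dots> = 2 ^ card X * (13 / l)" by (simp add: field_simps)
    also have "\<dots> \<le> 2 ^ card X * (round_const p / l)"
      using l by (intro mult_left_mono divide_right_mono) (auto simp: round_const_def)
    finally show ?thesis using True by simp
  next
    case False
    then have l1: "l > 1" by simp
    have e2: "\<epsilon> = 1 / (2 * l ^ p)" using False by (simp add: \<epsilon>_def)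
    \<comment> \<open>The logarithm of \<open>1 / \<epsilon>\<close> costs one factor
      \<open>l\<close>; the moment of order \<open>p + 1\<close> makes up for it.\<close>
    have "ln (2 / \<epsilon>) + 1 = ln 4 + p * ln l + 1"
      using l by (simp add: e2 ln_mult ln_realpow)
    also have "\<dots> \<le> 3 + p * l"
    proof -
      have "p * ln l \<le> p * l" using ln_less_self[OF l] by (intro mult_left_mono) auto
      then show ?thesis using ln4 by linarith
    qed
    also have "\<dots> \<le> 3 * l + p * l" using l1 by simp
    finally have le: "ln (2 / \<epsilon>) + 1 \<le> (3 + p) * l" by (simp add: algebra_simps)
    have "(\<Sum>c\<in>signs X. - ln (q (v c)))
      \<le> 2 ^ card X * (1 / l ^ p) + ((3 + p) * l) * (2 ^ card X * (4 * fact (p + 1) / l ^ (p + 1)))"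
    proof -
      have "(ln (2 / \<epsilon>) + 1) * (\<Sum>c\<in>signs X. \<bar>real_of_int (v c)\<bar>)
          \<le> ((3 + p) * l) * (2 ^ card X * (4 * fact (p + 1) / l ^ (p + 1)))"
        using le avg[of "p+1"] l by (intro mult_mono) (auto intro!: sum_nonneg)
      then show ?thesis using tot by (simp add: e2)
    qed
    also have "\<dots> = 2 ^ card X * ((1 + 4 * (3 + p) * fact (p + 1)) / l ^ p)"
      using l by (simp add: field_simps)
    also have "\<dots> \<le> 2 ^ card X * (round_const p / l ^ p)"
      using l by (intro mult_left_mono divide_right_mono) (auto simp: round_const_def)
    finally show ?thesis using False by simp
  qed
  show ?thesis by (rule that[OF qpos qsum fin])
qed

text \<open>Two colorings in a large class with equal roundings of all set sums are subtracted and halved.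
  The constants \<open>1/4\<close> and \<open>1/10\<close> are such that \<open>(5/4) * 4 powr (1/10) * exp (1/4) < 2\<close>, so that the class does not
  fit into a Hamming ball.\<close>

lemma partial_coloring:
  fixes \<Delta> w :: "'a set \<Rightarrow> real"
  assumes X: "finite X" "X \<noteq> {}" and F: "finite F" "\<And>S. S \<in> F \<Longrightarrow> S \<subseteq> X \<and> S \<noteq> {} \<and> \<Delta> S > 0"
    and p: "p \<ge> 1"
    and w: "\<And>S. S \<in> F \<Longrightarrow> (let l = \<Delta> S / sqrt (card S) in
               if l \<le> 1 then round_const p / l else round_const p / l ^ p) \<le> w S"
    and sw: "(\<Sum>S\<in>F. w S) \<le> card X / 4"
  obtains c :: "'a \<Rightarrow> int" where "\<And>x. c x \<in> {-1, 0, 1}" "\<And>x. x \<notin> X \<Longrightarrow> c x = 0"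
    "card X \<le> 10 * card {x \<in> X. c x \<noteq> 0}"
    "\<And>S. S \<in> F \<Longrightarrow> \<bar>real_of_int (\<Sum>x\<in>S. c x)\<bar> \<le> \<Delta> S"
proof -
  define m where "m = card X"
  have m: "m \<ge> 1" using X by (simp add: m_def Suc_le_eq card_gt_0_iff)
  define v where "v c S = \<lfloor>real_of_int (\<Sum>x\<in>S. c x) / (2 * \<Delta> S) + 1/2\<rfloor>" for c :: "'a \<Rightarrow> int" and S
  have "\<exists>q::int \<Rightarrow> real. (\<forall>k. q k > 0) \<and> (\<forall>G. finite G \<longrightarrow> sum q G \<le> 1) \<and>
          (\<Sum>c\<in>signs X. - ln (q (v c S))) \<le> 2 ^ m * w S" if "S \<in> F" for S
  proof -
    have S: "S \<subseteq> X" "S \<noteq> {}" "\<Delta> S > 0" using F(2)[OF that] by auto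
    from rounding_cost[OF X(1) S p] obtain q :: "int \<Rightarrow> real" where
      q: "\<And>k. q k > 0" "\<And>F. finite F \<Longrightarrow> sum q F \<le> 1"
      "(\<Sum>c\<in>signs X. - ln (q (v c S))) \<le> 2 ^ card X * (if \<Delta> S / sqrt (card S) \<le> 1
          then round_const p / (\<Delta> S / sqrt (card S)) else round_const p / (\<Delta> S / sqrt (card S)) ^ p)"
      unfolding v_def by blast
    have "(if \<Delta> S / sqrt (card S) \<le> 1
          then round_const p / (\<Delta> S / sqrt (card S)) else round_const p / (\<Delta> S / sqrt (card S)) ^ p) \<le> w S"
      using w[OF that] by (simp only: Let_def)
    from mult_left_mono[OF this, of "2 ^ m"] have
      "(\<Sum>c\<in>signs X. - ln (q (v c S))) \<le> 2 ^ m * w S"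
      using q(3) by (simp only: m_def) (smt (verit) zero_le_power)
    then show ?thesis using q(1,2) by blast
  qed
  then obtain q :: "'a set \<Rightarrow> int \<Rightarrow> real" where
    q: "\<And>S k. S \<in> F \<Longrightarrow> q S k > 0" "\<And>S G. S \<in> F \<Longrightarrow> finite G \<Longrightarrow> sum (q S) G \<le> 1"
      "\<And>S. S \<in> F \<Longrightarrow> (\<Sum>c\<in>signs X. - ln (q S (v c S))) \<le> 2 ^ m * w S"
    by metis
  define vv where "vv c = restrict (v c) F" for c
  define qq where "qq u = (\<Prod>S\<in>F. q S (u S))" for u
  have fO: "finite (signs X)" using X by (simp add: finite_signs)
  have neO: "signs X \<noteq> {}" using card_signs[OF X(1)] by auto
  \<comment> \<open>Enlarging the set of attained tuples to a full product set lets the total of the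
    product weight factorize, with each factor at most 1.\<close>
  have "(\<Sum>u\<in>vv ` signs X. qq u) \<le> (\<Sum>u\<in>PiE F (\<lambda>S. (\<lambda>c. v c S) ` signs X). qq u)"
    by (rule sum_mono2) (use F(1) fO q(1) in \<open>auto intro!: finite_PiE prod_nonneg simp: vv_def qq_def less_imp_le\<close>)
  also have "\<dots> = (\<Prod>S\<in>F. \<Sum>k\<in>(\<lambda>c. v c S) ` signs X. q S k)"
    unfolding qq_def using F(1) fO by (subst prod_sum_PiE) auto
  also have "\<dots> \<le> 1"
    by (rule prod_le_1) (use q fO in \<open>auto intro!: sum_nonneg simp: less_imp_le\<close>)
  finally have le1: "(\<Sum>u\<in>vv ` signs X. qq u) \<le> 1" .
  obtain c0 where c0: "c0 \<in> signs X"
    "ln (card (signs X)) + (\<Sum>c\<in>signs X. ln (qq (vv c))) / card (signs X)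
        \<le> ln (card {c \<in> signs X. vv c = vv c0})"
    by (rule gibbs_pigeonhole[OF fO neO _ le1]) (auto simp: qq_def vv_def intro!: prod_pos q(1))
  let ?cl = "{c \<in> signs X. vv c = vv c0}"
  have "(\<Sum>c\<in>signs X. - ln (qq (vv c))) = (\<Sum>c\<in>signs X. \<Sum>S\<in>F. - ln (q S (v c S)))"
  proof (rule sum.cong[OF refl])
    fix c
    have "ln (\<Prod>S\<in>F. q S (v c S)) = (\<Sum>S\<in>F. ln (q S (v c S)))"
      using F(1) q(1) by (intro ln_prod) (auto simp: less_le)
    then show "- ln (qq (vv c)) = (\<Sum>S\<in>F. - ln (q S (v c S)))"
      by (simp add: qq_def vv_def sum_negf)
  qed
  also have "\<dots> = (\<Sum>S\<in>F. \<Sum>c\<in>signs X. - ln (q S (v c S)))" by (rule sum.swap)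
  also have "\<dots> \<le> (\<Sum>S\<in>F. 2 ^ m * w S)" by (intro sum_mono q(3))
  also have "\<dots> = 2 ^ m * (\<Sum>S\<in>F. w S)" by (simp add: sum_distrib_left)
  also have "\<dots> \<le> 2 ^ m * (m / 4)" using sw by (intro mult_left_mono) (auto simp: m_def)
  finally have "- (\<Sum>c\<in>signs X. ln (qq (vv c))) \<le> 2 ^ m * (m / 4)" by (simp add: sum_negf)
  then have "- (m/4) \<le> (\<Sum>c\<in>signs X. ln (qq (vv c))) / 2 ^ m" by (simp add: field_simps)
  then have "m * ln 2 - m / 4 \<le> ln (card ?cl)"
    using c0(2) by (simp add: card_signs X m_def[symmetric] ln_realpow)
  moreover have clpos: "card ?cl > 0" using c0(1) fO by (auto simp: card_gt_0_iff)
  ultimately have "exp (m * ln 2 - m / 4) \<le> card ?cl"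
    by (subst ln_ge_iff[symmetric]) auto
  \<comment> \<open>The rationals 23/20 and 4/3 bound \<open>4 powr (1/10)\<close> and
    \<open>exp (1/4)\<close> from above, and \<open>5/4 * 23/20 = 1.4375\<close> is still below
    \<open>2 / (4/3) = 1.5\<close>.\<close>
  have key: "(5/4) ^ m * 4 powr (m / 10) < exp (m * ln 2 - m / 4)"
  proof -
    have a: "(4::real) powr (1/10) \<le> 23/20"
    proof -
      have "((23/20::real) ^ 10) powr (1/10) = 23/20"
      proof -
        have "(23/20::real) ^ 10 = (23/20) powr 10" by (subst powr_realpow[symmetric]) auto
        then show ?thesis by (simp only: powr_powr) simp
      qed
      moreover have "(4::real) powr (1/10) \<le> ((23/20) ^ 10) powr (1/10)"
        by (rule powr_mono2) (auto simp: power_divide)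
      ultimately show ?thesis by simp
    qed
    have b: "exp (1/4::real) < 4/3"
    proof -
      have "exp (1/4::real) ^ 4 = exp 1" by (simp add: exp_of_nat_mult[symmetric])
      also have "\<dots> \<le> 3" by (rule exp_le)
      also have "(3::real) < (4/3) ^ 4" by (simp add: power_divide)
      finally show ?thesis by (rule power_less_imp_less_base) auto
    qed
    have "(4::real) powr (m / 10) = (4 powr (1/10)) ^ m"
      by (simp add: powr_realpow[symmetric] powr_powr)
    then have "(5/4) ^ m * 4 powr (m / 10) = (5/4 * 4 powr (1/10)) ^ m" by (simp only: power_mult_distrib)
    also have "\<dots> \<le> (5/4 * (23/20)) ^ m" using a by (intro power_mono mult_left_mono) auto
    also have "\<dots> < (2 / exp (1/4)) ^ m"
      using b m by (intro power_strict_mono) (auto simp: field_simps)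
    also have "\<dots> = exp (m * ln 2 - m / 4)"
      by (simp add: exp_diff power_divide exp_of_nat_mult[symmetric] exp_of_nat_mult)
    finally show ?thesis .
  qed
  let ?B = "{c \<in> signs X. 10 * card {x \<in> X. c x \<noteq> c0 x} \<le> card X}"
  have "real (card ?B) < card ?cl"
    using card_hamming_ball[OF X(1) c0(1)] key \<open>exp _ \<le> card ?cl\<close> by (simp add: m_def)
  then have "\<not> ?cl \<subseteq> ?B" using card_mono[of ?B ?cl] fO by auto
  then obtain c1 where "c1 \<in> ?cl" "c1 \<notin> ?B" by blast
  then have c1: "c1 \<in> signs X" "vv c1 = vv c0" "10 * card {x \<in> X. c1 x \<noteq> c0 x} > card X"
    by auto
  \<comment> \<open>Half the difference of two sign vectors has values in -1, 0, 1, and it is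
    nonzero exactly where they disagree.\<close>
  define c where "c x = (if x \<in> X then (c1 x - c0 x) div 2 else 0)" for x
  have pm: "c0 x \<in> {1,-1}" "c1 x \<in> {1,-1}" if "x \<in> X" for x
    using c0(1) c1(1) that by (auto simp: signs_def)
  have c2: "2 * c x = c1 x - c0 x" if "x \<in> X" for x using pm[OF that] that by (auto simp: c_def)
  show ?thesis
  proof
    show "c x \<in> {-1, 0, 1}" for x using pm[of x] by (auto simp: c_def)
    show "c x = 0" if "x \<notin> X" for x using that by (simp add: c_def)
    have "{x \<in> X. c x \<noteq> 0} = {x \<in> X. c1 x \<noteq> c0 x}" using c2 by force
    then show "card X \<le> 10 * card {x \<in> X. c x \<noteq> 0}" using c1(3) by simp
    fix S assume S: "S \<in> F"
    have SX: "S \<subseteq> X" "\<Delta> S > 0" using F(2)[OF S] by auto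
    have "v c1 S = v c0 S" using c1(2) S by (metis restrict_apply' vv_def)
    define z0 where "z0 = real_of_int (\<Sum>x\<in>S. c0 x) / (2 * \<Delta> S)"
    define z1 where "z1 = real_of_int (\<Sum>x\<in>S. c1 x) / (2 * \<Delta> S)"
    have "\<lfloor>z1 + 1/2\<rfloor> = \<lfloor>z0 + 1/2\<rfloor>" using \<open>v c1 S = v c0 S\<close> by (simp add: v_def z0_def z1_def)
    \<comment> \<open>Equal roundings put both sums into one cell of width
      \<open>2 * \<Delta> S\<close>; halving the difference leaves
      \<open>\<Delta> S\<close>.\<close>
    then have "\<bar>z1 - z0\<bar> < 1" by linarith
    moreover have "z1 - z0 = real_of_int (\<Sum>x\<in>S. c x) / \<Delta> S"
    proof -
      have "(\<Sum>x\<in>S. c1 x) - (\<Sum>x\<in>S. c0 x) = (\<Sum>x\<in>S. 2 * c x)"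
        unfolding sum_subtractf[symmetric] by (rule sum.cong) (use SX c2 in auto)
      also have "\<dots> = 2 * (\<Sum>x\<in>S. c x)" by (simp add: sum_distrib_left)
      finally have "real_of_int (\<Sum>x\<in>S. c1 x) - real_of_int (\<Sum>x\<in>S. c0 x) = 2 * real_of_int (\<Sum>x\<in>S. c x)"
        by linarith
      then show ?thesis using SX(2) by (simp add: z0_def z1_def diff_divide_distrib[symmetric])
    qed
    ultimately show "\<bar>real_of_int (\<Sum>x\<in>S. c x)\<bar> \<le> \<Delta> S"
      using SX(2) by (simp add: abs_divide field_simps)
  qed
qed


text \<open>The terms decay geometrically on both sides of the peak \<open>u ^ j = a\<close>, so the
  bound depends on \<open>u\<close> alone, wherever the peak lies. The proof telescopes
  \<open>F y = y / (1 + y)\<close>, whose derivative with respect to \<open>ln y\<close> is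
  \<open>y / (1 + y)\<^sup>2\<close>, comparable to \<open>min y (1 / y)\<close>.\<close>

lemma sum_min_geometric_le:
  fixes u a :: real
  assumes u: "u > 1" and a: "a > 0"
  shows "(\<Sum>j<J. min (u ^ j / a) (1 / (u ^ j / a))) \<le> 4 * u / (u - 1)"
proof -
  define F where "F y = y / (1 + y)" for y :: real
  have step: "min y (1 / y) \<le> 4 * u / (u - 1) * (F (u * y) - F y)" if y: "y > 0" for y
  proof -
    have y4: "min y (1 / y) \<le> 4 * (y / (1 + y)\<^sup>2)"
    proof (cases "y \<le> 1")
      case True
      have "(1 + y)\<^sup>2 \<le> 2\<^sup>2" using y True by (intro power_mono) auto
      then have "y * (1 + y)\<^sup>2 \<le> y * 4" using y by (intro mult_left_mono) auto
      then have "y \<le> 4 * (y / (1 + y)\<^sup>2)" using y by (simp add: field_simps)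
      then show ?thesis by linarith
    next
      case False
      have "(1 + y)\<^sup>2 \<le> (2 * y)\<^sup>2" using y False by (intro power_mono) auto
      then have "1 / y \<le> 4 * (y / (1 + y)\<^sup>2)" using y by (simp add: field_simps power2_eq_square)
      then show ?thesis by linarith
    qed
    have "F (u * y) - F y = (u - 1) * y / ((1 + y) * (1 + u * y))"
    proof -
      have "1 + u * y > 0" "1 + y > 0" using y u by (auto intro: add_pos_pos)
      then show ?thesis by (simp add: F_def divide_simps) (simp add: algebra_simps)
    qed
    also have "\<dots> \<ge> (u - 1) * y / ((1 + y) * (u * (1 + y)))"
      using y u by (intro divide_left_mono mult_left_mono) (auto simp: algebra_simps intro!: mult_pos_pos add_pos_pos)
    also have "(u - 1) * y / ((1 + y) * (u * (1 + y))) = (u - 1) / u * (y / (1 + y)\<^sup>2)"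
      by (simp add: power2_eq_square mult_ac)
    finally have "4 * u / (u - 1) * ((u - 1) / u * (y / (1 + y)\<^sup>2)) \<le> 4 * u / (u - 1) * (F (u * y) - F y)"
      using u by (intro mult_left_mono) auto
    moreover have "4 * u / (u - 1) * ((u - 1) / u * (y / (1 + y)\<^sup>2)) = 4 * (y / (1 + y)\<^sup>2)"
      using u by simp
    ultimately show ?thesis using y4 by linarith
  qed
  have "(\<Sum>j<J. min (u ^ j / a) (1 / (u ^ j / a)))
      \<le> (\<Sum>j<J. 4 * u / (u - 1) * (F (u ^ Suc j / a) - F (u ^ j / a)))"
  proof (rule sum_mono)
    fix j
    have "u ^ j / a > 0" using u a by simp
    from step[OF this] show "min (u ^ j / a) (1 / (u ^ j / a)) \<le> 4 * u / (u - 1) * (F (u ^ Suc j / a) - F (u ^ j / a))"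
      by simp
  qed
  also have "\<dots> = 4 * u / (u - 1) * (F (u ^ J / a) - F (u ^ 0 / a))"
    using sum_lessThan_telescope[of "\<lambda>j. F (u ^ j / a)" J] by (simp only: sum_distrib_left[symmetric])
  also have "\<dots> \<le> 4 * u / (u - 1) * 1"
  proof (rule mult_left_mono)
    have "F (u ^ J / a) \<le> 1" "F (u ^ 0 / a) \<ge> 0"
      using u a by (auto simp: F_def divide_simps add_pos_pos)
    then show "F (u ^ J / a) - F (u ^ 0 / a) \<le> 1" by linarith
  qed (use u in auto)
  finally show ?thesis by simp
qed

text \<open>\<open>Q\<close> is the critical block size. The tolerances decay geometrically as
  \<open>2 ^ j\<close> moves away from \<open>Q\<close> in either direction, so their sum is
  dominated by the critical level and no factor \<open>J\<close> appears. The constant depends on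
  \<open>C\<close> and \<open>D\<close> only.\<close>

lemma dyadic_partial_coloring:
  fixes C :: real and D :: nat
  assumes C: "C > 0" and D: "D \<ge> 1"
  shows "\<exists>A>0. \<forall>(X::'a set) \<F> J Q. finite X \<and> X \<noteq> {} \<and> Q > 0 \<and>
           (\<forall>j<J. \<forall>S\<in>\<F> j. S \<subseteq> X \<and> card S = 2 ^ j) \<and>
           (\<forall>j<J. real (card (\<F> j)) \<le> C * card X * ((Q / 2 ^ j) ^ D + Q / 2 ^ j)) \<longrightarrow>
           (\<exists>(c::'a \<Rightarrow> int) \<Delta>. (\<forall>x. c x \<in> {-1, 0, 1}) \<and> (\<forall>x. x \<notin> X \<longrightarrow> c x = 0) \<and>
              card X \<le> 10 * card {x \<in> X. c x \<noteq> 0} \<and>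
              (\<forall>j<J. \<forall>S\<in>\<F> j. \<bar>real_of_int (\<Sum>x\<in>S. c x)\<bar> \<le> \<Delta> j) \<and>
              (\<forall>j. 0 \<le> \<Delta> j) \<and> (\<Sum>j<J. \<Delta> j) \<le> A * sqrt Q)"
proof -
  \<comment> \<open>The fourth root makes all quantities integral powers of \<open>x j\<close>, the
    fourth root of \<open>2 ^ j / Q\<close>: the standard deviation is
    \<open>sqrt Q * (x j)\<^sup>2\<close>, and the block counts are powers of
    \<open>1 / x j ^ 4\<close>.\<close>
  define u where "u = root 4 (2::real)"
  have u: "u > 1" by (simp add: u_def)
  \<comment> \<open>Small blocks may number \<open>x j ^ (- 4 * D)\<close> per point; a cost of
    \<open>x j ^ p\<close> cancels this and leaves four powers for convergence.\<close>
  define p where "p = 4 * D + 4"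
  define R where "R = round_const p"
  have R: "R > 0" by (simp add: R_def round_const_pos)
  define c0 where "c0 = 4 * u / (u - 1)"
  have c0: "c0 > 0" using u by (simp add: c0_def)
  \<comment> \<open>The total cost will be at most \<open>2 * C * R * c0 / A0\<close> per point of
    \<open>X\<close>; the factor 8 brings it down to 1/4.\<close>
  define A0 where "A0 = 1 + 8 * C * R * c0"
  have A0: "A0 \<ge> 1" "A0 \<ge> 8 * C * R * c0" using C R c0 by (auto simp: A0_def)
  define h where "h y = min y (1 / y)" for y :: real
  have h_le: "h z = z" if "0 < z" "z \<le> 1" for z
    using that by (simp add: h_def field_simps min_def) (smt (verit) mult_le_one mult_left_le)
  have h_gt: "h z = 1 / z" if "1 < z" for z
    using that by (simp add: h_def field_simps min_def) (smt (verit) mult_le_one mult_left_le mult_less_cancel_left2)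
  show ?thesis
  proof (intro exI[of _ "A0 * c0"] conjI allI impI; (elim conjE)?)
    show "A0 * c0 > 0" using A0 c0 by simp
    fix X :: "'a set" and \<F> :: "nat \<Rightarrow> 'a set set" and J :: nat and Q :: real
    assume X: "finite X" "X \<noteq> {}" and Q: "Q > 0"
      and F: "\<forall>j<J. \<forall>S\<in>\<F> j. S \<subseteq> X \<and> card S = 2 ^ j"
      and cF: "\<forall>j<J. real (card (\<F> j)) \<le> C * card X * ((Q / 2 ^ j) ^ D + Q / 2 ^ j)"
    define a where "a = root 4 Q"
    have a: "a > 0" using Q by (simp add: a_def)
    have a4: "a ^ 4 = Q" using Q by (simp add: a_def)
    have a2: "a\<^sup>2 = sqrt Q" using a a4 Q by (intro real_sqrt_unique[symmetric]) (auto simp: power_mult[symmetric])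
    have u4: "u ^ 4 = 2" by (simp add: u_def)
    define x where "x j = u ^ j / a" for j :: nat
    \<comment> \<open>The partial coloring takes tolerances as functions of the set, so the level is
      read off from the cardinality.\<close>
    define y where "y S = root 4 (real (card S)) / a" for S :: "'a set"
    have x: "x j > 0" for j using u a by (simp add: x_def)
    have x4: "Q / 2 ^ j = 1 / x j ^ 4" for j
    proof -
      have "(u ^ j) ^ 4 = 2 ^ j" by (metis mult.commute power_mult u4)
      then show ?thesis by (simp add: x_def power_divide a4)
    qed
    have sq: "sqrt (2 ^ j) = a\<^sup>2 * (x j)\<^sup>2" for j
    proof -
      have "(u ^ j) ^ 4 = 2 ^ j" by (metis mult.commute power_mult u4)
      then have "sqrt (2 ^ j) = (u ^ j)\<^sup>2" using u by (intro real_sqrt_unique) (auto simp flip: power_mult simp: mult.commute)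
      then show ?thesis using a by (simp add: x_def power_divide)
    qed
    have yx: "y S = x j" if "card S = 2 ^ j" for S j
    proof -
      have "root 4 (2 ^ j) = u ^ j" by (simp add: u_def real_root_power)
      then show ?thesis using that by (simp add: y_def x_def)
    qed
    \<comment> \<open>For \<open>z = x j\<close> the tolerance in standard deviations is
      \<open>A0 / z\<close> if \<open>z \<le> 1\<close> and \<open>A0 / z ^ 3\<close> otherwise. The
      entropy cost is then at most \<open>R / A0\<close> times \<open>z ^ p\<close> or
      \<open>z ^ 3\<close>, and after multiplication by the number of blocks it is of order
      \<open>min z (1 / z)\<close> per point.\<close>
    define \<Delta> where "\<Delta> S = A0 * a\<^sup>2 * h (y S)" for S
    define w where "w S = R / A0 * (if y S \<le> 1 then y S ^ p else y S ^ 3)" for S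
    define FF where "FF = (\<Union>j<J. \<F> j)"
    have fFj: "finite (\<F> j)" if "j < J" for j
      using F that X(1) by (intro finite_subset[of "\<F> j" "Pow X"]) auto
    have fFF: "finite FF" using fFj by (auto simp: FF_def)
    have hpos: "h z > 0" if "z > 0" for z using that by (simp add: h_def)
    have c1: "S \<subseteq> X \<and> S \<noteq> {} \<and> \<Delta> S > 0" if "S \<in> FF" for S
    proof -
      obtain j where j: "j < J" "S \<in> \<F> j" using \<open>S \<in> FF\<close> unfolding FF_def by blast
      then have S: "S \<subseteq> X" "card S = 2 ^ j" using F by auto
      then have "S \<noteq> {}" by auto
      moreover have "\<Delta> S > 0" using yx[OF S(2)] x[of j] A0 a hpos by (auto simp: \<Delta>_def)
      ultimately show ?thesis using S by auto
    qed
    have c2: "(let l = \<Delta> S / sqrt (card S) in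
               if l \<le> 1 then round_const p / l else round_const p / l ^ p) \<le> w S" if "S \<in> FF" for S
    proof -
      obtain j where j: "j < J" "S \<in> \<F> j" using \<open>S \<in> FF\<close> unfolding FF_def by blast
      then have S: "card S = 2 ^ j" using F by auto
      define z where "z = x j"
      have z: "z > 0" using x by (simp add: z_def)
      define l where "l = \<Delta> S / sqrt (card S)"
      have l: "l = A0 * (h z / z\<^sup>2)" using a z sq[of j] by (simp add: l_def \<Delta>_def yx[OF S] S z_def[symmetric])
      have "(if l \<le> 1 then R / l else R / l ^ p) \<le> R / A0 * (if z \<le> 1 then z ^ p else z ^ 3)"
      proof (cases "z \<le> 1")
        case True
        then have "h z = z" using z by (intro h_le)
        then have l': "l = A0 / z" using z by (simp add: l power2_eq_square)
        have l1: "l \<ge> 1" unfolding l' using A0(1) z True by simp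
        have "A0 \<le> A0 ^ p" using A0 by (intro self_le_power) (auto simp: p_def)
        then have "R * z ^ p / A0 ^ p \<le> R * z ^ p / A0" using A0 R z by (intro divide_left_mono) auto
        moreover have "R / l ^ p = R * z ^ p / A0 ^ p" by (simp add: l' power_divide)
        moreover have "R / l = R / l ^ p" if "l \<le> 1" using that l1 by simp
        ultimately show ?thesis using True by auto
      next
        case False
        then have "h z = 1 / z" by (intro h_gt) simp
        then have l': "l = A0 / z ^ 3" using z by (simp add: l power2_eq_square power3_eq_cube)
        have lpos: "l > 0" using l' A0 z by simp
        have "R / l ^ p \<le> R / l" if "\<not> l \<le> 1"
          using that R by (intro divide_left_mono self_le_power) (auto simp: p_def)
        moreover have "R / l = R / A0 * z ^ 3" by (simp add: l')
        ultimately show ?thesis using False by auto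
      qed
      then show ?thesis
        unfolding Let_def w_def yx[OF S] R_def[symmetric] z_def[symmetric] l_def[symmetric] .
    qed
    have c3: "(\<Sum>S\<in>FF. w S) \<le> card X / 4"
    proof -
      have "(\<Sum>S\<in>FF. w S) = (\<Sum>j<J. \<Sum>S\<in>\<F> j. w S)"
        unfolding FF_def
      proof (rule sum.UNION_disjoint)
        show "\<forall>i\<in>{..<J}. \<forall>j\<in>{..<J}. i \<noteq> j \<longrightarrow> \<F> i \<inter> \<F> j = {}"
          using F by (metis disjoint_iff lessThan_iff one_less_numeral_iff power_inject_exp semiring_norm(76))
      qed (use fFj in auto)
      also have "\<dots> \<le> (\<Sum>j<J. C * card X * 2 * (R / A0) * h (x j))"
      proof (rule sum_mono)
        fix j assume j: "j \<in> {..<J}"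
        define z where "z = x j"
        have z: "z > 0" using x by (simp add: z_def)
        define g where "g = (if z \<le> 1 then z ^ p else z ^ 3)"
        have g: "g > 0" using z by (simp add: g_def)
        have "(\<Sum>S\<in>\<F> j. w S) = (\<Sum>S\<in>\<F> j. R / A0 * g)"
          by (rule sum.cong) (use j F in \<open>auto simp: w_def yx z_def g_def\<close>)
        also have "\<dots> = real (card (\<F> j)) * (R / A0 * g)" by simp
        also have "\<dots> \<le> C * card X * ((Q / 2 ^ j) ^ D + Q / 2 ^ j) * (R / A0 * g)"
          using cF j R A0 g by (intro mult_right_mono) auto
        also have "\<dots> = C * card X * (R / A0) * (((1 / z ^ 4) ^ D + 1 / z ^ 4) * g)"
          unfolding x4 z_def[symmetric] by (simp only: mult_ac)
        also have "\<dots> \<le> C * card X * (R / A0) * (2 * h z)"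
        proof (rule mult_left_mono)
          show "((1 / z ^ 4) ^ D + 1 / z ^ 4) * g \<le> 2 * h z"
          proof (cases "z \<le> 1")
            case True
            then have "h z = z" using z by (intro h_le)
            have "(1 / z ^ 4) ^ D = 1 / z ^ (4 * D)" by (simp only: power_one_over power_mult)
            then have "(1 / z ^ 4) ^ D * g = z ^ 4"
              using True z by (simp add: g_def p_def power_add)
            moreover have "1 / z ^ 4 * g = z ^ (4 * D)"
              using True z by (simp add: g_def p_def power_add)
            moreover have "z ^ 4 \<le> z ^ 1" "z ^ (4 * D) \<le> z ^ 1" using True z D by (intro power_decreasing; simp)+
            ultimately show ?thesis using \<open>h z = z\<close> by (simp add: distrib_right power_mult)
          next
            case False
            then have hz: "h z = 1 / z" by (intro h_gt) simp
            have "1 / z ^ 4 \<le> 1" "1 / z ^ 4 \<ge> 0" using False by (auto simp: field_simps)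
            then have "(1 / z ^ 4) ^ D \<le> (1 / z ^ 4) ^ 1" using D by (intro power_decreasing) auto
            then have "((1 / z ^ 4) ^ D + 1 / z ^ 4) * g \<le> (1 / z ^ 4 + 1 / z ^ 4) * g"
              using g by (intro mult_right_mono) auto
            also have "\<dots> = 2 * h z" using False z by (simp add: hz g_def field_simps power3_eq_cube power4_eq_xxxx)
            finally show ?thesis .
          qed
        qed (use C R A0 in auto)
        finally show "(\<Sum>S\<in>\<F> j. w S) \<le> C * card X * 2 * (R / A0) * h (x j)" by (simp add: z_def mult_ac)
      qed
      also have "\<dots> = C * card X * 2 * (R / A0) * (\<Sum>j<J. h (x j))" by (simp add: sum_distrib_left)
      also have "\<dots> \<le> C * card X * 2 * (R / A0) * c0"
        unfolding h_def x_def c0_def using C R A0 by (intro mult_left_mono sum_min_geometric_le u a) auto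
      also have "\<dots> = card X / 4 * (8 * C * R * c0 / A0)" by simp
      also have "\<dots> \<le> card X / 4 * 1" using A0 by (intro mult_left_mono) (auto simp: field_simps)
      finally show ?thesis by simp
    qed
    have p1: "p \<ge> 1" by (simp add: p_def)
    obtain c :: "'a \<Rightarrow> int" where c: "\<And>x. c x \<in> {-1, 0, 1}" "\<And>x. x \<notin> X \<Longrightarrow> c x = 0"
      "card X \<le> 10 * card {x \<in> X. c x \<noteq> 0}"
      "\<And>S. S \<in> FF \<Longrightarrow> \<bar>real_of_int (\<Sum>x\<in>S. c x)\<bar> \<le> \<Delta> S"
      using partial_coloring[OF X fFF c1 p1 c2 c3] by blast
    define \<Delta>' where "\<Delta>' j = A0 * a\<^sup>2 * h (x j)" for j
    have "(\<Sum>j<J. \<Delta>' j) = A0 * a\<^sup>2 * (\<Sum>j<J. h (x j))" by (simp add: \<Delta>'_def sum_distrib_left)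
    also have "\<dots> \<le> A0 * a\<^sup>2 * c0"
      unfolding h_def x_def c0_def using A0 by (intro mult_left_mono sum_min_geometric_le u a) auto
    also have "\<dots> = A0 * c0 * sqrt Q" by (simp add: a2)
    finally have sD: "(\<Sum>j<J. \<Delta>' j) \<le> A0 * c0 * sqrt Q" .
    have D0: "\<forall>j. 0 \<le> \<Delta>' j" using A0 hpos[OF x] by (simp add: \<Delta>'_def less_imp_le)
    have cS: "\<forall>j<J. \<forall>S\<in>\<F> j. \<bar>real_of_int (\<Sum>x\<in>S. c x)\<bar> \<le> \<Delta>' j"
    proof (intro allI impI ballI)
      fix j S assume j: "j < J" "S \<in> \<F> j"
      then have "S \<in> FF" by (auto simp: FF_def)
      moreover have "\<Delta> S = \<Delta>' j" using F j yx[of S j] by (simp add: \<Delta>_def \<Delta>'_def)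
      ultimately show "\<bar>real_of_int (\<Sum>x\<in>S. c x)\<bar> \<le> \<Delta>' j" using c(4)[of S] by simp
    qed
    show "\<exists>(c::'a \<Rightarrow> int) \<Delta>. (\<forall>x. c x \<in> {-1, 0, 1}) \<and> (\<forall>x. x \<notin> X \<longrightarrow> c x = 0) \<and>
              card X \<le> 10 * card {x \<in> X. c x \<noteq> 0} \<and>
              (\<forall>j<J. \<forall>S\<in>\<F> j. \<bar>real_of_int (\<Sum>x\<in>S. c x)\<bar> \<le> \<Delta> j) \<and>
              (\<forall>j. 0 \<le> \<Delta> j) \<and> (\<Sum>j<J. \<Delta> j) \<le> A0 * c0 * sqrt Q"
      using c(1-3) cS sD D0 by blast
  qed
qed

section \<open>Translated pairs in sets with sparse rows\<close>

lemma card_congruent_le: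
  fixes A :: "nat set" and n L :: nat
  assumes A: "A \<subseteq> {1..L}" and n: "n > 0" and cong: "\<And>a b. a \<in> A \<Longrightarrow> b \<in> A \<Longrightarrow> a mod n = b mod n"
  shows "real (card A) \<le> 1 + L / n"
proof -
  have "inj_on (\<lambda>a. a div n) A"
  proof (rule inj_onI)
    fix a b assume ab: "a \<in> A" "b \<in> A" "a div n = b div n"
    have "a = a div n * n + a mod n" by simp
    also have "\<dots> = b div n * n + b mod n" using ab cong[of a b] by simp
    finally show "a = b" by simp
  qed
  then have "card A = card ((\<lambda>a. a div n) ` A)" by (simp add: card_image)
  also have "\<dots> \<le> card {..L div n}"
    by (rule card_mono) (use A in \<open>auto intro!: div_le_mono\<close>)
  finally have "real (card A) \<le> 1 + real (L div n)" by simp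
  also have "real (L div n) \<le> L / n" by (rule of_nat_div_le_of_nat)
  finally show ?thesis by simp
qed

text \<open>Two solutions differ in \<open>k\<close> by a multiple of
  \<open>j' div gcd j j'\<close>, and \<open>k\<close> determines \<open>k'\<close>.\<close>

lemma card_linear_solutions_le:
  fixes j j' L :: nat and v :: int
  assumes j: "j > 0" "j' > 0"
  shows "real (card {(k, k') \<in> {1..L} \<times> {1..L}. int k * int j - int k' * int j' = v})
           \<le> 1 + L * gcd j j' / j'"
proof -
  let ?T = "{(k, k') \<in> {1..L} \<times> {1..L}. int k * int j - int k' * int j' = v}"
  define n where "n = j' div gcd j j'"
  have n: "n > 0" using j by (simp add: n_def div_greater_zero_iff gcd_le2_nat)
  have nr: "real n = j' / gcd j j'" by (simp add: n_def real_of_nat_div)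
  have inj: "inj_on fst ?T" using j by (auto simp: inj_on_def)
  have "card ?T = card (fst ` ?T)" using inj by (simp add: card_image)
  moreover have "real (card (fst ` ?T)) \<le> 1 + L / n"
  proof (rule card_congruent_le[OF _ n])
    show "fst ` ?T \<subseteq> {1..L}" by auto
    fix a b assume "a \<in> fst ` ?T" "b \<in> fst ` ?T"
    then obtain p q where pq: "p \<in> ?T" "a = fst p" "q \<in> ?T" "b = fst q" by blast
    define a' b' where "a' = snd p" "b' = snd q"
    have ab: "int a * int j - int a' * int j' = v" "int b * int j - int b' * int j' = v"
      using pq by (auto simp: a'_b'_def)
    then have "(int a - int b) * int j = int j' * (int a' - int b')" by (simp add: algebra_simps)
    then have "int j' dvd (int a - int b) * int j" by simp
    moreover have jj: "int j' = int n * int (gcd j j')" "int j = int (j div gcd j j') * int (gcd j j')"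
      by (simp_all add: n_def flip: of_nat_mult)
    ultimately have "int n * int (gcd j j') dvd ((int a - int b) * int (j div gcd j j')) * int (gcd j j')"
      by (metis mult.assoc)
    then have "int n dvd (int a - int b) * int (j div gcd j j')"
      using j by simp
    moreover have "coprime (int n) (int (j div gcd j j'))"
      using div_gcd_coprime[of j j'] j by (simp add: n_def coprime_commute)
    ultimately have "int n dvd int a - int b" by (simp add: coprime_dvd_mult_left_iff)
    then have "int a mod int n = int b mod int n" by (simp add: mod_eq_dvd_iff)
    then show "a mod n = b mod n" by (metis of_nat_eq_iff of_nat_mod)
  qed
  ultimately show ?thesis using j by (simp add: nr)
qed

lemma card_linear_solutions_le_max:
  fixes j j' L :: nat and v :: int
  assumes j: "j > 0" "j' > 0"
  shows "real (card {(k, k') \<in> {1..L} \<times> {1..L}. int k * int j - int k' * int j' = v})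
           \<le> 1 + L * gcd j j' / max j j'"
proof (cases "j \<le> j'")
  case True
  then show ?thesis using card_linear_solutions_le[OF j, of L v] by (simp add: max_def)
next
  case False
  have "bij_betw (\<lambda>(k, k'). (k', k))
      {(k, k') \<in> {1..L} \<times> {1..L}. int k * int j - int k' * int j' = v}
      {(k, k') \<in> {1..L} \<times> {1..L}. int k * int j' - int k' * int j = - v}"
    by (rule bij_betw_byWitness[where f' = "\<lambda>(k, k'). (k', k)"]) auto
  from bij_betw_same_card[OF this] show ?thesis
    using card_linear_solutions_le[OF j(2,1), of L "-v"] False by (simp add: max_def gcd.commute)
qed

text \<open>At most \<open>2 * m\<close> pairs have maximum \<open>m\<close>, and each has weight
  \<open>1 / m\<close>.\<close>

lemma sum_inverse_max_le:
  fixes M :: nat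
  shows "(\<Sum>j\<in>{1..M}. \<Sum>j'\<in>{1..M}. 1 / real (max j j')) \<le> 2 * M"
proof -
  have "(\<Sum>j\<in>{1..M}. \<Sum>j'\<in>{1..M}. 1 / real (max j j'))
     \<le> (\<Sum>j\<in>{1..M}. \<Sum>j'\<in>{1..M}. (if j \<le> j' then 1 / real j' else 0) + (if j' \<le> j then 1 / real j else 0))"
    by (intro sum_mono) (auto simp: max_def)
  also have "\<dots> = (\<Sum>j'\<in>{1..M}. \<Sum>j\<in>{1..M}. if j \<le> j' then 1 / real j' else 0)
              + (\<Sum>j\<in>{1..M}. \<Sum>j'\<in>{1..M}. if j' \<le> j then 1 / real j else 0)"
    unfolding sum.distrib by (subst sum.swap) simp
  also have "\<dots> = (\<Sum>j'\<in>{1..M}. 1) + (\<Sum>j\<in>{1..M}. (1::real))"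
  proof -
    have "(\<Sum>j\<in>{1..M}. if j \<le> j' then 1 / real j' else 0) = 1" if "j' \<in> {1..M}" for j'
    proof -
      have "(\<Sum>j\<in>{1..M}. if j \<le> j' then 1 / real j' else 0) = (\<Sum>j\<in>{1..j'}. 1 / real j')"
        using that by (intro sum.mono_neutral_cong_right) auto
      then show ?thesis using that by simp
    qed
    then show ?thesis by simp
  qed
  finally show ?thesis by simp
qed

lemma sum_inverse_squares_le:
  fixes G M :: nat
  assumes "G \<ge> 1" shows "(\<Sum>g\<in>{G<..M}. 1 / (real g)\<^sup>2) \<le> 1 / G"
proof -
  have "(\<Sum>g\<in>{G<..G+n}. 1 / (real g)\<^sup>2) \<le> 1 / G - 1 / (G + n)" for n
  proof (induction n)
    case (Suc n)
    have "{G<..G + Suc n} = insert (G + Suc n) {G<..G+n}" by auto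
    then have "(\<Sum>g\<in>{G<..G + Suc n}. 1 / (real g)\<^sup>2) = 1 / (real (G + Suc n))\<^sup>2 + (\<Sum>g\<in>{G<..G+n}. 1 / (real g)\<^sup>2)"
      by simp
    moreover have "1 / (real (G + Suc n))\<^sup>2 \<le> 1 / (real G + n) - 1 / (G + Suc n)"
    proof -
      define z where "z = real G + n"
      have z: "z \<ge> 1" using assms by (simp add: z_def)
      have e: "real (G + Suc n) = z + 1" by (simp add: z_def)
      have "1 / (z+1)\<^sup>2 \<le> 1 / z - 1 / (z+1)"
      proof -
        have "1 / (z+1)\<^sup>2 \<le> 1 / (z * (z+1))"
          using z by (intro divide_left_mono) (auto simp: power2_eq_square)
        also have "\<dots> = 1 / z - 1 / (z+1)" using z by (simp add: field_simps)
        finally show ?thesis .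
      qed
      then show ?thesis unfolding e z_def[symmetric] .
    qed
    ultimately show ?case using Suc by simp
  qed simp
  note * = this
  show ?thesis
  proof (cases "G \<le> M")
    case True
    then have "G + (M - G) = M" by simp
    with *[of "M - G"] have "(\<Sum>g\<in>{G<..M}. 1 / (real g)\<^sup>2) \<le> 1 / G - 1 / real M" by simp
    then show ?thesis by (smt (verit) divide_nonneg_nonneg of_nat_0_le_iff)
  qed auto
qed

text \<open>Union over the value \<open>g > G\<close> of the gcd: both entries are multiples of
  \<open>g\<close>, which leaves at most \<open>(M / g)\<^sup>2\<close> pairs, and the tail of the
  inverse squares is at most \<open>1 / G\<close>.\<close>

lemma card_gcd_gt_le:
  fixes G M :: nat
  assumes "G \<ge> 1"
  shows "real (card {(j, j') \<in> {1..M} \<times> {1..M}. gcd j j' > G}) \<le> (real M)\<^sup>2 / G"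
proof -
  define mult where "mult g = {j \<in> {1..M}. g dvd j}" for g
  have cm: "real (card (mult g)) \<le> M / g" if "g > 0" for g
  proof -
    have "inj_on (\<lambda>j. j div g) (mult g)"
      by (rule inj_onI) (auto simp: mult_def)
    then have "card (mult g) = card ((\<lambda>j. j div g) ` mult g)" by (simp add: card_image)
    also have "\<dots> \<le> card {1..M div g}"
      by (rule card_mono) (use that in \<open>auto simp: mult_def Suc_le_eq div_greater_zero_iff intro: div_le_mono dvd_imp_le\<close>)
    finally show ?thesis using of_nat_div_le_of_nat[of M g, where ?'a = real] by simp
  qed
  have fm: "finite (mult g)" for g by (simp add: mult_def)
  have "{(j, j') \<in> {1..M} \<times> {1..M}. gcd j j' > G} \<subseteq> (\<Union>g\<in>{G<..M}. mult g \<times> mult g)"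
  proof clarify
    fix j j' assume j: "j \<in> {1..M}" "j' \<in> {1..M}" "G < gcd j j'"
    have "gcd j j' \<le> j" using j by (intro gcd_le1_nat) auto
    then show "(j, j') \<in> (\<Union>g\<in>{G<..M}. mult g \<times> mult g)"
      using j by (intro UN_I[of "gcd j j'"]) (auto simp: mult_def)
  qed
  then have "card {(j, j') \<in> {1..M} \<times> {1..M}. gcd j j' > G} \<le> card (\<Union>g\<in>{G<..M}. mult g \<times> mult g)"
    by (intro card_mono) (auto simp: fm)
  also have "\<dots> \<le> (\<Sum>g\<in>{G<..M}. card (mult g \<times> mult g))" by (rule card_UN_le) simp
  finally have "real (card {(j, j') \<in> {1..M} \<times> {1..M}. gcd j j' > G})
      \<le> real (\<Sum>g\<in>{G<..M}. card (mult g \<times> mult g))" by (simp only: of_nat_le_iff)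
  also have "\<dots> = (\<Sum>g\<in>{G<..M}. real (card (mult g)) * real (card (mult g)))"
    by (simp add: card_cartesian_product)
  also have "\<dots> \<le> (\<Sum>g\<in>{G<..M}. (M / g) * (M / g))"
    by (intro sum_mono mult_mono cm) auto
  also have "\<dots> = (real M)\<^sup>2 * (\<Sum>g\<in>{G<..M}. 1 / (real g)\<^sup>2)"
    by (simp add: sum_distrib_left power2_eq_square)
  also have "\<dots> \<le> (real M)\<^sup>2 * (1 / G)" by (intro mult_left_mono sum_inverse_squares_le assms) auto
  finally show ?thesis by simp
qed

lemma sum_squared_le_card_sum_squares:
  fixes f :: "'a \<Rightarrow> real"
  shows "(\<Sum>x\<in>A. f x)\<^sup>2 \<le> card A * (\<Sum>x\<in>A. (f x)\<^sup>2)"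
  using Cauchy_Schwarz_ineq_sum[of f "\<lambda>_. 1" A] by (simp add: mult.commute)

section \<open>Pairs that differ by a shift along one coordinate axis\<close>

definition axis_row :: "nat \<Rightarrow> (nat \<Rightarrow> int) set \<Rightarrow> (nat \<Rightarrow> int) \<Rightarrow> (nat \<Rightarrow> int) set" where
  "axis_row i E x = {y \<in> E. \<forall>k. k \<noteq> i \<longrightarrow> y k = x k}"

definition bump :: "nat \<Rightarrow> (nat \<Rightarrow> int) \<Rightarrow> int \<Rightarrow> (nat \<Rightarrow> int)" where
  "bump i x t = x(i := x i + t)"

lemma bump_simps [simp]:
  "bump i x t i = x i + t" "k \<noteq> i \<Longrightarrow> bump i x t k = x k" "bump i x 0 = x"
  "bump i (bump i x s) t = bump i x (s + t)" "bump i x t = bump i y t \<longleftrightarrow> x = y"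
proof -
  show "bump i x t = bump i y t \<longleftrightarrow> x = y"
  proof
    assume "bump i x t = bump i y t"
    then have "bump i (bump i x t) (- t) = bump i (bump i y t) (- t)" by simp
    then show "x = y" by (simp add: bump_def)
  qed simp
qed (auto simp: bump_def)

text \<open>Pairs of step sizes with \<open>gcd j j' \<le> G\<close> contribute through the number of solutions of
  \<open>k j - k' j' = v\<close>; those with larger gcd are bounded trivially, but they are rare.\<close>

lemma positive_shift_pairs_bound:
  fixes E :: "(nat \<Rightarrow> int) set" and G L M h :: nat
  assumes E: "finite E" and row: "\<And>x. x \<in> E \<Longrightarrow> card (axis_row i E x) \<le> h" and G: "G \<ge> 1"
  shows "(real (card {(x, k, j). x \<in> E \<and> k \<in> {1..L} \<and> j \<in> {1..M} \<and> bump i x (int k * int j) \<in> E}))\<^sup>2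
     \<le> (real (card E))\<^sup>2 * (h * ((real M)\<^sup>2 + 2 * G * L * M) + (real L * real M)\<^sup>2 / G)"
proof -
  define P where "P x = {(k, j) \<in> {1..L} \<times> {1..M}. bump i x (int k * int j) \<in> E}" for x
  define V where "V = card {(x, k, j). x \<in> E \<and> k \<in> {1..L} \<and> j \<in> {1..M} \<and> bump i x (int k * int j) \<in> E}"
  have fP: "finite (P x)" for x by (rule finite_subset[of _ "{1..L} \<times> {1..M}"]) (auto simp: P_def)
  have "{(x, k, j). x \<in> E \<and> k \<in> {1..L} \<and> j \<in> {1..M} \<and> bump i x (int k * int j) \<in> E} = Sigma E P"
    by (auto simp: P_def)
  then have V: "real V = (\<Sum>x\<in>E. real (card (P x)))" using E fP by (simp add: V_def card_SigmaI)
  define N where "N j j' = {(x, k, k'). x \<in> E \<and> k \<in> {1..L} \<and> k' \<in> {1..L} \<and>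
      bump i x (int k * int j) \<in> E \<and> bump i x (int k' * int j') \<in> E}" for j j'
  have fN: "finite (N j j')" for j j'
    by (rule finite_subset[of _ "E \<times> {1..L} \<times> {1..L}"]) (use E in \<open>auto simp: N_def\<close>)
  have "(\<Sum>x\<in>E. (real (card (P x)))\<^sup>2) = real (card (Sigma E (\<lambda>x. P x \<times> P x)))"
    using E fP by (subst card_SigmaI) (auto simp: card_cartesian_product power2_eq_square)
  also have "card (Sigma E (\<lambda>x. P x \<times> P x)) = card (Sigma ({1..M} \<times> {1..M}) (\<lambda>(j, j'). N j j'))"
    by (rule bij_betw_same_card[of "\<lambda>(x, (k, j), (k', j')). ((j, j'), (x, k, k'))"],
        rule bij_betw_byWitness[where f' = "\<lambda>((j, j'), (x, k, k')). (x, (k, j), (k', j'))"])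
      (auto simp: P_def N_def)
  also have "\<dots> = (\<Sum>(j, j')\<in>{1..M} \<times> {1..M}. card (N j j'))"
    using fN by (subst card_SigmaI) (auto simp: case_prod_unfold)
  finally have sq: "(\<Sum>x\<in>E. (real (card (P x)))\<^sup>2) = (\<Sum>(j, j')\<in>{1..M} \<times> {1..M}. real (card (N j j')))"
    by (simp add: case_prod_unfold)
  have NA: "real (card (N j j')) \<le> card E * (real L)\<^sup>2" for j j'
  proof -
    have "card (N j j') \<le> card (E \<times> {1..L} \<times> {1..L})"
      by (rule card_mono) (use E in \<open>auto simp: N_def\<close>)
    then have "real (card (N j j')) \<le> real (card E * (L * L))"
      by (simp only: card_cartesian_product card_atLeastAtMost diff_Suc_1 of_nat_le_iff)
    then show ?thesis by (simp add: power2_eq_square)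
  qed
  have NB: "real (card (N j j')) \<le> card E * h * (1 + L * gcd j j' / max j j')"
    if j: "j > 0" "j' > 0" for j j'
  proof -
    define S where "S v = {(k, k') \<in> {1..L} \<times> {1..L}. int k * int j - int k' * int j' = v}" for v
    have fS: "finite (S v)" for v by (rule finite_subset[of _ "{1..L} \<times> {1..L}"]) (auto simp: S_def)
    have frow: "finite (axis_row i E u)" for u using E by (auto simp: axis_row_def)
    define T where "T = Sigma (Sigma E (axis_row i E)) (\<lambda>(u, u'). S (u i - u' i))"
    have fT: "finite T" unfolding T_def using E frow fS by (intro finite_SigmaI) auto
    \<comment> \<open>The two shifted points \<open>u\<close>, \<open>u'\<close> lie in a common row
      of \<open>E\<close>, which allows at most \<open>card E * h\<close> pairs. Their difference in
      coordinate \<open>i\<close> prescribes \<open>v = k j - k' j'\<close>, and \<open>x\<close> is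
      recovered from \<open>u\<close> and \<open>k\<close>.\<close>
    have "card (N j j') \<le> card T"
    proof (rule card_inj_on_le[where f = "\<lambda>(x, k, k'). ((bump i x (int k * int j), bump i x (int k' * int j')), (k, k'))"])
      show "inj_on (\<lambda>(x, k, k'). ((bump i x (int k * int j), bump i x (int k' * int j')), (k, k'))) (N j j')"
        by (auto simp: inj_on_def)
      show "(\<lambda>(x, k, k'). ((bump i x (int k * int j), bump i x (int k' * int j')), (k, k'))) ` N j j' \<subseteq> T"
        by (auto simp: N_def T_def S_def axis_row_def)
    qed (rule fT)
    also have "card T = (\<Sum>(u, u')\<in>Sigma E (axis_row i E). card (S (u i - u' i)))"
      unfolding T_def using E frow fS by (subst card_SigmaI) (auto simp: case_prod_unfold)
    finally have "real (card (N j j')) \<le> (\<Sum>(u, u')\<in>Sigma E (axis_row i E). real (card (S (u i - u' i))))"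
      by (simp add: case_prod_unfold flip: of_nat_sum)
    also have "\<dots> \<le> (\<Sum>(u, u')\<in>Sigma E (axis_row i E). 1 + L * gcd j j' / max j j')"
    proof -
      have "real (card (S v)) \<le> 1 + L * gcd j j' / max j j'" for v
        unfolding S_def by (rule card_linear_solutions_le_max[OF j])
      then show ?thesis unfolding case_prod_unfold by (intro sum_mono)
    qed
    also have "\<dots> = real (card (Sigma E (axis_row i E))) * (1 + L * gcd j j' / max j j')"
      by (simp add: case_prod_unfold)
    also have "\<dots> \<le> real (card E * h) * (1 + L * gcd j j' / max j j')"
    proof (rule mult_right_mono)
      have "card (Sigma E (axis_row i E)) = (\<Sum>u\<in>E. card (axis_row i E u))" using E frow by (simp add: card_SigmaI)
      also have "\<dots> \<le> (\<Sum>u\<in>E. h)" by (intro sum_mono row)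
      finally show "real (card (Sigma E (axis_row i E))) \<le> real (card E * h)" by (simp only: sum_constant of_nat_le_iff of_nat_id)
    qed simp
    finally show ?thesis by simp
  qed
  have "(\<Sum>(j, j')\<in>{1..M} \<times> {1..M}. real (card (N j j')))
     \<le> (\<Sum>(j, j')\<in>{1..M} \<times> {1..M}. card E * h * (1 + L * G / max j j')
          + (if gcd j j' > G then card E * (real L)\<^sup>2 else 0))"
    unfolding case_prod_unfold
  proof (rule sum_mono)
    fix p assume p: "p \<in> {1..M} \<times> {1..M}"
    define j j' where "j = fst p" "j' = snd p"
    have j: "j > 0" "j' > 0" using p by (auto simp: j_j'_def)
    have "real (card (N j j')) \<le> card E * h * (1 + L * G / max j j') + (if gcd j j' > G then card E * (real L)\<^sup>2 else 0)"
    proof (cases "gcd j j' > G")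
      case True
      have "0 \<le> real (card E) * h * (1 + real (L * G) / max j j')"
        by (intro mult_nonneg_nonneg add_nonneg_nonneg divide_nonneg_nonneg) auto
      then show ?thesis using NA[of j j'] True by (simp add: add_increasing)
    next
      case False
      have "real (card (N j j')) \<le> card E * h * (1 + L * gcd j j' / max j j')" using NB[OF j] by simp
      also have "\<dots> \<le> card E * h * (1 + L * G / max j j')"
        using False by (intro mult_left_mono add_mono divide_right_mono) (auto intro!: mult_left_mono)
      finally show ?thesis using False by simp
    qed
    then show "real (card (N (fst p) (snd p))) \<le> card E * h * (1 + L * G / max (fst p) (snd p))
       + (if gcd (fst p) (snd p) > G then card E * (real L)\<^sup>2 else 0)" by (simp add: j_j'_def)
  qed
  also have "\<dots> = card E * h * ((real M)\<^sup>2 + L * G * (\<Sum>j\<in>{1..M}. \<Sum>j'\<in>{1..M}. 1 / real (max j j')))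
       + real (card {(j, j') \<in> {1..M} \<times> {1..M}. gcd j j' > G}) * (card E * (real L)\<^sup>2)"
  proof -
    have 1: "(\<Sum>(j, j')\<in>{1..M} \<times> {1..M}. if gcd j j' > G then card E * (real L)\<^sup>2 else 0)
       = (\<Sum>p\<in>{(j, j') \<in> {1..M} \<times> {1..M}. gcd j j' > G}. card E * (real L)\<^sup>2)"
      by (rule sum.mono_neutral_cong_right) (auto split: if_splits)
    have 2: "(\<Sum>(j, j')\<in>{1..M} \<times> {1..M}. card E * h * (1 + L * G / max j j'))
      = card E * h * (\<Sum>j\<in>{1..M}. \<Sum>j'\<in>{1..M}. 1 + L * G * (1 / real (max j j')))"
      by (simp add: sum.cartesian_product sum_distrib_left case_prod_unfold)
    have 3: "(\<Sum>j\<in>{1..M}. \<Sum>j'\<in>{1..M}. 1 + L * G * (1 / real (max j j')))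
      = (real M)\<^sup>2 + L * G * (\<Sum>j\<in>{1..M}. \<Sum>j'\<in>{1..M}. 1 / real (max j j'))"
      by (simp only: sum.distrib sum_distrib_left[symmetric]) (simp add: power2_eq_square)
    have "(\<Sum>(j, j')\<in>{1..M} \<times> {1..M}. card E * h * (1 + L * G / max j j')
          + (if gcd j j' > G then card E * (real L)\<^sup>2 else 0)) =
       (\<Sum>(j, j')\<in>{1..M} \<times> {1..M}. card E * h * (1 + L * G / max j j')) +
       (\<Sum>(j, j')\<in>{1..M} \<times> {1..M}. if gcd j j' > G then card E * (real L)\<^sup>2 else 0)"
      unfolding case_prod_unfold by (rule sum.distrib)
    then show ?thesis unfolding 1 2 3 by simp
  qed
  also have "\<dots> \<le> card E * h * ((real M)\<^sup>2 + L * G * (2 * M)) + (real M)\<^sup>2 / G * (card E * (real L)\<^sup>2)"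
    using sum_inverse_max_le[of M] card_gcd_gt_le[OF G, of M]
    by (intro add_mono mult_left_mono mult_right_mono) (auto intro!: mult_left_mono)
  also have "\<dots> = card E * (h * ((real M)\<^sup>2 + 2 * G * L * M) + (real L * real M)\<^sup>2 / G)"
    by (simp add: algebra_simps power2_eq_square)
  finally have s2: "(\<Sum>x\<in>E. (real (card (P x)))\<^sup>2)
      \<le> card E * (h * ((real M)\<^sup>2 + 2 * G * L * M) + (real L * real M)\<^sup>2 / G)"
    unfolding sq .
  have "(real V)\<^sup>2 \<le> card E * (\<Sum>x\<in>E. (real (card (P x)))\<^sup>2)"
    unfolding V by (rule sum_squared_le_card_sum_squares)
  also have "\<dots> \<le> card E * (card E * (h * ((real M)\<^sup>2 + 2 * G * L * M) + (real L * real M)\<^sup>2 / G))"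
    by (intro mult_left_mono s2) auto
  finally show ?thesis by (simp add: V_def power2_eq_square mult.assoc)
qed

text \<open>If \<open>k\<close> and \<open>j\<close> have opposite signs, exchanging the two ends of
  the pair makes the shift positive, so each of the four sign patterns is an image of the positive
  case. The cases \<open>k = 0\<close> and \<open>j = 0\<close> give the trivial term.\<close>

lemma shift_pairs_split:
  fixes E :: "(nat \<Rightarrow> int) set"
  assumes E: "finite E"
  shows "card {(x, k, j). x \<in> E \<and> k \<in> {-int L..int L} \<and> j \<in> {-int M..int M} \<and> bump i x (k * j) \<in> E}
     \<le> card E * ((2 * M + 1) + (2 * L + 1))
       + 4 * card {(x, k, j). x \<in> E \<and> k \<in> {1..L} \<and> j \<in> {1..M} \<and> bump i x (int k * int j) \<in> E}"
    (is "card ?V \<le> _ + 4 * card ?P")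
proof -
  have fP: "finite ?P" by (rule finite_subset[of _ "E \<times> {1..L} \<times> {1..M}"]) (use E in auto)
  let ?f1 = "\<lambda>(x, k, j). (x, int k, int j)"
  let ?f2 = "\<lambda>(x, k, j). (x, - int k, - int j)"
  let ?f3 = "\<lambda>(x, k, j). (bump i x (int k * int j), int k, - int j)"
  let ?f4 = "\<lambda>(x, k, j). (bump i x (int k * int j), - int k, int j)"
  let ?A = "E \<times> {0::int} \<times> {-int M..int M}"
  let ?B = "E \<times> {-int L..int L} \<times> {0::int}"
  have "?V \<subseteq> (?A \<union> ?B) \<union> ((?f1 ` ?P \<union> ?f2 ` ?P) \<union> (?f3 ` ?P \<union> ?f4 ` ?P))"
  proof
    fix p assume "p \<in> ?V"
    then obtain x and k j :: int where p: "p = (x, k, j)" and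
      x: "x \<in> E" "k \<in> {-int L..int L}" "j \<in> {-int M..int M}" "bump i x (k * j) \<in> E"
      by auto
    consider "k = 0" | "j = 0" | "k > 0" "j > 0" | "k < 0" "j < 0" | "k > 0" "j < 0" | "k < 0" "j > 0"
      by linarith
    then show "p \<in> (?A \<union> ?B) \<union> ((?f1 ` ?P \<union> ?f2 ` ?P) \<union> (?f3 ` ?P \<union> ?f4 ` ?P))"
    proof cases
      case 1
      then show ?thesis using p x by auto
    next
      case 2
      then show ?thesis using p x by auto
    next
      case 3
      then have "(x, nat k, nat j) \<in> ?P" using x by auto
      then have "?f1 (x, nat k, nat j) \<in> ?f1 ` ?P" by (rule imageI)
      then have "p \<in> ?f1 ` ?P" using 3 p by simp
      then show ?thesis by blast
    next
      case 4
      then have "(x, nat (-k), nat (-j)) \<in> ?P" using x by auto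
      then have "?f2 (x, nat (-k), nat (-j)) \<in> ?f2 ` ?P" by (rule imageI)
      then have "p \<in> ?f2 ` ?P" using 4 p by simp
      then show ?thesis by blast
    next
      case 5
      then have "(bump i x (k * j), nat k, nat (-j)) \<in> ?P" using x by auto
      then have "?f3 (bump i x (k * j), nat k, nat (-j)) \<in> ?f3 ` ?P" by (rule imageI)
      then have "p \<in> ?f3 ` ?P" using 5 p by simp
      then show ?thesis by blast
    next
      case 6
      then have "(bump i x (k * j), nat (-k), nat j) \<in> ?P" using x by auto
      then have "?f4 (bump i x (k * j), nat (-k), nat j) \<in> ?f4 ` ?P" by (rule imageI)
      then have "p \<in> ?f4 ` ?P" using 6 p by simp
      then show ?thesis by blast
    qed
  qed
  then have "card ?V \<le> card ((?A \<union> ?B) \<union> ((?f1 ` ?P \<union> ?f2 ` ?P) \<union> (?f3 ` ?P \<union> ?f4 ` ?P)))"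
    by (rule card_mono[rotated]) (use fP E in auto)
  also have "\<dots> \<le> (card ?A + card ?B) + ((card ?P + card ?P) + (card ?P + card ?P))"
    by (intro order_trans[OF card_Un_le] add_mono card_image_le fP) auto
  also have "\<dots> = card E * ((2 * M + 1) + (2 * L + 1)) + 4 * card ?P"
    by (simp add: card_cartesian_product algebra_simps nat_add_distrib nat_mult_distrib)
  finally show ?thesis .
qed

section \<open>From lines in arbitrary directions to axis-parallel shifts; sets with sparse
  rows\<close>

definition cube :: "nat \<Rightarrow> int set \<Rightarrow> (nat \<Rightarrow> int) set" where
  "cube d A = {x. (\<forall>i<d. x i \<in> A) \<and> (\<forall>i\<ge>d. x i = 0)}"

lemma grid_eq_cube: "grid d N = cube d {1..int N}"
  by (auto simp: grid_def cube_def)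

lemma bij_betw_cube_PiE:
  "bij_betw (\<lambda>x. restrict x {..<d}) (cube d A) (PiE {..<d} (\<lambda>_. A))"
  by (rule bij_betw_byWitness[where f' = "\<lambda>f i. if i < d then f i else 0"])
    (auto simp: cube_def fun_eq_iff PiE_def extensional_def not_less)

lemma card_cube: "card (cube d A) = card A ^ d"
  using bij_betw_same_card[OF bij_betw_cube_PiE, of d A] by (simp add: card_PiE)

lemma finite_cube: "finite A \<Longrightarrow> finite (cube d A)"
  using bij_betw_finite[OF bij_betw_cube_PiE, of d A] by (simp add: finite_PiE)

lemma cube_mono: "A \<subseteq> B \<Longrightarrow> cube d A \<subseteq> cube d B"
  by (auto simp: cube_def)

definition line_pt :: "(nat \<Rightarrow> int) \<Rightarrow> int \<Rightarrow> (nat \<Rightarrow> int) \<Rightarrow> (nat \<Rightarrow> int)" where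
  "line_pt x k b = (\<lambda>i. x i + k * b i)"

lemma line_pt_zero [simp]: "line_pt x 0 b = x"
  by (simp add: line_pt_def)

lemma line_pt_line_pt [simp]: "line_pt (line_pt x j b) k b = line_pt x (j + k) b"
  by (simp add: line_pt_def algebra_simps)

lemma line_pt_cancel: "line_pt x k b = line_pt y k b \<longleftrightarrow> x = y"
  by (auto simp: line_pt_def fun_eq_iff)

lemma line_pt_inj: "b \<noteq> (\<lambda>_. 0) \<Longrightarrow> line_pt x j b = line_pt x k b \<longleftrightarrow> j = k"
  by (auto simp: line_pt_def fun_eq_iff)

text \<open>Cauchy--Schwarz over all but the \<open>i\<close>-th coordinate of the difference \<open>b\<close>. The averaging over
  \<open>t\<close> replaces a sum over the cube of directions with \<open>b i = 0\<close>.\<close>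

lemma line_pairs_bound:
  fixes E F :: "(nat \<Rightarrow> int) set" and R L d :: nat
  assumes E: "finite E" and F: "finite F" and i: "i < d"
  defines "Bx \<equiv> cube d {-int R..int R}"
  shows "(real (card {(b, k, y). b \<in> Bx \<and> k \<in> {-int L..int L} \<and> y \<in> F \<and> line_pt y k b \<in> E}))\<^sup>2 * (2 * R + 1)
    \<le> ((2 * R + 1) ^ d)\<^sup>2 * (2 * L + 1) * card F *
       card {(x, k, j). x \<in> E \<and> k \<in> {-int L..int L} \<and> j \<in> {-int (2 * R)..int (2 * R)} \<and> bump i x (k * j) \<in> E}"
proof -
  let ?T = "{-int R..int R}" and ?K = "{-int L..int L}" and ?J = "{-int (2 * R)..int (2 * R)}"
  define r where "r = 2 * real R + 1"
  have r: "r > 0" by (simp add: r_def)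
  have cT: "real (card ?T) = r" by (simp add: r_def)
  have cK: "real (card ?K) = 2 * L + 1" by simp
  have fBx: "finite Bx" by (simp add: Bx_def finite_cube)
  have cBx: "real (card Bx) = r ^ d" by (simp add: Bx_def card_cube cT[symmetric])
  define W where "W = {(b, k, y). b \<in> Bx \<and> k \<in> ?K \<and> y \<in> F \<and> line_pt y k b \<in> E}"
  define V where "V = {(x, k, j). x \<in> E \<and> k \<in> ?K \<and> j \<in> ?J \<and> bump i x (k * j) \<in> E}"
  define V' where "V' k = {(x, j). x \<in> E \<and> j \<in> ?J \<and> bump i x (k * j) \<in> E}" for k
  define H where "H b k y = {t \<in> ?T. line_pt y k (b(i := t)) \<in> E}" for b k y
  have fH: "finite (H b k y)" for b k y by (rule finite_subset[of _ ?T]) (auto simp: H_def)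
  have fV': "finite (V' k)" for k by (rule finite_subset[of _ "E \<times> ?J"]) (use E in \<open>auto simp: V'_def\<close>)
  have upd: "b(i := t) \<in> Bx" if "b \<in> Bx" "t \<in> ?T" for b t
    using that i by (auto simp: Bx_def cube_def)
  have coord: "b i \<in> ?T" if "b \<in> Bx" for b
    using that i by (auto simp: Bx_def cube_def)
  \<comment> \<open>Exchanging \<open>b i\<close> with \<open>t\<close> is an involution. It shows
    that summing the fibre sizes \<open>card (H b k y)\<close> over all \<open>b\<close> counts each
    element of \<open>W\<close> once for every value of the overwritten coordinate.\<close>
  have "bij_betw (\<lambda>((b, k, y), t). ((b(i := t), k, y), b i)) (Sigma (Bx \<times> ?K \<times> F) (\<lambda>(b, k, y). H b k y)) (W \<times> ?T)"
  proof (rule bij_betw_byWitness[where f' = "\<lambda>((b, k, y), t). ((b(i := t), k, y), b i)"])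
    show "(\<lambda>((b, k, y), t). ((b(i := t), k, y), b i)) ` Sigma (Bx \<times> ?K \<times> F) (\<lambda>(b, k, y). H b k y) \<subseteq> W \<times> ?T"
    proof
      fix p assume "p \<in> (\<lambda>((b, k, y), t). ((b(i := t), k, y), b i)) ` Sigma (Bx \<times> ?K \<times> F) (\<lambda>(b, k, y). H b k y)"
      then obtain b k y t where p: "p = ((b(i := t), k, y), b i)" "b \<in> Bx" "k \<in> ?K" "y \<in> F" "t \<in> H b k y"
        by auto
      then have "t \<in> ?T" "line_pt y k (b(i := t)) \<in> E" by (simp_all add: H_def)
      then show "p \<in> W \<times> ?T" using p upd[of b t] coord[of b] by (simp add: W_def)
    qed
    show "(\<lambda>((b, k, y), t). ((b(i := t), k, y), b i)) ` (W \<times> ?T) \<subseteq> Sigma (Bx \<times> ?K \<times> F) (\<lambda>(b, k, y). H b k y)"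
    proof
      fix p assume "p \<in> (\<lambda>((b, k, y), t). ((b(i := t), k, y), b i)) ` (W \<times> ?T)"
      then obtain b k y t where p: "p = ((b(i := t), k, y), b i)" "(b, k, y) \<in> W" "t \<in> ?T"
        by auto
      then have w: "b \<in> Bx" "k \<in> ?K" "y \<in> F" "line_pt y k b \<in> E" by (simp_all add: W_def)
      then have "b i \<in> H (b(i := t)) k y" using coord[of b] by (simp add: H_def)
      then show "p \<in> Sigma (Bx \<times> ?K \<times> F) (\<lambda>(b, k, y). H b k y)" using p w upd[of b t] by simp
    qed
  qed (simp_all add: case_prod_unfold)
  then have "card (W \<times> ?T) = card (Sigma (Bx \<times> ?K \<times> F) (\<lambda>(b, k, y). H b k y))"
    by (rule bij_betw_same_card[symmetric])
  also have "\<dots> = (\<Sum>(b, k, y)\<in>Bx \<times> ?K \<times> F. card (H b k y))"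
    using fBx F fH by (subst card_SigmaI) (auto simp: case_prod_unfold)
  finally have "real (card (W \<times> ?T)) = (\<Sum>(b, k, y)\<in>Bx \<times> ?K \<times> F. real (card (H b k y)))"
    by (simp add: case_prod_unfold)
  then have Wr: "card W * r = (\<Sum>(b, k, y)\<in>Bx \<times> ?K \<times> F. real (card (H b k y)))"
    by (simp only: card_cartesian_product of_nat_mult cT)
  \<comment> \<open>Two hits \<open>t\<close>, \<open>t'\<close> from the same \<open>y\<close> are
    points of \<open>E\<close> that differ by \<open>k * (t' - t)\<close> in coordinate
    \<open>i\<close>; differences of entries explain the range \<open>2 * R\<close>. Keeping
    \<open>t\<close> in the code allows \<open>y\<close> to be recovered.\<close>
  have HH: "(\<Sum>y\<in>F. (real (card (H b k y)))\<^sup>2) \<le> r * card (V' k)" if "b \<in> Bx" for b k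
  proof -
    have "(\<Sum>y\<in>F. (real (card (H b k y)))\<^sup>2) = real (card (Sigma F (\<lambda>y. H b k y \<times> H b k y)))"
      using F fH by (subst card_SigmaI) (auto simp: card_cartesian_product power2_eq_square)
    also have "card (Sigma F (\<lambda>y. H b k y \<times> H b k y)) \<le> card (?T \<times> V' k)"
    proof (rule card_inj_on_le[where f = "\<lambda>(y, t, t'). (t, line_pt y k (b(i := t)), t' - t)"])
      show "inj_on (\<lambda>(y, t, t'). (t, line_pt y k (b(i := t)), t' - t)) (Sigma F (\<lambda>y. H b k y \<times> H b k y))"
        by (auto simp: inj_on_def line_pt_cancel)
      have "bump i (line_pt y k (b(i := t))) (k * (t' - t)) = line_pt y k (b(i := t'))" for y t t'
        by (auto simp: bump_def line_pt_def fun_eq_iff algebra_simps)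
      then show "(\<lambda>(y, t, t'). (t, line_pt y k (b(i := t)), t' - t)) ` (Sigma F (\<lambda>y. H b k y \<times> H b k y)) \<subseteq> ?T \<times> V' k"
        by (auto simp: H_def V'_def)
    qed (use fV' in auto)
    also have "real (card (?T \<times> V' k)) = r * card (V' k)" by (simp only: card_cartesian_product of_nat_mult cT)
    finally show ?thesis by simp
  qed
  have cV: "(\<Sum>k\<in>?K. real (card (V' k))) = card V"
  proof -
    have "bij_betw (\<lambda>(k, (x, j)). (x, k, j)) (Sigma ?K V') V"
      by (rule bij_betw_byWitness[where f' = "\<lambda>(x, k, j). (k, (x, j))"]) (auto simp: V'_def V_def)
    then have "card V = card (Sigma ?K V')" by (metis bij_betw_same_card)
    also have "\<dots> = (\<Sum>k\<in>?K. card (V' k))" using fV' by (subst card_SigmaI) auto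
    finally show ?thesis by simp
  qed
  have "(card W * r)\<^sup>2 \<le> card (Bx \<times> ?K \<times> F) * (\<Sum>p\<in>Bx \<times> ?K \<times> F. (real (card (case p of (b, k, y) \<Rightarrow> H b k y)))\<^sup>2)"
    unfolding Wr by (rule order_trans[OF _ sum_squared_le_card_sum_squares]) (simp add: case_prod_unfold)
  also have "(\<Sum>p\<in>Bx \<times> ?K \<times> F. (real (card (case p of (b, k, y) \<Rightarrow> H b k y)))\<^sup>2)
      = (\<Sum>b\<in>Bx. \<Sum>k\<in>?K. \<Sum>y\<in>F. (real (card (H b k y)))\<^sup>2)"
    by (simp add: sum.cartesian_product case_prod_unfold)
  also have "real (card (Bx \<times> ?K \<times> F)) = r ^ d * (2 * L + 1) * card F"
    by (simp only: card_cartesian_product of_nat_mult cBx cK mult.assoc)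
  also have "(\<Sum>b\<in>Bx. \<Sum>k\<in>?K. \<Sum>y\<in>F. (real (card (H b k y)))\<^sup>2) \<le> (\<Sum>b\<in>Bx. \<Sum>k\<in>?K. r * card (V' k))"
    by (intro sum_mono HH)
  also have "(\<Sum>b\<in>Bx. \<Sum>k\<in>?K. r * card (V' k)) = r ^ d * r * card V"
    by (simp add: sum_distrib_left[symmetric] cV cBx)
  finally have "(card W * r)\<^sup>2 \<le> r ^ d * (2 * L + 1) * card F * (r ^ d * r * card V)"
    using r by (simp add: mult_left_mono)
  then have "((card W)\<^sup>2 * r) * r \<le> ((r ^ d)\<^sup>2 * (2 * L + 1) * card F * card V) * r"
    by (simp add: power2_eq_square mult_ac)
  then have "(card W)\<^sup>2 * r \<le> (r ^ d)\<^sup>2 * (2 * L + 1) * card F * card V"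
    using r by (simp only: mult_le_cancel_right_pos)
  then show ?thesis
    unfolding W_def V_def r_def by (simp only: of_nat_add of_nat_mult of_nat_numeral of_nat_1 of_nat_power)
qed

text \<open>Peeling off, coordinate by coordinate, the points whose row in that direction is sparse. A point
  surviving all \<open>d\<close> rounds would generate more than \<open>h ^ d\<close> points of \<open>X\<close>.\<close>

lemma sparse_row_partition:
  fixes X :: "(nat \<Rightarrow> int) set" and h d :: nat
  assumes X: "finite X" and cX: "card X < (h + 1) ^ d"
  obtains E where "X = (\<Union>i<d. E i)" "\<And>i x. i < d \<Longrightarrow> x \<in> E i \<Longrightarrow> card (axis_row i (E i) x) \<le> h"
proof -
  define Z where "Z = rec_nat X (\<lambda>i Z. {x \<in> Z. card (axis_row i Z x) > h})"
  have Z0: "Z 0 = X" and ZS: "Z (Suc i) = {x \<in> Z i. card (axis_row i (Z i) x) > h}" for i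
    by (auto simp: Z_def)
  have ZX: "Z i \<subseteq> X" for i by (induction i) (auto simp: Z0 ZS)
  have finZ: "finite (Z i)" for i using ZX X finite_subset by blast
  \<comment> \<open>The points of \<open>X\<close> that agree with \<open>x\<close> from coordinate
    \<open>j\<close> on. A survivor of round \<open>j\<close> has more than \<open>h\<close>
    survivors of the earlier rounds in its row, and their tails are disjoint, so the count gains a
    factor \<open>h + 1\<close> per round.\<close>
  define tail where "tail j x = {y \<in> X. \<forall>k\<ge>j. y k = x k}" for j and x :: "nat \<Rightarrow> int"
  have fint: "finite (tail j x)" for j x using X by (simp add: tail_def)
  have big: "(h + 1) ^ j \<le> card (tail j x)" if "x \<in> Z j" for j x
    using that
  proof (induction j arbitrary: x)
    case 0
    then have "x \<in> tail 0 x" by (auto simp: Z0 tail_def)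
    then show ?case using fint[of 0 x] by (auto simp: Suc_le_eq card_gt_0_iff)
  next
    case (Suc j)
    define Y where "Y = axis_row j (Z j) x"
    have Y: "card Y \<ge> h + 1" "Y \<subseteq> Z j" "finite Y" using Suc.prems finZ by (auto simp: ZS Y_def axis_row_def)
    have "(h + 1) ^ Suc j \<le> (\<Sum>y\<in>Y. (h + 1) ^ j)" using mult_le_mono1[OF Y(1), of "(h + 1) ^ j"] by simp
    also have "\<dots> \<le> (\<Sum>y\<in>Y. card (tail j y))" using Y(2) by (intro sum_mono Suc.IH) auto
    also have "\<dots> = card (\<Union>y\<in>Y. tail j y)"
    proof (rule card_UN_disjoint[symmetric])
      show "\<forall>y\<in>Y. \<forall>y'\<in>Y. y \<noteq> y' \<longrightarrow> tail j y \<inter> tail j y' = {}"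
      proof (intro ballI impI)
        fix y y' assume y: "y \<in> Y" "y' \<in> Y" "y \<noteq> y'"
        then have "\<And>k. k \<noteq> j \<Longrightarrow> y k = y' k" by (auto simp: Y_def axis_row_def)
        then have "y j \<noteq> y' j" using y(3) by (metis ext)
        then show "tail j y \<inter> tail j y' = {}" by (auto simp: tail_def)
      qed
    qed (use Y fint in auto)
    also have "\<dots> \<le> card (tail (Suc j) x)"
      by (rule card_mono[OF fint]) (auto simp: tail_def Y_def axis_row_def)
    finally show ?case .
  qed
  have "Z d = {}"
  proof (rule ccontr)
    assume "Z d \<noteq> {}"
    then obtain x where "x \<in> Z d" by auto
    then have "(h + 1) ^ d \<le> card (tail d x)" by (rule big)
    also have "\<dots> \<le> card X" using X by (intro card_mono) (auto simp: tail_def)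
    finally show False using cX by simp
  qed
  define E where "E i = Z i - Z (Suc i)" for i
  have "X = (\<Union>i<j. E i) \<union> Z j" for j
    by (induction j) (use ZX in \<open>auto simp: Z0 E_def ZS lessThan_Suc\<close>)
  from this[of d] have "X = (\<Union>i<d. E i)" using \<open>Z d = {}\<close> by simp
  moreover have "card (axis_row i (E i) x) \<le> h" if "x \<in> E i" for i x
  proof -
    have "card (axis_row i (E i) x) \<le> card (axis_row i (Z i) x)"
      using finZ by (intro card_mono) (auto simp: axis_row_def E_def)
    also have "\<dots> \<le> h" using that by (auto simp: E_def ZS)
    finally show ?thesis .
  qed
  ultimately show ?thesis using that by blast
qed

section \<open>Counting rich blocks\<close>

text \<open>The \<open>s\<close> points occupy distinct multiples of \<open>b\<close>, so the
  extreme ones are at least \<open>s - 1 \<ge> s / 2\<close> steps apart, while their coordinates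
  differ by at most \<open>N\<close>.\<close>

lemma block_direction_bound:
  assumes S: "S \<subseteq> grid d N" "card S = s" "s \<ge> 2" and i: "i < d"
    and line: "\<And>x y. x \<in> S \<Longrightarrow> y \<in> S \<Longrightarrow> \<exists>k. y = line_pt x k b"
  shows "int s * \<bar>b i\<bar> \<le> 2 * int N"
proof -
  have fS: "finite S" using S by (metis card.infinite not_numeral_le_zero)
  obtain x where x: "x \<in> S" using S by fastforce
  have "\<exists>\<kappa>. \<forall>y\<in>S. y = line_pt x (\<kappa> y) b" using line[OF x] by metis
  then obtain \<kappa> where \<kappa>: "\<And>y. y \<in> S \<Longrightarrow> y = line_pt x (\<kappa> y) b" by metis
  have inj: "inj_on \<kappa> S" by (rule inj_onI) (metis \<kappa>)
  define A where "A = \<kappa> ` S"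
  have A: "finite A" "A \<noteq> {}" "card A = s" using fS x inj S by (auto simp: A_def card_image)
  have "A \<subseteq> {Min A..Max A}" using A by auto
  then have "card A \<le> nat (Max A - Min A + 1)" using card_mono[of "{Min A..Max A}" A] by simp
  then have gap: "int s - 1 \<le> Max A - Min A" using A(3) S(3) by linarith
  obtain y z where yz: "y \<in> S" "\<kappa> y = Max A" "z \<in> S" "\<kappa> z = Min A"
    using Max_in[OF A(1,2)] Min_in[OF A(1,2)] by (auto simp: A_def)
  have "y i = x i + Max A * b i" "z i = x i + Min A * b i"
    using \<kappa>[OF yz(1)] \<kappa>[OF yz(3)] yz by (metis line_pt_def)+
  then have "y i - z i = (Max A - Min A) * b i" by (simp add: algebra_simps)
  moreover have "\<bar>y i - z i\<bar> \<le> int N"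
  proof -
    have "y \<in> grid d N" "z \<in> grid d N" using yz S(1) by auto
    then have "1 \<le> y i \<and> y i \<le> int N" "1 \<le> z i \<and> z i \<le> int N" using i by (simp_all add: grid_def)
    then show ?thesis by linarith
  qed
  ultimately have "(Max A - Min A) * \<bar>b i\<bar> \<le> int N"
    using gap S(3) by (simp add: abs_mult)
  moreover have "int s * \<bar>b i\<bar> \<le> (2 * (Max A - Min A)) * \<bar>b i\<bar>"
    using gap S(3) by (intro mult_right_mono) auto
  ultimately show ?thesis by linarith
qed

text \<open>A block contributes all its \<open>s * s\<close> ordered pairs, diagonal ones with
  \<open>k = 0\<close> included. Pairs from disjoint blocks are distinct, and a pair is determined
  by its first point and the multiplier. This reduces rich blocks to pair counting.\<close>

lemma card_big_blocks_le:
  fixes X :: "(nat \<Rightarrow> int) set" and \<B> :: "(nat \<Rightarrow> int) set set"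
  assumes X: "finite X" and B: "\<And>S. S \<in> \<B> \<Longrightarrow> S \<subseteq> X \<and> card S = s" "disjoint \<B>"
    and line: "\<And>S x y. S \<in> \<B> \<Longrightarrow> x \<in> S \<Longrightarrow> y \<in> S \<Longrightarrow> \<exists>k\<in>{-int L..int L}. y = line_pt x k b"
  shows "card \<B> * (s * s) \<le> card {(k, y). k \<in> {-int L..int L} \<and> y \<in> X \<and> line_pt y k b \<in> X}"
proof -
  have fB: "finite \<B>" by (rule finite_subset[of _ "Pow X"]) (use B X in auto)
  have fS: "finite S" if "S \<in> \<B>" for S using B that X finite_subset by blast
  have "card (\<Union>S\<in>\<B>. S \<times> S) = (\<Sum>S\<in>\<B>. card (S \<times> S))"
    by (rule card_UN_disjoint) (use fB fS B(2) in \<open>auto simp: disjoint_def\<close>)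
  also have "\<dots> = (\<Sum>S\<in>\<B>. s * s)" by (rule sum.cong) (use B in \<open>auto simp: card_cartesian_product\<close>)
  finally have c: "card (\<Union>S\<in>\<B>. S \<times> S) = card \<B> * (s * s)" by simp
  define \<kappa> where "\<kappa> p = (SOME k. k \<in> {-int L..int L} \<and> snd p = line_pt (fst p) k b)" for p
  have \<kappa>: "\<kappa> p \<in> {-int L..int L} \<and> snd p = line_pt (fst p) (\<kappa> p) b" if "p \<in> (\<Union>S\<in>\<B>. S \<times> S)" for p
    unfolding \<kappa>_def by (rule someI_ex) (use that line in force)
  show ?thesis unfolding c[symmetric]
  proof (rule card_inj_on_le[where f = "\<lambda>p. (\<kappa> p, fst p)"])
    show "inj_on (\<lambda>p. (\<kappa> p, fst p)) (\<Union>S\<in>\<B>. S \<times> S)"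
    proof (rule inj_onI)
      fix p q assume "p \<in> (\<Union>S\<in>\<B>. S \<times> S)" "q \<in> (\<Union>S\<in>\<B>. S \<times> S)" "(\<kappa> p, fst p) = (\<kappa> q, fst q)"
      then show "p = q" using \<kappa>[of p] \<kappa>[of q] by (metis prod.inject prod_eqI)
    qed
    show "(\<lambda>p. (\<kappa> p, fst p)) ` (\<Union>S\<in>\<B>. S \<times> S) \<subseteq> {(k, y). k \<in> {-int L..int L} \<and> y \<in> X \<and> line_pt y k b \<in> X}"
    proof
      fix q assume "q \<in> (\<lambda>p. (\<kappa> p, fst p)) ` (\<Union>S\<in>\<B>. S \<times> S)"
      then obtain p where p: "p \<in> (\<Union>S\<in>\<B>. S \<times> S)" "q = (\<kappa> p, fst p)" by auto
      then obtain S where "S \<in> \<B>" "fst p \<in> S" "snd p \<in> S" by auto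
      then have "fst p \<in> X" "snd p \<in> X" using B(1)[of S] by auto
      then show "q \<in> {(k, y). k \<in> {-int L..int L} \<and> y \<in> X \<and> line_pt y k b \<in> X}"
        using \<kappa>[OF p(1)] p(2) by auto
    qed
    show "finite {(k, y). k \<in> {-int L..int L} \<and> y \<in> X \<and> line_pt y k b \<in> X}"
      by (rule finite_subset[of _ "{-int L..int L} \<times> X"]) (use X in auto)
  qed
qed

lemma shift_pairs_bound:
  fixes E :: "(nat \<Rightarrow> int) set" and G L M h :: nat
  assumes E: "finite E" and row: "\<And>x. x \<in> E \<Longrightarrow> card (axis_row i E x) \<le> h" and G: "G \<ge> 1"
  shows "real (card {(x, k, j). x \<in> E \<and> k \<in> {-int L..int L} \<and> j \<in> {-int M..int M} \<and> bump i x (k * j) \<in> E})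
     \<le> card E * ((2 * real M + 1) + (2 * real L + 1)
         + 4 * sqrt (h * ((real M)\<^sup>2 + 2 * G * L * M) + (real L * real M)\<^sup>2 / G))"
proof -
  define P where "P = card {(x, k, j). x \<in> E \<and> k \<in> {1..L} \<and> j \<in> {1..M} \<and> bump i x (int k * int j) \<in> E}"
  define Z where "Z = h * ((real M)\<^sup>2 + 2 * G * L * M) + (real L * real M)\<^sup>2 / G"
  have Z: "Z \<ge> 0" by (simp add: Z_def)
  have "(real P)\<^sup>2 \<le> (real (card E))\<^sup>2 * Z"
    unfolding P_def Z_def by (rule positive_shift_pairs_bound[OF E row G])
  also have "\<dots> = (card E * sqrt Z)\<^sup>2" using Z by (simp add: power_mult_distrib)
  finally have "real P \<le> card E * sqrt Z" by (rule power2_le_imp_le) (use Z in auto)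
  moreover have "real (card {(x, k, j). x \<in> E \<and> k \<in> {-int L..int L} \<and> j \<in> {-int M..int M} \<and> bump i x (k * j) \<in> E})
     \<le> real (card E * ((2 * M + 1) + (2 * L + 1)) + 4 * P)"
    unfolding P_def of_nat_le_iff by (rule shift_pairs_split[OF E])
  ultimately show ?thesis unfolding Z_def[symmetric] by (simp add: algebra_simps)
qed

text \<open>Here \<open>B ^ d\<close> is the critical length and \<rho> its ratio to the block size.
  Compared with the trivial count, of order \<open>(2 * R + 1) ^ d * L * card X\<close>, the gain is
  \<open>\<zeta>\<^sup>2\<close>: the axis-parallel count gains \<open>\<zeta> ^ 4\<close>, and the
  reduction to it takes a square root. The factor \<open>\<rho> + 1 / \<rho>\<close> allows for
  block sizes away from the critical length.\<close>

lemma line_pairs_sparse_rows_bound: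
  fixes E X :: "(nat \<Rightarrow> int) set" and d i h s N L R :: nat and B \<zeta> :: real
  assumes X: "finite X" "E \<subseteq> X" and i: "i < d" and row: "\<And>x. x \<in> E \<Longrightarrow> card (axis_row i E x) \<le> h"
    and B: "B \<ge> 1" "B ^ (d + 1) = N" "B * \<zeta> ^ 16 \<ge> 1" and \<zeta>: "0 < \<zeta>" "\<zeta> \<le> 1" and h: "real h \<le> \<zeta> ^ 16 * N"
    and s: "s \<ge> 1" and L: "real L \<ge> s / \<zeta>" and R: "real R \<ge> N / s"
  defines "\<rho> \<equiv> B ^ d / s"
  shows "real (card {(b, k, y). b \<in> cube d {-int R..int R} \<and> k \<in> {-int L..int L} \<and> y \<in> X \<and> line_pt y k b \<in> E})
     \<le> 7 * (2 * real R + 1) ^ d * real L * real (card X) * \<zeta>\<^sup>2 * (\<rho> + 1 / \<rho>)"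
proof -
  define M where "M = 2 * R"
  \<comment> \<open>The threshold balances two errors: \<open>h * G\<close> is at most
    \<open>2 * \<zeta> ^ 8 * N\<close>, and the pairs of larger gcd contribute a share of
    \<open>1 / G \<le> \<zeta> ^ 8\<close>.\<close>
  define G where "G = nat \<lceil>1 / \<zeta> ^ 8\<rceil>"
  define m where "m = real (card X)"
  define K where "K = B ^ d"
  have d: "d \<ge> 1" using i by simp
  have K: "K \<ge> B" unfolding K_def using B d by (intro self_le_power) auto
  have K1: "K \<ge> 1" using K B by simp
  have NK: "N = K * B" by (simp add: K_def flip: B(2))
  have N0: "real N > 0" using NK K1 B by simp
  have \<rho>: "\<rho> > 0" "\<rho> * s = K" using K1 s by (auto simp: \<rho>_def K_def)
  define \<sigma> where "\<sigma> = \<rho> + 1 / \<rho>"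
  have \<sigma>: "\<sigma> \<ge> 2" "\<rho> \<le> \<sigma>" "1 / \<rho> \<le> \<sigma>"
  proof -
    have "0 \<le> (\<rho> - 1)\<^sup>2 / \<rho>" using \<rho> by simp
    also have "\<dots> = \<sigma> - 2" using \<rho> by (simp add: \<sigma>_def field_simps power2_eq_square)
    finally show "\<sigma> \<ge> 2" by simp
  qed (use \<rho> in \<open>auto simp: \<sigma>_def\<close>)
  have z4: "\<zeta> ^ 16 \<le> \<zeta> ^ 4" "0 < \<zeta> ^ 4" using \<zeta> by (auto intro: power_decreasing)
  have z8: "1 / \<zeta> ^ 8 \<ge> 1" "0 < \<zeta> ^ 8" "\<zeta> ^ 16 \<le> \<zeta> ^ 8" using \<zeta> by (auto simp: power_le_one intro: power_decreasing)
  have G: "real G \<ge> 1 / \<zeta> ^ 8" "real G \<le> 2 / \<zeta> ^ 8" "G \<ge> 1"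
  proof -
    have "real G = of_int \<lceil>1 / \<zeta> ^ 8\<rceil>" using z8 by (simp add: G_def)
    then show g: "real G \<ge> 1 / \<zeta> ^ 8" by linarith
    show "real G \<le> 2 / \<zeta> ^ 8" using \<open>real G = _\<close> z8(1) by linarith
    show "G \<ge> 1" using g z8(1) by linarith
  qed
  have Ls: "real L \<ge> s" "real L > 0"
  proof -
    have "real s \<le> s / \<zeta>" using \<zeta> s by (simp add: field_simps)
    then show "real L \<ge> s" using L by linarith
    then show "real L > 0" using s by linarith
  qed
  have Ms: "real M \<ge> 2 * N / s" "real M > 0"
  proof -
    show "real M \<ge> 2 * N / s" using R by (simp add: M_def)
    moreover have "2 * N / s > 0" using N0 s by simp
    ultimately show "real M > 0" by linarith
  qed
  have LM: "real L * real M \<ge> 2 * N"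
  proof -
    have "s * (2 * N / s) \<le> real L * real M" using Ls Ms by (intro mult_mono) auto
    then show ?thesis using s by simp
  qed
  define Q where "Q = real L * real M"
  have Q: "Q > 0" using Ls Ms by (simp add: Q_def)
  have t1: "h * ((real M)\<^sup>2 + 2 * G * L * M) + (real L * real M)\<^sup>2 / G \<le> (Q * (\<zeta> ^ 4 * (\<rho> + 2)))\<^sup>2"
  proof -
    have a: "h * (real M)\<^sup>2 \<le> Q\<^sup>2 * (\<zeta> ^ 8 * \<rho>\<^sup>2)"
    proof -
      have "N \<le> K\<^sup>2" using NK K K1 by (simp add: power2_eq_square)
      also have "K\<^sup>2 = \<rho>\<^sup>2 * (real s)\<^sup>2" using \<rho>(2) by (metis power_mult_distrib)
      also have "\<dots> \<le> \<rho>\<^sup>2 * (real L)\<^sup>2" using Ls by (intro mult_left_mono power_mono) auto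
      finally have "N \<le> \<rho>\<^sup>2 * (real L)\<^sup>2" .
      then have "h \<le> \<zeta> ^ 16 * (\<rho>\<^sup>2 * (real L)\<^sup>2)" using h \<zeta> by (meson mult_left_mono order_trans zero_le_power less_imp_le)
      also have "\<dots> \<le> \<zeta> ^ 8 * (\<rho>\<^sup>2 * (real L)\<^sup>2)" using z8 by (intro mult_right_mono) auto
      finally have "h * (real M)\<^sup>2 \<le> \<zeta> ^ 8 * (\<rho>\<^sup>2 * (real L)\<^sup>2) * (real M)\<^sup>2" by (intro mult_right_mono) auto
      then show ?thesis by (simp add: Q_def power_mult_distrib mult_ac)
    qed
    have b: "h * (2 * G * L * M) \<le> Q\<^sup>2 * (\<zeta> ^ 8 * 2)"
    proof -
      have "real h * real G \<le> (\<zeta> ^ 16 * N) * (2 / \<zeta> ^ 8)" using h G by (intro mult_mono) auto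
      also have "\<dots> = \<zeta> ^ 8 * (2 * N)"
        using z8(2) by (simp add: field_simps flip: power_add)
      also have "\<dots> \<le> \<zeta> ^ 8 * Q" using LM z8 by (intro mult_left_mono) (auto simp: Q_def)
      finally have "(real h * real G) * (2 * Q) \<le> (\<zeta> ^ 8 * Q) * (2 * Q)" using Q by (intro mult_right_mono) auto
      then show ?thesis by (simp add: Q_def power2_eq_square mult_ac)
    qed
    have c: "(real L * real M)\<^sup>2 / G \<le> Q\<^sup>2 * \<zeta> ^ 8"
    proof -
      have "real G > 0" using G(3) by simp
      then have "1 / real G \<le> \<zeta> ^ 8" using G(1) z8(2) by (simp add: divide_le_eq mult.commute)
      then have "Q\<^sup>2 * (1 / real G) \<le> Q\<^sup>2 * \<zeta> ^ 8" by (intro mult_left_mono) auto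
      then show ?thesis by (simp add: Q_def)
    qed
    have "h * ((real M)\<^sup>2 + 2 * G * L * M) + (real L * real M)\<^sup>2 / G
        \<le> Q\<^sup>2 * (\<zeta> ^ 8 * \<rho>\<^sup>2) + Q\<^sup>2 * (\<zeta> ^ 8 * 2) + Q\<^sup>2 * \<zeta> ^ 8"
      using a b c by (simp add: distrib_left)
    also have "\<dots> = Q\<^sup>2 * \<zeta> ^ 8 * (\<rho>\<^sup>2 + 3)" by (simp add: algebra_simps)
    also have "\<dots> \<le> Q\<^sup>2 * \<zeta> ^ 8 * (\<rho> + 2)\<^sup>2"
      using \<rho> \<zeta> Q by (intro mult_left_mono) (auto simp: power2_eq_square algebra_simps)
    also have "\<dots> = (Q * (\<zeta> ^ 4 * (\<rho> + 2)))\<^sup>2" by (simp add: power_mult_distrib flip: power_mult)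
    finally show ?thesis .
  qed
  have t2: "sqrt (h * ((real M)\<^sup>2 + 2 * G * L * M) + (real L * real M)\<^sup>2 / G) \<le> Q * (\<zeta> ^ 4 * (\<rho> + 2))"
    using real_sqrt_le_mono[OF t1] Q \<rho> \<zeta> by simp
  \<comment> \<open>The degenerate shifts have to be absorbed into the same gain
    \<open>\<zeta> ^ 4\<close>. This is where \<open>B * \<zeta> ^ 16 \<ge> 1\<close> enters:
    \<zeta> must not be so small that the trivial solutions dominate.\<close>
  have t3: "(2 * real M + 1) + (2 * real L + 1) \<le> Q * (\<zeta> ^ 4 * (3 * \<rho> + 3 / \<rho>))"
  proof -
    have iz: "1 \<le> B * \<zeta> ^ 4" using B z4 by (smt (verit) mult_left_mono)
    have "1 \<le> K * \<zeta> ^ 4" using iz K z4 by (smt (verit) mult_right_mono)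
    also have "\<dots> = s * (\<zeta> ^ 4 * \<rho>)" by (simp add: \<rho>(2)[symmetric])
    also have "\<dots> \<le> L * (\<zeta> ^ 4 * \<rho>)" using Ls \<rho> \<zeta> by (intro mult_right_mono) auto
    finally have "real M * 1 \<le> real M * (L * (\<zeta> ^ 4 * \<rho>))" by (intro mult_left_mono) auto
    then have a: "M \<le> Q * (\<zeta> ^ 4 * \<rho>)" by (simp add: Q_def mult_ac)
    have "1 / \<rho> = s / K" using \<rho> s by (simp add: field_simps flip: \<rho>(2))
    then have "N / s * (1 / \<rho>) = N / K" using s by simp
    also have "\<dots> = B" using NK K1 by simp
    finally have "1 \<le> N / s * (1 / \<rho>) * \<zeta> ^ 4" using iz by simp
    also have "\<dots> \<le> M * (1 / \<rho>) * \<zeta> ^ 4"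
    proof (intro mult_right_mono)
      show "N / s \<le> real M" using R by (simp add: M_def)
    qed (use \<rho> \<zeta> in auto)
    finally have "real L * 1 \<le> real L * (M * (1 / \<rho>) * \<zeta> ^ 4)" by (intro mult_left_mono) auto
    then have b: "L \<le> Q * (\<zeta> ^ 4 * (1 / \<rho>))" by (simp add: Q_def mult_ac)
    have "M \<ge> 1" "L \<ge> 1" using Ms Ls by (auto simp: Suc_le_eq)
    then have "(2 * real M + 1) + (2 * real L + 1) \<le> 3 * real M + 3 * real L" by linarith
    also have "\<dots> \<le> 3 * (Q * (\<zeta> ^ 4 * \<rho>)) + 3 * (Q * (\<zeta> ^ 4 * (1 / \<rho>)))" using a b by linarith
    also have "\<dots> = Q * (\<zeta> ^ 4 * (3 * \<rho> + 3 / \<rho>))" by (simp add: algebra_simps)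
    finally show ?thesis .
  qed
  define V where "V = real (card {(x, k, j). x \<in> E \<and> k \<in> {-int L..int L} \<and> j \<in> {-int M..int M} \<and> bump i x (k * j) \<in> E})"
  have fE: "finite E" using X finite_subset by blast
  have cE: "real (card E) \<le> m" using X card_mono by (auto simp: m_def)
  have "V \<le> card E * ((2 * real M + 1) + (2 * real L + 1)
         + 4 * sqrt (h * ((real M)\<^sup>2 + 2 * G * L * M) + (real L * real M)\<^sup>2 / G))"
    unfolding V_def by (rule shift_pairs_bound[OF fE row G(3)])
  also have "\<dots> \<le> card E * (Q * (\<zeta> ^ 4 * (3 * \<rho> + 3 / \<rho>)) + 4 * (Q * (\<zeta> ^ 4 * (\<rho> + 2))))"
    using t2 t3 by (intro mult_left_mono add_mono) auto
  also have "\<dots> = card E * (Q * \<zeta> ^ 4 * (7 * \<rho> + 3 / \<rho> + 8))" by (simp add: algebra_simps)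
  also have "\<dots> \<le> m * (Q * \<zeta> ^ 4 * (16 * \<sigma>))"
  proof (intro mult_mono mult_left_mono)
    have "3 / \<rho> = 3 * (1 / \<rho>)" by simp
    then have "7 * \<rho> + 3 / \<rho> \<le> 7 * \<sigma>" using \<rho>(1) \<sigma>_def by (smt (verit) divide_pos_pos)
    then show "7 * \<rho> + 3 / \<rho> + 8 \<le> 16 * \<sigma>" using \<sigma> by linarith
  qed (use cE Q \<rho> \<zeta> in \<open>auto simp: m_def\<close>)
  finally have V: "V \<le> m * (Q * \<zeta> ^ 4 * (16 * \<sigma>))" .
  define r where "r = 2 * real R + 1"
  have r: "r > 0" "real M \<le> r" by (auto simp: r_def M_def)
  define W where "W = real (card {(b, k, y). b \<in> cube d {-int R..int R} \<and> k \<in> {-int L..int L} \<and> y \<in> X \<and> line_pt y k b \<in> E})"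
  have "W\<^sup>2 * r \<le> (r ^ d)\<^sup>2 * (2 * L + 1) * card X * V"
    using line_pairs_bound[OF fE X(1) i, of R L]
    unfolding W_def V_def r_def M_def by (simp only: of_nat_add of_nat_mult of_nat_numeral of_nat_1 of_nat_power)
  also have "\<dots> \<le> (r ^ d)\<^sup>2 * (2 * L + 1) * m * (m * (Q * \<zeta> ^ 4 * (16 * \<sigma>)))"
    using V r by (intro mult_mono) (auto simp: m_def V_def)
  also have "\<dots> = (r ^ d * m * \<zeta>\<^sup>2)\<^sup>2 * ((2 * real L + 1) * real L * (16 * \<sigma>)) * M"
    by (simp add: Q_def power2_eq_square power4_eq_xxxx algebra_simps)
  also have "\<dots> \<le> (r ^ d * m * \<zeta>\<^sup>2)\<^sup>2 * ((3 * real L) * real L * (16 * \<sigma>\<^sup>2)) * r"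
  proof (intro mult_mono mult_left_mono)
    show "2 * real L + 1 \<le> 3 * real L" using Ls by simp
    show "\<sigma> \<le> \<sigma>\<^sup>2" using \<sigma> by (simp add: power2_eq_square)
  qed (use r \<sigma> in auto)
  finally have "W\<^sup>2 \<le> (r ^ d * m * \<zeta>\<^sup>2)\<^sup>2 * ((3 * real L) * real L * (16 * \<sigma>\<^sup>2))"
    using r by (simp only: mult_le_cancel_right_pos)
  also have "\<dots> \<le> (7 * r ^ d * real L * m * \<zeta>\<^sup>2 * \<sigma>)\<^sup>2"
  proof -
    define Y where "Y = r ^ d * real L * m * \<zeta>\<^sup>2 * \<sigma>"
    have "(r ^ d * m * \<zeta>\<^sup>2)\<^sup>2 * ((3 * real L) * real L * (16 * \<sigma>\<^sup>2)) = 48 * Y\<^sup>2"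
      by (simp add: Y_def power2_eq_square)
    also have "\<dots> \<le> 49 * Y\<^sup>2" by simp
    also have "\<dots> = (7 * r ^ d * real L * m * \<zeta>\<^sup>2 * \<sigma>)\<^sup>2"
      by (simp add: Y_def power_mult_distrib)
    finally show ?thesis .
  qed
  finally have "W \<le> 7 * r ^ d * real L * m * \<zeta>\<^sup>2 * \<sigma>"
    by (rule power2_le_imp_le) (use r \<sigma> in \<open>auto simp: m_def\<close>)
  then show ?thesis by (simp add: W_def r_def m_def \<sigma>_def add.commute)
qed


lemma card_disjoint_blocks_le:
  fixes X :: "'a set"
  assumes X: "finite X" and B: "\<And>S. S \<in> \<B> \<Longrightarrow> S \<subseteq> X \<and> card S = s" "disjoint \<B>"
  shows "card \<B> * s \<le> card X"
proof -
  have fB: "finite \<B>" by (rule finite_subset[of _ "Pow X"]) (use B X in auto)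
  have fS: "finite S" if "S \<in> \<B>" for S using B that X finite_subset by blast
  have "card (\<Union>S\<in>\<B>. S) = (\<Sum>S\<in>\<B>. card S)"
    by (rule card_UN_disjoint) (use fB fS B(2) in \<open>auto simp: disjoint_def\<close>)
  also have "\<dots> = card \<B> * s" using B(1) by simp
  finally have "card \<B> * s = card (\<Union>S\<in>\<B>. S)" by simp
  also have "\<dots> \<le> card X" by (rule card_mono) (use X B in auto)
  finally show ?thesis .
qed

text \<open>Directions \<open>b\<close> of norm at most \<open>\<zeta> R\<close> are few. For the others the multiplier \<open>k\<close> between two
  points of a block is at most \<open>L\<close>.\<close>

lemma blocks_count:
  fixes X :: "(nat \<Rightarrow> int) set" and d s N :: nat and B \<zeta> :: real
    and \<B> :: "(nat \<Rightarrow> int) \<Rightarrow> (nat \<Rightarrow> int) set set"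
  assumes d: "d \<ge> 1" and X: "X \<subseteq> grid d N"
    and B: "B \<ge> 1" "B ^ (d + 1) = N" "B * \<zeta> ^ 16 \<ge> 1" and \<zeta>: "0 < \<zeta>" "\<zeta> \<le> 1"
    and cX: "card X \<le> (\<zeta> ^ 16 * N) ^ d" and s: "s \<ge> 2"
    and blk: "\<And>b S. S \<in> \<B> b \<Longrightarrow> S \<subseteq> X \<and> card S = s" "\<And>b. disjoint (\<B> b)"
    and line: "\<And>b S x y. S \<in> \<B> b \<Longrightarrow> x \<in> S \<Longrightarrow> y \<in> S \<Longrightarrow> \<exists>k. y = line_pt x k b"
  defines "\<rho> \<equiv> B ^ d / s"
  shows "real (card (\<Union>b\<in>zvec d - {\<lambda>_. 0}. \<B> b)) \<le> (28 * d * 6 ^ d + 5 ^ d) * card X * (\<zeta> * (\<rho> ^ (d + 2) + \<rho>))"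
proof -
  have fX: "finite X" using X by (rule finite_subset) (simp add: grid_eq_cube finite_cube)
  define m where "m = real (card X)"
  define K where "K = B ^ d"
  have K: "K \<ge> B" unfolding K_def using B d by (intro self_le_power) auto
  have K1: "K \<ge> 1" using K B by simp
  have NK: "N = K * B" by (simp add: K_def flip: B(2))
  have N0: "real N > 0" using NK K1 B by simp
  have \<rho>: "\<rho> > 0" "\<rho> * s = K" using K1 s by (auto simp: \<rho>_def K_def)
  have Ns: "N / s = \<rho> * B" using NK s by (simp add: \<rho>_def K_def)
  \<comment> \<open>Only directions with all coordinates bounded by \<open>R\<close> carry a block.
    \<open>T\<close> separates short from long directions, and \<open>L\<close> is the resulting
    range of multipliers for the long ones.\<close>
  define R where "R = (2 * N) div s"
  define T where "T = nat \<lfloor>\<zeta> * R\<rfloor>"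
  define L where "L = nat \<lceil>s / \<zeta>\<rceil>"
  have Rle: "real R \<le> 2 * (\<rho> * B)"
    using of_nat_div_le_of_nat[of "2*N" s, where ?'a=real] by (simp add: R_def flip: Ns)
  have T: "real T \<le> \<zeta> * R" "\<zeta> * R < T + 1"
  proof -
    have "real T = of_int \<lfloor>\<zeta> * R\<rfloor>" using \<zeta> by (simp add: T_def)
    then show "real T \<le> \<zeta> * R" "\<zeta> * R < T + 1" by linarith+
  qed
  have sz: "s / \<zeta> \<ge> 2" using s \<zeta> by (simp add: field_simps)
  have L: "real L \<ge> s / \<zeta>" "real L \<le> 2 * (s / \<zeta>)"
  proof -
    have "real L = of_int \<lceil>s / \<zeta>\<rceil>" using sz by (simp add: L_def)
    then show "real L \<ge> s / \<zeta>" "real L \<le> 2 * (s / \<zeta>)" using sz by linarith+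
  qed
  define D where "D = cube d {-int R..int R} - {\<lambda>_. 0}"
  define Ds where "Ds = cube d {-int T..int T}"
  define Db where "Db = cube d {-int R..int R} - Ds"
  have fD: "finite D" "finite Ds" "finite Db" by (auto simp: D_def Ds_def Db_def finite_cube)
  have fB: "finite (\<B> b)" for b
  proof (rule finite_subset)
    show "\<B> b \<subseteq> Pow X" using blk(1) by blast
  qed (use fX in simp)
  have inD: "b \<in> D" if "b \<in> zvec d" "b \<noteq> (\<lambda>_. 0)" "\<B> b \<noteq> {}" for b
  proof -
    obtain S where S: "S \<in> \<B> b" using \<open>\<B> b \<noteq> {}\<close> by blast
    have "\<bar>b i\<bar> \<le> int R" if i: "i < d" for i
    proof -
      have "S \<subseteq> grid d N" "card S = s" using blk(1)[OF S] X by auto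
      then have "int s * \<bar>b i\<bar> \<le> 2 * int N" using s i line[OF S] by (intro block_direction_bound) auto
      then have "s * nat \<bar>b i\<bar> \<le> 2 * N" by (metis (mono_tags) abs_ge_zero int_nat_eq of_nat_le_iff of_nat_mult of_nat_numeral)
      then have "nat \<bar>b i\<bar> \<le> R" using s by (simp add: R_def less_eq_div_iff_mult_less_eq mult.commute)
      then show ?thesis by linarith
    qed
    then show ?thesis using that by (auto simp: D_def cube_def zvec_def abs_le_iff) (meson minus_le_iff)+
  qed
  have "(\<Union>b\<in>zvec d - {\<lambda>_. 0}. \<B> b) \<subseteq> (\<Union>b\<in>D. \<B> b)" using inD by blast
  then have "card (\<Union>b\<in>zvec d - {\<lambda>_. 0}. \<B> b) \<le> card (\<Union>b\<in>D. \<B> b)" using fD fB by (intro card_mono) auto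
  also have "\<dots> \<le> (\<Sum>b\<in>D. card (\<B> b))" by (rule card_UN_le[OF fD(1)])
  also have "\<dots> \<le> (\<Sum>b\<in>Ds \<union> Db. card (\<B> b))"
    by (rule sum_mono2) (use fD in \<open>auto simp: D_def Db_def\<close>)
  also have "\<dots> = (\<Sum>b\<in>Ds. card (\<B> b)) + (\<Sum>b\<in>Db. card (\<B> b))"
    by (rule sum.union_disjoint) (use fD in \<open>auto simp: Db_def\<close>)
  finally have split: "real (card (\<Union>b\<in>zvec d - {\<lambda>_. 0}. \<B> b))
      \<le> real (\<Sum>b\<in>Ds. card (\<B> b)) + real (\<Sum>b\<in>Db. card (\<B> b))"
    by (metis of_nat_add of_nat_le_iff)
  \<comment> \<open>Each direction has at most \<open>card X / s\<close> disjoint blocks, and the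
    number of short directions already gains \<open>\<zeta> ^ d \<le> \<zeta>\<close>. The
    \<open>+ 1\<close> in \<open>2 * T + 1\<close> is harmless because
    \<open>\<zeta> * B \<ge> 1\<close>.\<close>
  have small: "real (\<Sum>b\<in>Ds. card (\<B> b)) \<le> 5 ^ d * m * (\<zeta> * (\<rho> ^ (d + 2) + \<rho>))"
  proof -
    have "real (\<Sum>b\<in>Ds. card (\<B> b)) = (\<Sum>b\<in>Ds. real (card (\<B> b)))" by simp
    also have "\<dots> \<le> (\<Sum>b\<in>Ds. m / s)"
    proof (rule sum_mono)
      fix b
      have "real (card (\<B> b) * s) \<le> m"
        unfolding m_def of_nat_le_iff by (rule card_disjoint_blocks_le[OF fX blk(1) blk(2)])
      then show "real (card (\<B> b)) \<le> m / s" using s by (simp add: field_simps)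
    qed
    also have "\<dots> = (2 * real T + 1) ^ d * (m / s)" by (simp add: Ds_def card_cube)
    also have "\<dots> \<le> ((\<zeta> * B) * (4 * \<rho> + 1)) ^ d * (m / s)"
    proof (intro mult_right_mono power_mono)
      have "\<zeta> ^ 16 \<le> \<zeta> ^ 1" using \<zeta> by (intro power_decreasing) auto
      then have "B * \<zeta> ^ 16 \<le> B * \<zeta>" using B by (intro mult_left_mono) auto
      then have 1: "1 \<le> \<zeta> * B" using B(3) by (simp add: mult.commute)
      have "2 * real T \<le> 2 * (\<zeta> * (2 * (\<rho> * B)))"
        using T(1) mult_left_mono[OF Rle, of \<zeta>] \<zeta> by linarith
      then show "2 * real T + 1 \<le> (\<zeta> * B) * (4 * \<rho> + 1)" using 1 by (simp add: algebra_simps)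
    qed (auto simp: m_def)
    also have "\<dots> = \<zeta> ^ d * (4 * \<rho> + 1) ^ d * m * \<rho>"
      using s by (simp add: power_mult_distrib \<rho>_def)
    also have "\<dots> \<le> \<zeta> * (5 ^ d * (1 + \<rho> ^ (d + 1))) * m * \<rho>"
    proof (intro mult_right_mono mult_mono)
      show "\<zeta> ^ d \<le> \<zeta>" using \<zeta> power_decreasing[of 1 d \<zeta>] d by simp
      show "(4 * \<rho> + 1) ^ d \<le> 5 ^ d * (1 + \<rho> ^ (d + 1))"
      proof (cases "\<rho> \<le> 1")
        case True
        have "(4 * \<rho> + 1) ^ d \<le> 5 ^ d" using True \<rho> by (intro power_mono) auto
        also have "(5::real) ^ d \<le> 5 ^ d * (1 + \<rho> ^ (d + 1))" using \<rho> by simp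
        finally show ?thesis .
      next
        case False
        have "(4 * \<rho> + 1) ^ d \<le> (5 * \<rho>) ^ d" using False by (intro power_mono) auto
        also have "\<dots> = 5 ^ d * \<rho> ^ d" by (simp add: power_mult_distrib)
        also have "\<dots> \<le> 5 ^ d * (1 + \<rho> ^ (d + 1))"
        proof (intro mult_left_mono)
          have "\<rho> ^ d \<le> \<rho> ^ (d + 1)" using False by (intro power_increasing) auto
          then show "\<rho> ^ d \<le> 1 + \<rho> ^ (d + 1)" by linarith
        qed simp
        finally show ?thesis .
      qed
    qed (use \<zeta> \<rho> in \<open>auto simp: m_def\<close>)
    also have "\<dots> = 5 ^ d * m * (\<zeta> * (\<rho> ^ (d + 2) + \<rho>))" by (simp add: algebra_simps)
    finally show ?thesis .
  qed
  have big: "real (\<Sum>b\<in>Db. card (\<B> b)) \<le> 28 * d * 6 ^ d * m * (\<zeta> * (\<rho> ^ (d + 2) + \<rho>))"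
  proof (cases "R = 0")
    case True
    \<comment> \<open>The estimate \<open>R \<ge> N / s\<close> used in the other case relies on
      \<open>R \<ge> 1\<close>; for \<open>R = 0\<close> the only direction is 0, which belongs to
      \<open>Ds\<close>.\<close>
    then have "Db = {}" by (auto simp: Db_def Ds_def T_def)
    then show ?thesis using \<zeta> \<rho> by (auto simp: m_def intro!: mult_nonneg_nonneg add_nonneg_nonneg)
  next
    case False
    have R1: "real R \<ge> 1" using False by linarith
    have Rge: "real R \<ge> N / s"
    proof -
      have "2 * N < (R + 1) * s" using s by (simp add: R_def dividend_less_div_times mult.commute[of s])
      then have "2 * real N < (real R + 1) * s" by (metis of_nat_1 of_nat_add of_nat_less_iff of_nat_mult of_nat_numeral)
      also have "\<dots> \<le> (2 * real R) * s" using R1 by (intro mult_right_mono) auto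
      finally show ?thesis using s by (simp add: field_simps)
    qed
    define W where "W b = {(k, y). k \<in> {-int L..int L} \<and> y \<in> X \<and> line_pt y k b \<in> X}" for b
    have fW: "finite (W b)" for b
      by (rule finite_subset[of _ "{-int L..int L} \<times> X"]) (use fX in \<open>auto simp: W_def\<close>)
    have bW: "card (\<B> b) * (s * s) \<le> card (W b)" if b: "b \<in> Db" for b
      unfolding W_def
    proof (rule card_big_blocks_le[OF fX blk(1) blk(2)])
      fix S x y assume S: "S \<in> \<B> b" "x \<in> S" "y \<in> S"
      obtain k where k: "y = line_pt x k b" using line[OF S] by auto
      obtain i where i: "i < d" "\<bar>b i\<bar> > int T"
        using b by (auto simp: Db_def Ds_def cube_def abs_le_iff not_le)
      have "x \<in> grid d N" "y \<in> grid d N" using S blk(1) X by blast+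
      then have "1 \<le> x i \<and> x i \<le> int N" "1 \<le> y i \<and> y i \<le> int N" using i by (simp_all add: grid_def)
      moreover have "y i = x i + k * b i" using k by (simp add: line_pt_def)
      ultimately have "\<bar>k * b i\<bar> \<le> int N" by linarith
      then have "real_of_int \<bar>k\<bar> * real_of_int \<bar>b i\<bar> \<le> N"
        by (metis abs_mult of_int_le_iff of_int_mult of_int_of_nat_eq)
      moreover have "real_of_int \<bar>b i\<bar> \<ge> \<zeta> * R" using i T by linarith
      ultimately have kR: "real_of_int \<bar>k\<bar> * (\<zeta> * R) \<le> N"
        by (smt (verit) mult_left_mono of_int_0_le_iff abs_ge_zero)
      have "N \<le> (s / \<zeta>) * (\<zeta> * R)" using Rge \<zeta> s by (simp add: field_simps)
      also have "\<dots> \<le> L * (\<zeta> * R)" using L \<zeta> by (intro mult_right_mono) auto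
      finally have "real_of_int \<bar>k\<bar> * (\<zeta> * R) \<le> L * (\<zeta> * R)" using kR by linarith
      then have "real_of_int \<bar>k\<bar> \<le> L" using \<zeta> R1 by (simp add: mult_le_cancel_right)
      then show "\<exists>k\<in>{-int L..int L}. y = line_pt x k b" using k by (intro bexI[of _ k]) auto
    qed
    define C where "C = cube d {-int R..int R}"
    have fC: "finite C" by (simp add: C_def finite_cube)
    define h where "h = nat \<lfloor>\<zeta> ^ 16 * N\<rfloor>"
    have h: "real h \<le> \<zeta> ^ 16 * N" "\<zeta> ^ 16 * N < h + 1"
    proof -
      have "real h = of_int \<lfloor>\<zeta> ^ 16 * N\<rfloor>" using \<zeta> by (simp add: h_def)
      then show "real h \<le> \<zeta> ^ 16 * N" "\<zeta> ^ 16 * N < h + 1" by linarith+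
    qed
    have "m < real (h + 1) ^ d"
    proof -
      have "(\<zeta> ^ 16 * N) ^ d < real (h + 1) ^ d"
        using h(2) \<zeta> d by (intro power_strict_mono) auto
      then show ?thesis using cX by (simp add: m_def)
    qed
    then have "card X < (h + 1) ^ d" unfolding m_def by (metis of_nat_less_iff of_nat_power)
    then obtain E where E: "X = (\<Union>i<d. E i)" "\<And>i x. i < d \<Longrightarrow> x \<in> E i \<Longrightarrow> card (axis_row i (E i) x) \<le> h"
      using sparse_row_partition[OF fX] by metis
    define WE where "WE i = {(b, k, y). b \<in> C \<and> k \<in> {-int L..int L} \<and> y \<in> X \<and> line_pt y k b \<in> E i}" for i
    have fWE: "finite (WE i)" for i
      by (rule finite_subset[of _ "C \<times> {-int L..int L} \<times> X"]) (use fC fX in \<open>auto simp: WE_def\<close>)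
    define \<sigma> where "\<sigma> = \<rho> + 1 / \<rho>"
    have WEb: "real (card (WE i)) \<le> 7 * (2 * real R + 1) ^ d * real L * m * \<zeta>\<^sup>2 * \<sigma>" if i: "i < d" for i
      unfolding WE_def C_def m_def \<sigma>_def \<rho>_def
      by (rule line_pairs_sparse_rows_bound[OF fX _ i E(2)[OF i] B \<zeta> h(1) _ L(1) Rge]) (use E i s in auto)
    have "(\<Sum>b\<in>Db. card (\<B> b)) * (s * s) = (\<Sum>b\<in>Db. card (\<B> b) * (s * s))" by (rule sum_distrib_right)
    also have "\<dots> \<le> (\<Sum>b\<in>Db. card (W b))" by (intro sum_mono bW)
    also have "\<dots> = card (Sigma Db W)" using fD fW by (simp add: card_SigmaI)
    also have "\<dots> \<le> card (\<Union>i<d. WE i)"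
    proof (rule card_mono)
      show "finite (\<Union>i<d. WE i)" using fWE by auto
      show "Sigma Db W \<subseteq> (\<Union>i<d. WE i)"
      proof
        fix p assume "p \<in> Sigma Db W"
        then obtain b k y where p: "p = (b, k, y)" "b \<in> Db" "k \<in> {-int L..int L}" "y \<in> X" "line_pt y k b \<in> X"
          by (auto simp: W_def)
        obtain i where "i < d" "line_pt y k b \<in> E i" using p(5) E(1) by blast
        then have "p \<in> WE i" using p by (simp add: WE_def Db_def C_def)
        then show "p \<in> (\<Union>i<d. WE i)" using \<open>i < d\<close> by blast
      qed
    qed
    also have "\<dots> \<le> (\<Sum>i<d. card (WE i))" by (rule card_UN_le) simp
    finally have "real (\<Sum>b\<in>Db. card (\<B> b)) * (s * s) \<le> (\<Sum>i<d. real (card (WE i)))"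
      by (metis of_nat_le_iff of_nat_mult of_nat_sum)
    also have "\<dots> \<le> (\<Sum>i<d. 7 * (2 * real R + 1) ^ d * real L * m * \<zeta>\<^sup>2 * \<sigma>)" by (intro sum_mono WEb) auto
    also have "\<dots> = d * (7 * (2 * real R + 1) ^ d * real L * m * \<zeta>\<^sup>2 * \<sigma>)" by (simp add: add.commute)
    \<comment> \<open>One of the two factors \<zeta> is lost here, since \<open>L\<close> is of
      order \<open>s / \<zeta>\<close>.\<close>
    also have "\<dots> \<le> d * (7 * (6 ^ d * \<rho> ^ d * K) * (2 * (s / \<zeta>)) * m * \<zeta>\<^sup>2 * \<sigma>)"
    proof (intro mult_left_mono mult_right_mono mult_mono)
      have "(2 * real R + 1) ^ d \<le> (6 * (\<rho> * B)) ^ d" using R1 Rle by (intro power_mono) auto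
      also have "\<dots> = 6 ^ d * \<rho> ^ d * K" by (simp add: power_mult_distrib K_def)
      finally show "(2 * real R + 1) ^ d \<le> 6 ^ d * \<rho> ^ d * K" .
    qed (use L \<rho> \<zeta> K1 in \<open>auto simp: m_def \<sigma>_def\<close>)
    also have "\<dots> = (14 * d * 6 ^ d * m * (\<zeta> * (\<rho> ^ d * \<rho> * \<sigma>))) * (s * s)"
      using \<zeta> by (simp add: power2_eq_square field_simps flip: \<rho>(2))
    finally have "real (\<Sum>b\<in>Db. card (\<B> b)) \<le> 14 * d * 6 ^ d * m * (\<zeta> * (\<rho> ^ d * \<rho> * \<sigma>))"
      using s by (simp only: mult_le_cancel_right_pos of_nat_0_less_iff mult_pos_pos)
    also have "\<dots> \<le> 14 * d * 6 ^ d * m * (\<zeta> * (2 * (\<rho> ^ (d + 2) + \<rho>)))"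
    proof (intro mult_left_mono)
      have e: "\<rho> ^ d * \<rho> * \<sigma> = \<rho> ^ (d + 2) + \<rho> ^ d"
        using \<rho> by (simp add: \<sigma>_def distrib_left power_add power2_eq_square)
      have "\<rho> ^ d \<le> \<rho> ^ (d + 2) + \<rho>"
      proof (cases "\<rho> \<le> 1")
        case True
        then have "\<rho> ^ d \<le> \<rho> ^ 1" using \<rho> d by (intro power_decreasing) auto
        moreover have "0 \<le> \<rho> ^ (d + 2)" using \<rho> by simp
        ultimately show ?thesis by simp
      next
        case False
        then have "\<rho> ^ d \<le> \<rho> ^ (d + 2)" by (intro power_increasing) auto
        then show ?thesis using \<rho>(1) by linarith
      qed
      then show "\<rho> ^ d * \<rho> * \<sigma> \<le> 2 * (\<rho> ^ (d + 2) + \<rho>)" using e \<rho> by simp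
    qed (use \<zeta> in \<open>auto simp: m_def\<close>)
    also have "\<dots> = 28 * d * 6 ^ d * m * (\<zeta> * (\<rho> ^ (d + 2) + \<rho>))" by simp
    finally show ?thesis .
  qed
  show ?thesis using split small big by (simp add: m_def distrib_right)
qed

section \<open>Upper bound\<close>

definition rank_in :: "int set \<Rightarrow> int \<Rightarrow> nat" where
  "rank_in T t = card {t' \<in> T. t' < t}"

lemma rank_in_less_iff:
  assumes "finite T" "t \<in> T"
  shows "rank_in T t < rank_in T p \<longleftrightarrow> t < p"
proof
  assume "t < p"
  then have "{t' \<in> T. t' < t} \<subset> {t' \<in> T. t' < p}" using assms by auto
  then show "rank_in T t < rank_in T p" unfolding rank_in_def using assms by (intro psubset_card_mono) auto
next
  assume l: "rank_in T t < rank_in T p"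
  show "t < p"
  proof (rule ccontr)
    assume "\<not> t < p"
    then have "rank_in T p \<le> rank_in T t" unfolding rank_in_def using assms by (intro card_mono) auto
    then show False using l by simp
  qed
qed

lemma bij_betw_rank_in:
  assumes T: "finite T"
  shows "bij_betw (rank_in T) T {..<card T}"
proof -
  have inj: "inj_on (rank_in T) T"
    by (rule inj_onI) (metis T rank_in_less_iff less_irrefl linorder_neqE)
  have "rank_in T ` T \<subseteq> {..<card T}"
  proof (rule image_subsetI)
    fix t assume "t \<in> T"
    then have "{t' \<in> T. t' < t} \<subset> T" by auto
    then show "rank_in T t \<in> {..<card T}" unfolding rank_in_def using T by (simp add: psubset_card_mono)
  qed
  moreover have "card (rank_in T ` T) = card {..<card T}" using inj by (simp add: card_image)
  ultimately have "rank_in T ` T = {..<card T}" by (intro card_subset_eq) auto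
  then show ?thesis using inj by (simp add: bij_betw_def)
qed

text \<open>Truncate the binary expansion of \<open>n\<close> at bit \<open>j\<close>: refining from
  bit \<open>j + 1\<close> to bit \<open>j\<close> adds one block of \<open>2 ^ j\<close>
  consecutive ranks or nothing. All these blocks end at or before \<open>n \<le> card T\<close>, so
  only complete ones occur.\<close>

lemma prefix_sum_bound:
  fixes f :: "int \<Rightarrow> int" and \<Delta> :: "nat \<Rightarrow> real"
  assumes T: "finite T" "card T < 2 ^ J" and n: "n \<le> card T" and \<Delta>: "\<And>j. \<Delta> j \<ge> 0"
    and blk: "\<And>j i. j < J \<Longrightarrow> card {t \<in> T. rank_in T t div 2 ^ j = i} = 2 ^ j \<Longrightarrow>
                \<bar>real_of_int (\<Sum>t | t \<in> T \<and> rank_in T t div 2 ^ j = i. f t)\<bar> \<le> \<Delta> j"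
  shows "\<bar>real_of_int (\<Sum>t | t \<in> T \<and> rank_in T t < n. f t)\<bar> \<le> (\<Sum>j<J. \<Delta> j)"
proof -
  define P where "P j = real_of_int (\<Sum>t | t \<in> T \<and> rank_in T t < n div 2 ^ j * 2 ^ j. f t)" for j
  have step: "\<bar>P j - P (Suc j)\<bar> \<le> \<Delta> j" if j: "j < J" for j
  proof -
    define q where "q = n div 2 ^ j"
    have nS: "n div 2 ^ Suc j * 2 ^ Suc j = (q div 2) * 2 * 2 ^ j"
      by (simp add: q_def div_mult2_eq mult.commute[of 2])
    show ?thesis
    proof (cases "even q")
      case True
      then have "P j = P (Suc j)" unfolding P_def nS by (simp add: q_def)
      then show ?thesis using \<Delta> by simp
    next
      case False
      then obtain r where r: "q = Suc (2 * r)" by (metis oddE Suc_eq_plus1)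
      have nS': "n div 2 ^ Suc j * 2 ^ Suc j = 2 * r * 2 ^ j" unfolding nS by (simp add: r)
      have nj: "n div 2 ^ j * 2 ^ j = 2 * r * 2 ^ j + 2 ^ j" by (simp add: q_def[symmetric] r)
      let ?I = "{t \<in> T. rank_in T t div 2 ^ j = 2 * r}"
      have I: "rank_in T t div 2 ^ j = 2 * r \<longleftrightarrow> 2 * r * 2 ^ j \<le> rank_in T t \<and> rank_in T t < 2 * r * 2 ^ j + 2 ^ j" for t
      proof -
        have "rank_in T t div 2 ^ j = 2 * r \<longleftrightarrow> 2 * r \<le> rank_in T t div 2 ^ j \<and> rank_in T t div 2 ^ j < 2 * r + 1" by linarith
        then show ?thesis by (simp add: less_eq_div_iff_mult_less_eq div_less_iff_less_mult algebra_simps)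
      qed
      have le: "2 * r * 2 ^ j + 2 ^ j \<le> card T"
        using n unfolding nj[symmetric] by (rule order_trans[OF div_times_less_eq_dividend])
      have "bij_betw (rank_in T) ?I {2 * r * 2 ^ j..<2 * r * 2 ^ j + 2 ^ j}"
        unfolding bij_betw_def
      proof
        show "inj_on (rank_in T) ?I"
          using bij_betw_rank_in[OF T(1)] by (auto simp: bij_betw_def intro: inj_on_subset)
        have "rank_in T ` T = {..<card T}" using bij_betw_rank_in[OF T(1)] by (simp add: bij_betw_def)
        show "rank_in T ` ?I = {2 * r * 2 ^ j..<2 * r * 2 ^ j + 2 ^ j}"
        proof (intro equalityI subsetI)
          fix k assume k: "k \<in> {2 * r * 2 ^ j..<2 * r * 2 ^ j + 2 ^ j}"
          then have "k \<in> rank_in T ` T" using le unfolding \<open>rank_in T ` T = _\<close> by auto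
          then obtain t where "t \<in> T" "k = rank_in T t" by auto
          then show "k \<in> rank_in T ` ?I" using k I by auto
        qed (use I in auto)
      qed
      then have "card ?I = 2 ^ j" by (simp add: bij_betw_same_card)
      from blk[OF j this] have b: "\<bar>real_of_int (\<Sum>t\<in>?I. f t)\<bar> \<le> \<Delta> j" .
      have "{t \<in> T. rank_in T t < n div 2 ^ j * 2 ^ j} =
          {t \<in> T. rank_in T t < n div 2 ^ Suc j * 2 ^ Suc j} \<union> ?I"
        unfolding nS' nj
      proof (rule set_eqI)
        fix t
        have "x < a + w \<longleftrightarrow> x < a \<or> a \<le> x \<and> x < a + w" for x a w :: nat by linarith
        from this[of "rank_in T t" "2 * r * 2 ^ j" "2 ^ j"]
        show "t \<in> {t \<in> T. rank_in T t < 2 * r * 2 ^ j + 2 ^ j} \<longleftrightarrow> t \<in> {t \<in> T. rank_in T t < 2 * r * 2 ^ j} \<union> ?I"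
          using I[of t] by blast
      qed
      then have "(\<Sum>t | t \<in> T \<and> rank_in T t < n div 2 ^ j * 2 ^ j. f t) =
          (\<Sum>t | t \<in> T \<and> rank_in T t < n div 2 ^ Suc j * 2 ^ Suc j. f t) + (\<Sum>t\<in>?I. f t)"
        by (simp only:) (rule sum.union_disjoint, use T I nS' in auto)
      then have "P j - P (Suc j) = real_of_int (\<Sum>t\<in>?I. f t)" unfolding P_def by simp
      then show ?thesis using b by simp
    qed
  qed
  have tel: "\<bar>P 0 - P k\<bar> \<le> (\<Sum>j<k. \<Delta> j)" if "k \<le> J" for k
    using that
  proof (induction k)
    case (Suc k)
    then have "\<bar>P 0 - P k\<bar> \<le> (\<Sum>j<k. \<Delta> j)" "\<bar>P k - P (Suc k)\<bar> \<le> \<Delta> k" using step by auto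
    then show ?case by simp
  qed simp
  have "n div 2 ^ J = 0" using n T by simp
  then have "P J = 0" by (simp add: P_def)
  moreover have "P 0 = real_of_int (\<Sum>t | t \<in> T \<and> rank_in T t < n. f t)" by (simp add: P_def)
  ultimately show ?thesis using tel[of J] by simp
qed

text \<open>A line is a coset of the multiples of \<open>b\<close>. Counting the points of
  \<open>X\<close> before \<open>x\<close> avoids choosing a base point, so one block structure
  serves all progressions with this difference.\<close>

definition line_rank :: "(nat \<Rightarrow> int) set \<Rightarrow> (nat \<Rightarrow> int) \<Rightarrow> (nat \<Rightarrow> int) \<Rightarrow> nat" where
  "line_rank X b x = card {k. k < 0 \<and> line_pt x k b \<in> X}"

definition line_block :: "(nat \<Rightarrow> int) set \<Rightarrow> (nat \<Rightarrow> int) \<Rightarrow> nat \<Rightarrow> (nat \<Rightarrow> int) \<Rightarrow> (nat \<Rightarrow> int) set" where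
  "line_block X b j x = {y \<in> X. (\<exists>k. y = line_pt x k b) \<and> line_rank X b y div 2 ^ j = line_rank X b x div 2 ^ j}"

text \<open>The incomplete last block of a line is left out: initial segments decompose into
  complete ones, and the exact size \<open>2 ^ j\<close> identifies the level.\<close>

definition full_blocks :: "(nat \<Rightarrow> int) set \<Rightarrow> nat \<Rightarrow> (nat \<Rightarrow> int) \<Rightarrow> (nat \<Rightarrow> int) set set" where
  "full_blocks X j b = {S. \<exists>x\<in>X. S = line_block X b j x \<and> card S = 2 ^ j}"

lemma line_block_eq:
  assumes "z \<in> line_block X b j x"
  shows "line_block X b j x = line_block X b j z"
proof -
  obtain k where k: "z = line_pt x k b" and r: "line_rank X b z div 2 ^ j = line_rank X b x div 2 ^ j"
    using assms by (auto simp: line_block_def)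
  have "(\<exists>l. y = line_pt x l b) \<longleftrightarrow> (\<exists>l. y = line_pt z l b)" for y
  proof
    assume "\<exists>l. y = line_pt x l b"
    then obtain l where "y = line_pt x l b" by auto
    then have "y = line_pt z (l - k) b" by (simp add: k)
    then show "\<exists>l. y = line_pt z l b" by blast
  next
    assume "\<exists>l. y = line_pt z l b"
    then show "\<exists>l. y = line_pt x l b" by (auto simp: k)
  qed
  then show ?thesis unfolding line_block_def r by simp
qed

lemma disjoint_full_blocks: "disjoint (full_blocks X j b)"
proof (rule disjointI)
  fix S S' assume "S \<in> full_blocks X j b" "S' \<in> full_blocks X j b" "S \<noteq> S'"
  then show "S \<inter> S' = {}"
    unfolding full_blocks_def using line_block_eq by (smt (verit) disjoint_iff mem_Collect_eq)
qed

lemma full_blocks_line: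
  assumes "S \<in> full_blocks X j b" "x \<in> S" "y \<in> S"
  shows "\<exists>k. y = line_pt x k b"
proof -
  obtain z where "S = line_block X b j z" using assms by (auto simp: full_blocks_def)
  then have "S = line_block X b j x" using assms line_block_eq by metis
  then show ?thesis using assms(3) by (auto simp: line_block_def)
qed

lemma ap_eq_image: "ap a b l = (\<lambda>k. line_pt a k b) ` {0..<int l}"
proof -
  have "{0..<int l} = int ` {..<l}" using image_int_atLeastLessThan[of 0 l] by (simp add: lessThan_atLeast0)
  then show ?thesis by (auto simp: ap_def line_pt_def)
qed

text \<open>A progression is the difference of two initial segments of its line, those before the
  indices \<open>l\<close> and 0. Using \<open>card X\<close> levels is crude but harmless, as the
  sum of the tolerances is later bounded independently of their number.\<close>

lemma ap_sum_bound:
  fixes c :: "(nat \<Rightarrow> int) \<Rightarrow> int" and \<Delta> :: "nat \<Rightarrow> real"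
  assumes X: "finite X" and c0: "\<And>x. x \<notin> X \<Longrightarrow> c x = 0" and b: "b \<noteq> (\<lambda>_. 0)" and \<Delta>: "\<And>j. \<Delta> j \<ge> 0"
    and blk: "\<And>j S. j < card X \<Longrightarrow> S \<in> full_blocks X j b \<Longrightarrow> \<bar>real_of_int (\<Sum>x\<in>S. c x)\<bar> \<le> \<Delta> j"
  shows "\<bar>real_of_int (\<Sum>x\<in>ap a b l. c x)\<bar> \<le> 2 * (\<Sum>j<card X. \<Delta> j)"
proof -
  define g where "g k = line_pt a k b" for k
  have injg: "inj_on g A" for A using b by (auto simp: inj_on_def g_def line_pt_inj)
  define T where "T = {k. g k \<in> X}"
  have gT: "g ` T \<subseteq> X" by (auto simp: T_def)
  have T: "finite T" using gT X injg by (metis finite_subset finite_imageD)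
  have "card T = card (g ` T)" using injg by (simp add: card_image)
  also have "\<dots> \<le> card X" using gT X by (rule card_mono[rotated])
  also have "\<dots> < 2 ^ card X" by (rule less_exp)
  finally have cT: "card T < 2 ^ card X" .
  define f where "f k = c (g k)" for k
  have rk: "line_rank X b (g t) = rank_in T t" for t
  proof -
    have "bij_betw (\<lambda>k. t + k) {k. k < 0 \<and> line_pt (g t) k b \<in> X} {t' \<in> T. t' < t}"
      by (rule bij_betw_byWitness[where f' = "\<lambda>k. k - t"]) (auto simp: T_def g_def)
    then show ?thesis unfolding line_rank_def rank_in_def by (rule bij_betw_same_card)
  qed
  have pre: "\<bar>real_of_int (\<Sum>t | t \<in> T \<and> t < p. f t)\<bar> \<le> (\<Sum>j<card X. \<Delta> j)" for p
  proof -
    \<comment> \<open>The segment may end at an index \<open>p\<close> outside \<open>T\<close>;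
      comparing ranks with \<open>p\<close> only asks that \<open>t\<close> belong to
      \<open>T\<close>.\<close>
    have "{t. t \<in> T \<and> t < p} = {t. t \<in> T \<and> rank_in T t < rank_in T p}"
      using rank_in_less_iff[OF T] by auto
    moreover have "\<bar>real_of_int (\<Sum>t | t \<in> T \<and> rank_in T t < rank_in T p. f t)\<bar> \<le> (\<Sum>j<card X. \<Delta> j)"
    proof (rule prefix_sum_bound[OF T cT])
      show "rank_in T p \<le> card T" unfolding rank_in_def using T by (intro card_mono) auto
      fix j i assume j: "j < card X" and cI: "card {t \<in> T. rank_in T t div 2 ^ j = i} = 2 ^ j"
      let ?I = "{t \<in> T. rank_in T t div 2 ^ j = i}"
      have "?I \<noteq> {}" using cI by (metis card.empty power_not_zero zero_neq_numeral)
      then obtain t0 where t0: "t0 \<in> T" "rank_in T t0 div 2 ^ j = i" by auto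
      have "line_block X b j (g t0) = g ` ?I"
      proof (intro equalityI subsetI)
        fix y assume "y \<in> line_block X b j (g t0)"
        then obtain k where y: "y \<in> X" "y = line_pt (g t0) k b" "line_rank X b y div 2 ^ j = line_rank X b (g t0) div 2 ^ j"
          by (auto simp: line_block_def)
        have "y = g (t0 + k)" using y by (simp add: g_def)
        then show "y \<in> g ` ?I" using y t0 rk by (auto simp: T_def)
      next
        fix y assume "y \<in> g ` ?I"
        then obtain t where t: "t \<in> ?I" "y = g t" by auto
        have "g t = line_pt (g t0) (t - t0) b" by (simp add: g_def)
        then have "\<exists>k. y = line_pt (g t0) k b" using t by blast
        moreover have "line_rank X b y div 2 ^ j = line_rank X b (g t0) div 2 ^ j" "y \<in> X"
          using t t0 rk by (auto simp: T_def)
        ultimately show "y \<in> line_block X b j (g t0)" unfolding line_block_def by blast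
      qed
      moreover have "card (g ` ?I) = 2 ^ j" using cI injg by (simp add: card_image)
      ultimately have "g ` ?I \<in> full_blocks X j b"
        using t0 by (auto simp: full_blocks_def T_def intro!: bexI[of _ "g t0"])
      from blk[OF j this] show "\<bar>real_of_int (\<Sum>t\<in>?I. f t)\<bar> \<le> \<Delta> j"
        by (simp add: sum.reindex[OF injg] f_def)
    qed (rule \<Delta>)
    ultimately show ?thesis by simp
  qed
  have "(\<Sum>x\<in>ap a b l. c x) = (\<Sum>k\<in>{0..<int l}. f k)"
    unfolding ap_eq_image by (subst sum.reindex) (use injg[unfolded g_def] in \<open>auto simp: f_def g_def\<close>)
  also have "\<dots> = (\<Sum>k | k \<in> T \<and> 0 \<le> k \<and> k < int l. f k)"
  proof (rule sum.mono_neutral_right)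
    show "\<forall>k\<in>{0..<int l} - {k. k \<in> T \<and> 0 \<le> k \<and> k < int l}. f k = 0"
    proof
      fix k assume "k \<in> {0..<int l} - {k. k \<in> T \<and> 0 \<le> k \<and> k < int l}"
      then have "g k \<notin> X" by (auto simp: T_def)
      then show "f k = 0" unfolding f_def by (rule c0)
    qed
  qed auto
  also have "\<dots> = (\<Sum>k | k \<in> T \<and> k < int l. f k) - (\<Sum>k | k \<in> T \<and> k < 0. f k)"
  proof -
    let ?P = "{k. k \<in> T \<and> 0 \<le> k \<and> k < int l}" and ?N = "{k. k \<in> T \<and> k < 0}"
    have "{k. k \<in> T \<and> k < int l} = ?P \<union> ?N" by auto
    moreover have "sum f (?P \<union> ?N) = sum f ?P + sum f ?N"
    proof (rule sum.union_disjoint)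
      show "finite ?P" "finite ?N" by (rule finite_subset[OF _ T]; blast)+
    qed auto
    ultimately show ?thesis by simp
  qed
  finally show ?thesis using pre[of "int l"] pre[of 0] by simp
qed

lemma partial_ap_coloring:
  assumes d: "d \<ge> 1"
  defines "e \<equiv> 1 / (32 * real d * (real d + 1) * (real d + 2))"
  shows "\<exists>A>0. \<forall>N\<ge>1. \<forall>X. X \<subseteq> grid d N \<and> X \<noteq> {} \<longrightarrow>
    (\<exists>c. (\<forall>x. c x \<in> {-1, 0, 1}) \<and> (\<forall>x. x \<notin> X \<longrightarrow> c x = 0) \<and>
      card X \<le> 10 * card {x \<in> X. c x \<noteq> 0} \<and>
      (\<forall>S\<in>APs d N. \<bar>real_of_int (\<Sum>x\<in>S. c x)\<bar>
         \<le> A * (real N powr (real d / (2 * real d + 2)) * (card X / real N ^ d) powr e)))"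
proof -
  define C where "C = 28 * real d * 6 ^ d + 5 ^ d"
  have C: "C \<ge> 1" by (simp add: C_def add_increasing)
  obtain A where A: "A > 0" and
    PC: "\<And>(X::(nat \<Rightarrow> int) set) \<F> J Q. finite X \<Longrightarrow> X \<noteq> {} \<Longrightarrow> Q > 0 \<Longrightarrow>
           (\<forall>j<J. \<forall>S\<in>\<F> j. S \<subseteq> X \<and> card S = 2 ^ j) \<Longrightarrow>
           (\<forall>j<J. real (card (\<F> j)) \<le> C * card X * ((Q / 2 ^ j) ^ (d + 2) + Q / 2 ^ j)) \<Longrightarrow>
           (\<exists>(c::(nat \<Rightarrow> int) \<Rightarrow> int) \<Delta>. (\<forall>x. c x \<in> {-1, 0, 1}) \<and> (\<forall>x. x \<notin> X \<longrightarrow> c x = 0) \<and>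
              card X \<le> 10 * card {x \<in> X. c x \<noteq> 0} \<and>
              (\<forall>j<J. \<forall>S\<in>\<F> j. \<bar>real_of_int (\<Sum>x\<in>S. c x)\<bar> \<le> \<Delta> j) \<and>
              (\<forall>j. 0 \<le> \<Delta> j) \<and> (\<Sum>j<J. \<Delta> j) \<le> A * sqrt Q)"
    using dyadic_partial_coloring[of C "d + 2", where 'a = "nat \<Rightarrow> int"] C by fastforce
  show ?thesis
  proof (intro exI[of _ "2 * A"] conjI allI impI; (elim conjE)?)
    show "2 * A > 0" using A by simp
    fix N :: nat and X :: "(nat \<Rightarrow> int) set"
    assume N: "1 \<le> N" and X: "X \<subseteq> grid d N" "X \<noteq> {}"
    have fX: "finite X" using X(1) by (rule finite_subset) (simp add: grid_eq_cube finite_cube)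
    define m where "m = real (card X)"
    have m1: "m \<ge> 1" using fX X(2) by (simp add: m_def Suc_le_eq card_gt_0_iff)
    have mN: "m \<le> real N ^ d"
    proof -
      have "card X \<le> card (grid d N)" using X by (intro card_mono) (auto simp: grid_eq_cube finite_cube)
      then show ?thesis by (simp add: m_def grid_eq_cube card_cube flip: of_nat_power)
    qed
    define \<theta> where "\<theta> = m / real N ^ d"
    have \<theta>: "0 < \<theta>" "\<theta> \<le> 1" "1 / real N ^ d \<le> \<theta>"
      using m1 mN N by (auto simp: \<theta>_def divide_simps)
    define B where "B = real N powr (1 / (real d + 1))"
    have B: "B \<ge> 1" using N by (simp add: B_def ge_one_powr_ge_zero)
    have Bp: "B ^ n = real N powr (real n / (real d + 1))" for n
      using N by (simp add: B_def powr_powr flip: powr_realpow)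
    have BN: "B ^ (d + 1) = N" using N by (simp add: Bp add.commute del: power_Suc)
    \<comment> \<open>With this choice
      \<open>\<zeta> ^ 16 = \<theta> powr (1 / (d * (d + 1)))\<close>. As \<theta> can be as small
      as \<open>1 / N ^ d\<close>, this is just what \<open>B * \<zeta> ^ 16 \<ge> 1\<close>
      permits. The root of order \<open>d + 2\<close> in \<xi> turns
      \<open>\<zeta> * \<rho> ^ (d + 2)\<close> into \<open>(\<xi> * \<rho>) ^ (d + 2)\<close>, a
      mere rescaling of the block size.\<close>
    define u where "u = 1 / (16 * real d * (real d + 1) * (real d + 2))"
    define \<xi> where "\<xi> = \<theta> powr u"
    define \<zeta> where "\<zeta> = \<xi> ^ (d + 2)"
    have u: "u > 0" using d by (simp add: u_def)
    have \<xi>: "0 < \<xi>" "\<xi> \<le> 1" using \<theta> u by (auto simp: \<xi>_def powr_le1)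
    have \<xi>p: "\<xi> ^ n = \<theta> powr (u * n)" for n using \<theta> by (simp add: \<xi>_def powr_powr flip: powr_realpow)
    have \<zeta>: "0 < \<zeta>" "\<zeta> \<le> 1" using \<xi> power_le_one[of \<xi> "d + 2"] unfolding \<zeta>_def by auto
    have \<zeta>\<xi>: "\<zeta> \<le> \<xi>" using \<xi> power_decreasing[of 1 "d + 2" \<xi>] by (simp add: \<zeta>_def)
    have \<zeta>p: "\<zeta> ^ n = \<theta> powr (n / (16 * real d * (real d + 1)))" for n
    proof -
      have "\<zeta> ^ n = \<xi> ^ ((d + 2) * n)" by (simp only: \<zeta>_def power_mult)
      also have "\<dots> = \<theta> powr (u * real ((d + 2) * n))" by (rule \<xi>p)
      also have "u * real ((d + 2) * n) = n / (16 * real d * (real d + 1))"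
      proof -
        have "1 / (p * c) * (c * x) = x / p" if "c \<noteq> 0" for p c x :: real using that by simp
        moreover have "real d + 2 \<noteq> 0" by linarith
        ultimately show ?thesis unfolding u_def of_nat_mult of_nat_add of_nat_numeral by blast
      qed
      finally show ?thesis .
    qed
    have B\<zeta>: "B * \<zeta> ^ 16 \<ge> 1"
    proof -
      have "(1 / real N ^ d) powr (1 / (real d * (real d + 1))) \<le> \<theta> powr (1 / (real d * (real d + 1)))"
        using \<theta> N by (intro powr_mono2) auto
      also have "\<dots> = \<zeta> ^ 16" by (simp add: \<zeta>p)
      also have "(1 / real N ^ d) powr (1 / (real d * (real d + 1))) = 1 / B"
      proof -
        have "1 / real N ^ d = real N powr (- real d)"
          using N by (simp add: powr_minus powr_realpow inverse_eq_divide)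
        then have "(1 / real N ^ d) powr (1 / (real d * (real d + 1))) = real N powr (- real d * (1 / (real d * (real d + 1))))"
          by (simp only: powr_powr)
        also have "- real d * (1 / (real d * (real d + 1))) = - (1 / (real d + 1))" using d by simp
        finally show ?thesis unfolding B_def by (simp only: powr_minus inverse_eq_divide)
      qed
      finally show ?thesis using B by (simp add: field_simps)
    qed
    have cX: "card X \<le> (\<zeta> ^ 16 * N) ^ d"
    proof -
      have "\<theta> = \<theta> powr 1" using \<theta> by simp
      also have "\<dots> \<le> \<theta> powr (real (16 * d) / (16 * real d * (real d + 1)))"
        using \<theta> d by (intro powr_mono') auto
      also have "\<dots> = \<zeta> ^ (16 * d)" by (rule \<zeta>p[symmetric])
      finally have "\<theta> \<le> (\<zeta> ^ 16) ^ d" by (simp only: power_mult)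
      then have "\<theta> * real N ^ d \<le> (\<zeta> ^ 16) ^ d * real N ^ d" by (intro mult_right_mono) auto
      then show ?thesis using N by (simp add: \<theta>_def m_def power_mult_distrib)
    qed
    define K where "K = B ^ d"
    have K: "K \<ge> B" unfolding K_def using B d by (intro self_le_power) auto
    \<comment> \<open>The critical block size, reduced by \<xi> through the sparsity of
      \<open>X\<close>. Its square root gives the main term times
      \<open>\<theta> powr (u / 2)\<close>, which is the decay exponent \<open>e\<close>.\<close>
    define Q where "Q = \<xi> * K"
    have Q: "Q \<ge> 1"
    proof -
      have "\<zeta> ^ 16 \<le> \<zeta> ^ 1" using \<zeta> by (intro power_decreasing) auto
      then have "\<zeta> ^ 16 \<le> \<xi>" using \<zeta>\<xi> by simp
      then have "B * \<zeta> ^ 16 \<le> K * \<xi>" using K B \<zeta> by (intro mult_mono) auto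
      then show ?thesis using B\<zeta> by (simp add: Q_def mult.commute)
    qed
    define \<F> where "\<F> j = (\<Union>b\<in>zvec d - {\<lambda>_. 0}. full_blocks X j b)" for j
    have F: "S \<subseteq> X \<and> card S = 2 ^ j" if "S \<in> full_blocks X j b" for S j b
      using that by (auto simp: full_blocks_def line_block_def)
    have cF: "real (card (\<F> j)) \<le> C * card X * ((Q / 2 ^ j) ^ (d + 2) + Q / 2 ^ j)" for j
    proof (cases "j = 0")
      case True
      \<comment> \<open>The block count applies from size 2 on. Blocks of level 0 are singletons,
        common to all directions, and \<open>Q \<ge> 1\<close> makes the required bound at least
        \<open>card X\<close>.\<close>
      have "\<F> 0 \<subseteq> (\<lambda>x. {x}) ` X"
      proof
        fix S assume "S \<in> \<F> 0"
        then have "S \<subseteq> X" "card S = 1" using F[of S 0] by (auto simp: \<F>_def)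
        then show "S \<in> (\<lambda>x. {x}) ` X" by (auto simp: card_1_singleton_iff)
      qed
      then have "card (\<F> 0) \<le> card X" using fX by (meson card_image_le card_mono finite_imageI order_trans)
      then have "real (card (\<F> j)) \<le> 1 * m * (0 + 1)" using True by (simp add: m_def)
      also have "\<dots> \<le> C * m * (Q ^ (d + 2) + Q)"
        using C Q m1 by (intro mult_mono add_mono) auto
      finally show ?thesis using True by (simp add: m_def)
    next
      case False
      define \<rho> where "\<rho> = B ^ d / real (2 ^ j)"
      have \<rho>: "\<rho> > 0" using B by (simp add: \<rho>_def)
      have "(2::nat) ^ 1 \<le> 2 ^ j" using False by (intro power_increasing) auto
      then have s2: "(2::nat) ^ j \<ge> 2" by simp
      have "real (card (\<F> j)) \<le> (28 * d * 6 ^ d + 5 ^ d) * card X * (\<zeta> * (\<rho> ^ (d + 2) + \<rho>))"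
        unfolding \<F>_def \<rho>_def
      proof (rule blocks_count[OF d X(1) B BN B\<zeta> \<zeta> cX s2])
        show "S \<subseteq> X \<and> card S = 2 ^ j" if "S \<in> full_blocks X j b" for b S using that by (rule F)
        show "disjoint (full_blocks X j b)" for b by (rule disjoint_full_blocks)
        show "\<exists>k. y = line_pt x k b" if "S \<in> full_blocks X j b" "x \<in> S" "y \<in> S" for b S x y
          using that by (rule full_blocks_line)
      qed
      also have "\<dots> = C * m * (\<zeta> * \<rho> ^ (d + 2) + \<zeta> * \<rho>)" by (simp add: C_def m_def distrib_left)
      also have "\<dots> \<le> C * m * ((\<xi> * \<rho>) ^ (d + 2) + \<xi> * \<rho>)"
        using C m1 \<rho> \<zeta>\<xi> by (intro mult_left_mono add_mono mult_right_mono) (auto simp: \<zeta>_def power_mult_distrib)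
      also have "\<xi> * \<rho> = Q / 2 ^ j" by (simp add: Q_def K_def \<rho>_def)
      finally show ?thesis by (simp add: m_def)
    qed
    obtain c :: "(nat \<Rightarrow> int) \<Rightarrow> int" and \<Delta> where c: "\<forall>x. c x \<in> {-1, 0, 1}" "\<forall>x. x \<notin> X \<longrightarrow> c x = 0"
      "card X \<le> 10 * card {x \<in> X. c x \<noteq> 0}"
      "\<forall>j<card X. \<forall>S\<in>\<F> j. \<bar>real_of_int (\<Sum>x\<in>S. c x)\<bar> \<le> \<Delta> j"
      "\<forall>j. 0 \<le> \<Delta> j" "(\<Sum>j<card X. \<Delta> j) \<le> A * sqrt Q"
    proof -
      have F1: "\<forall>j<card X. \<forall>S\<in>\<F> j. S \<subseteq> X \<and> card S = 2 ^ j" using F unfolding \<F>_def by blast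
      have Q0: "Q > 0" using Q by linarith
      have F2: "\<forall>j<card X. real (card (\<F> j)) \<le> C * card X * ((Q / 2 ^ j) ^ (d + 2) + Q / 2 ^ j)"
        using cF by simp
      show ?thesis using PC[OF fX X(2) Q0 F1 F2] that by (elim exE conjE) simp
    qed
    have sQ: "sqrt Q = real N powr (real d / (2 * real d + 2)) * (card X / real N ^ d) powr e"
    proof -
      have "sqrt Q = \<xi> powr (1/2) * K powr (1/2)" using \<xi> K B by (simp add: Q_def powr_half_sqrt real_sqrt_mult)
      also have "\<xi> powr (1/2) = \<theta> powr e"
      proof -
        have "1 / (16 * a * b * c) * (1/2) = 1 / (32 * a * b * c)" for a b c :: real by simp
        then have "u * (1/2) = e" unfolding u_def e_def by blast
        then show ?thesis by (simp only: \<xi>_def powr_powr)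
      qed
      also have "K powr (1/2) = real N powr (real d / (2 * real d + 2))"
        by (simp add: K_def Bp powr_powr algebra_simps)
      finally show ?thesis by (simp add: \<theta>_def m_def)
    qed
    show "\<exists>c. (\<forall>x. c x \<in> {-1, 0, 1}) \<and> (\<forall>x. x \<notin> X \<longrightarrow> c x = 0) \<and>
      card X \<le> 10 * card {x \<in> X. c x \<noteq> 0} \<and>
      (\<forall>S\<in>APs d N. \<bar>real_of_int (\<Sum>x\<in>S. c x)\<bar>
         \<le> 2 * A * (real N powr (real d / (2 * real d + 2)) * (card X / real N ^ d) powr e))"
    proof (intro exI[of _ c] conjI ballI)
      fix S assume "S \<in> APs d N"
      then obtain a b l where S: "S = ap a b l" "b \<in> zvec d" "b \<noteq> (\<lambda>_. 0)" by (auto simp: APs_def)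
      have "\<bar>real_of_int (\<Sum>x\<in>ap a b l. c x)\<bar> \<le> 2 * (\<Sum>j<card X. \<Delta> j)"
        by (rule ap_sum_bound[OF fX]) (use c S in \<open>auto simp: \<F>_def\<close>)
      also have "\<dots> \<le> 2 * (A * sqrt Q)" using c(6) by simp
      finally show "\<bar>real_of_int (\<Sum>x\<in>S. c x)\<bar>
         \<le> 2 * A * (real N powr (real d / (2 * real d + 2)) * (card X / real N ^ d) powr e)"
        by (simp add: S(1) sQ)
    qed (use c in auto)
  qed
qed

text \<open>A round leaves at most nine tenths of the points, so the next bound shrinks by
  \<open>q = (9/10) powr e < 1\<close>, and the induction closes with the \<open>A\<close> that
  solves \<open>A0 + A * q = A\<close>. Arbitrary subsets are allowed because the uncolored
  remainder has no structure.\<close>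

lemma full_ap_coloring:
  assumes d: "d \<ge> 1"
  defines "e \<equiv> 1 / (32 * real d * (real d + 1) * (real d + 2))"
  shows "\<exists>A>0. \<forall>N\<ge>1. \<forall>X. X \<subseteq> grid d N \<longrightarrow>
    (\<exists>c. (\<forall>x\<in>X. c x \<in> {1, -1}) \<and> (\<forall>x. x \<notin> X \<longrightarrow> c x = 0) \<and>
      (\<forall>S\<in>APs d N. \<bar>real_of_int (\<Sum>x\<in>S. c x)\<bar>
         \<le> A * (real N powr (real d / (2 * real d + 2)) * (card X / real N ^ d) powr e)))"
proof -
  obtain A0 where A0: "A0 > 0" and
    PC: "\<forall>N\<ge>1. \<forall>X. X \<subseteq> grid d N \<and> X \<noteq> {} \<longrightarrow>
    (\<exists>c. (\<forall>x. c x \<in> {-1, 0, 1}) \<and> (\<forall>x. x \<notin> X \<longrightarrow> c x = 0) \<and>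
      card X \<le> 10 * card {x \<in> X. c x \<noteq> 0} \<and>
      (\<forall>S\<in>APs d N. \<bar>real_of_int (\<Sum>x\<in>S. c x)\<bar>
         \<le> A0 * (real N powr (real d / (2 * real d + 2)) * (card X / real N ^ d) powr e)))"
    using partial_ap_coloring[OF d, folded e_def] by (elim exE conjE) (rule that; assumption)
  have e: "e > 0" using d by (simp add: e_def)
  define q where "q = (9/10 :: real) powr e"
  have q: "0 < q" "q < 1" using powr_less_mono2[OF e, of "9/10" 1] by (auto simp: q_def)
  define A where "A = A0 / (1 - q)"
  have A: "A > 0" "A0 + A * q = A" using A0 q by (auto simp: A_def field_simps)
  show ?thesis
  proof (intro exI[of _ A] conjI allI impI)
    fix N :: nat and X :: "(nat \<Rightarrow> int) set"
    assume N: "1 \<le> N" and "X \<subseteq> grid d N"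
    then show "\<exists>c. (\<forall>x\<in>X. c x \<in> {1, -1}) \<and> (\<forall>x. x \<notin> X \<longrightarrow> c x = 0) \<and>
      (\<forall>S\<in>APs d N. \<bar>real_of_int (\<Sum>x\<in>S. c x)\<bar>
         \<le> A * (real N powr (real d / (2 * real d + 2)) * (card X / real N ^ d) powr e))"
    proof (induction "card X" arbitrary: X rule: less_induct)
      case less
      show ?case
      proof (cases "X = {}")
        case True
        then show ?thesis by (intro exI[of _ "\<lambda>_. 0"]) auto
      next
        case False
        have fX: "finite X" using less.prems(2) by (rule finite_subset) (simp add: grid_eq_cube finite_cube)
        obtain c where c: "\<forall>x. c x \<in> {-1, 0, 1}" "\<forall>x. x \<notin> X \<longrightarrow> c x = 0"
          "card X \<le> 10 * card {x \<in> X. c x \<noteq> 0}"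
          "\<forall>S\<in>APs d N. \<bar>real_of_int (\<Sum>x\<in>S. c x)\<bar>
             \<le> A0 * (real N powr (real d / (2 * real d + 2)) * (card X / real N ^ d) powr e)"
          using PC[rule_format, OF N conjI[OF less.prems(2) False]] by (elim exE conjE) (rule that; assumption)
        define Y where "Y = {x \<in> X. c x = 0}"
        have cXY: "card X = card Y + card {x \<in> X. c x \<noteq> 0}"
          unfolding Y_def using fX by (subst card_Un_disjoint[symmetric]) (auto intro: arg_cong[where f = card])
        moreover have "card X > 0" using fX False by (simp add: card_gt_0_iff)
        ultimately have cY: "card Y < card X" using c(3) by linarith
        have YX: "Y \<subseteq> grid d N" using less.prems by (auto simp: Y_def)
        obtain c' where c': "\<forall>x\<in>Y. c' x \<in> {1, -1}" "\<forall>x. x \<notin> Y \<longrightarrow> c' x = 0"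
          "\<forall>S\<in>APs d N. \<bar>real_of_int (\<Sum>x\<in>S. c' x)\<bar>
             \<le> A * (real N powr (real d / (2 * real d + 2)) * (card Y / real N ^ d) powr e)"
          using less.hyps[OF cY N YX] by (elim exE conjE) (rule that; assumption)
        have "real (card Y) \<le> 9/10 * card X" using cXY c(3) by linarith
        then have "(card Y / real N ^ d) powr e \<le> (9/10 * (card X / real N ^ d)) powr e"
          using e N by (intro powr_mono2) (auto simp: divide_right_mono field_simps)
        also have "\<dots> = q * (card X / real N ^ d) powr e" unfolding q_def by (rule powr_mult)
        finally have Yb: "(card Y / real N ^ d) powr e \<le> q * (card X / real N ^ d) powr e" .
        define V where "V = real N powr (real d / (2 * real d + 2))"
        have V: "V \<ge> 0" by (simp add: V_def)
        show ?thesis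
        proof (intro exI[of _ "\<lambda>x. c x + c' x"] conjI ballI allI impI)
          fix x assume "x \<in> X"
          then show "c x + c' x \<in> {1, -1}"
            using c(1)[rule_format, of x] c'(1,2) by (cases "c x = 0") (auto simp: Y_def)
        next
          fix x assume "x \<notin> X" then show "c x + c' x = 0" using c(2) c'(2) by (auto simp: Y_def)
        next
          fix S assume S: "S \<in> APs d N"
          have "\<bar>real_of_int (\<Sum>x\<in>S. c x + c' x)\<bar> \<le> \<bar>real_of_int (\<Sum>x\<in>S. c x)\<bar> + \<bar>real_of_int (\<Sum>x\<in>S. c' x)\<bar>"
            by (simp add: sum.distrib)
          also have "\<dots> \<le> A0 * (V * (card X / real N ^ d) powr e) + A * (V * (card Y / real N ^ d) powr e)"
            using c(4) c'(3) S by (intro add_mono) (auto simp: V_def)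
          also have "\<dots> \<le> A0 * (V * (card X / real N ^ d) powr e) + A * (V * (q * (card X / real N ^ d) powr e))"
            using Yb V A by (intro add_left_mono mult_left_mono) auto
          also have "\<dots> = (A0 + A * q) * (V * (card X / real N ^ d) powr e)" by (simp add: algebra_simps)
          finally show "\<bar>real_of_int (\<Sum>x\<in>S. c x + c' x)\<bar>
             \<le> A * (real N powr (real d / (2 * real d + 2)) * (card X / real N ^ d) powr e)"
            by (simp only: A(2) V_def)
        qed
      qed
    qed
  qed (rule A)
qed

section \<open>Lower bound\<close>

definition phase :: "nat \<Rightarrow> nat \<Rightarrow> (nat \<Rightarrow> nat) \<Rightarrow> (nat \<Rightarrow> int) \<Rightarrow> complex" where
  "phase d P t x = (\<Prod>i<d. cis (2 * pi * real (t i) * real_of_int (x i) / real P))"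

lemma norm_phase [simp]: "norm (phase d P t x) = 1"
  by (simp add: phase_def flip: prod_norm)

lemma phase_mult_cnj: "phase d P t x * cnj (phase d P t y) = phase d P t (\<lambda>i. x i - y i)"
  by (simp add: phase_def cis_cnj cis_mult algebra_simps diff_divide_distrib flip: prod.distrib)

lemma phase_line_pt: "phase d P t (line_pt x (- int l) b) = phase d P t x * cnj (phase d P t b) ^ l"
proof -
  have "cis (2 * pi * real (t i) * real_of_int (line_pt x (- int l) b i) / real P)
      = cis (2 * pi * real (t i) * real_of_int (x i) / real P)
        * cnj (cis (2 * pi * real (t i) * real_of_int (b i) / real P)) ^ l" for i
    by (simp add: line_pt_def cis_cnj cis_mult Complex.DeMoivre algebra_simps diff_divide_distrib)
  then show ?thesis by (simp add: phase_def prod.distrib prod_power_distrib)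
qed

lemma sum_cis_period:
  fixes z :: int
  assumes "\<bar>z\<bar> < int P"
  shows "(\<Sum>t<P. cis (2 * pi * real t * real_of_int z / real P)) = (if z = 0 then of_nat P else 0)"
proof (cases "z = 0")
  case False
  have P: "P > 0" using assms by linarith
  define w where "w = cis (2 * pi * real_of_int z / real P)"
  have w1: "w \<noteq> 1"
  proof
    assume "w = 1"
    then have "cos (2 * pi * real_of_int z / real P) = 1" by (simp add: w_def complex_eq_iff)
    then obtain n :: int where "2 * pi * real_of_int z / real P = n * 2 * pi" by (auto simp: cos_one_2pi_int)
    then have "real_of_int z = real_of_int n * real P" using P by (simp add: field_simps)
    then have "z = n * int P" by (metis of_int_eq_iff of_int_mult of_int_of_nat_eq)
    then have n: "\<bar>n\<bar> * int P < 1 * int P" using assms by (simp add: abs_mult)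
    then have "n = 0" using P by (simp only: mult_less_cancel_right) auto
    then show False using False \<open>z = n * int P\<close> by simp
  qed
  have "w ^ P = cis (real P * (2 * pi * real_of_int z / real P))" by (simp only: w_def Complex.DeMoivre)
  also have "real P * (2 * pi * real_of_int z / real P) = 2 * pi * real_of_int z" using P by simp
  also have "cis (2 * pi * real_of_int z) = 1" by (rule cis_multiple_2pi) simp
  finally have "w ^ P = 1" .
  then have "(\<Sum>t<P. w ^ t) = 0" using w1 by (simp add: geometric_sum)
  moreover have "w ^ t = cis (2 * pi * real t * real_of_int z / real P)" for t
    by (simp add: w_def Complex.DeMoivre mult_ac)
  ultimately show ?thesis using False by simp
qed simp

lemma sum_phase:
  assumes z: "\<And>i. i < d \<Longrightarrow> \<bar>z i\<bar> < int P"
  shows "(\<Sum>t\<in>PiE {..<d} (\<lambda>_. {..<P}). phase d P t z) = (if \<forall>i<d. z i = 0 then of_nat (P ^ d) else 0)"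
proof -
  have "(\<Sum>t\<in>PiE {..<d} (\<lambda>_. {..<P}). phase d P t z)
      = (\<Prod>i<d. \<Sum>t<P. cis (2 * pi * real t * real_of_int (z i) / real P))"
    unfolding phase_def by (subst prod_sum_PiE) auto
  also have "\<dots> = (\<Prod>i<d. if z i = 0 then of_nat P else 0)"
    by (rule prod.cong) (use z sum_cis_period in auto)
  also have "\<dots> = (if \<forall>i<d. z i = 0 then of_nat (P ^ d) else 0)"
    by (auto simp: prod_zero_iff)
  finally show ?thesis .
qed

text \<open>Points of the box differ by less than \<open>P\<close> in every coordinate, so no two of
  them are identified modulo \<open>P\<close>, and orthogonality of the characters leaves the
  diagonal.\<close>

lemma parseval:
  fixes g :: "(nat \<Rightarrow> int) \<Rightarrow> complex"
  assumes Y: "finite Y" "Y \<subseteq> cube d {a..b}" and P: "b - a < int P"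
  shows "(\<Sum>t\<in>PiE {..<d} (\<lambda>_. {..<P}). (norm (\<Sum>y\<in>Y. g y * phase d P t y))\<^sup>2)
           = real (P ^ d) * (\<Sum>y\<in>Y. (norm (g y))\<^sup>2)"
proof -
  let ?T = "PiE {..<d} (\<lambda>_. {..<P})"
  have dlt: "(\<Sum>t\<in>?T. phase d P t (\<lambda>i. y i - y' i)) = (if y = y' then of_nat (P ^ d) else 0)"
    if y: "y \<in> Y" "y' \<in> Y" for y y'
  proof -
    have c: "y \<in> cube d {a..b}" "y' \<in> cube d {a..b}" using y Y by auto
    have "(\<forall>i<d. y i - y' i = 0) \<longleftrightarrow> y = y'"
    proof
      assume e: "\<forall>i<d. y i - y' i = 0"
      show "y = y'"
      proof
        fix i show "y i = y' i" using c e by (cases "i < d") (auto simp: cube_def)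
      qed
    qed simp
    moreover have "\<bar>y i - y' i\<bar> < int P" if "i < d" for i
    proof -
      have "y i \<in> {a..b}" "y' i \<in> {a..b}" using c that by (auto simp: cube_def)
      then show ?thesis using P by auto
    qed
    ultimately show ?thesis using sum_phase[of d "\<lambda>i. y i - y' i" P] by simp
  qed
  have "complex_of_real (\<Sum>t\<in>?T. (norm (\<Sum>y\<in>Y. g y * phase d P t y))\<^sup>2)
      = (\<Sum>t\<in>?T. (\<Sum>y\<in>Y. g y * phase d P t y) * cnj (\<Sum>y\<in>Y. g y * phase d P t y))"
    by (simp only: of_real_sum complex_norm_square)
  also have "\<dots> = (\<Sum>t\<in>?T. \<Sum>y\<in>Y. \<Sum>y'\<in>Y. (g y * cnj (g y')) * phase d P t (\<lambda>i. y i - y' i))"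
    by (simp add: sum_product flip: phase_mult_cnj) (simp add: mult_ac)
  also have "\<dots> = (\<Sum>y\<in>Y. \<Sum>t\<in>?T. \<Sum>y'\<in>Y. (g y * cnj (g y')) * phase d P t (\<lambda>i. y i - y' i))"
    by (rule sum.swap)
  also have "\<dots> = (\<Sum>y\<in>Y. \<Sum>y'\<in>Y. \<Sum>t\<in>?T. (g y * cnj (g y')) * phase d P t (\<lambda>i. y i - y' i))"
    by (rule sum.cong[OF refl], rule sum.swap)
  also have "\<dots> = (\<Sum>y\<in>Y. \<Sum>y'\<in>Y. (g y * cnj (g y')) * (if y = y' then of_nat (P ^ d) else 0))"
    by (intro sum.cong refl) (simp add: dlt flip: sum_distrib_left)
  also have "\<dots> = (\<Sum>y\<in>Y. (g y * cnj (g y)) * of_nat (P ^ d))"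
    using Y(1) by (intro sum.cong refl) (simp add: if_distrib sum.delta cong: if_cong)
  also have "\<dots> = complex_of_real (real (P ^ d) * (\<Sum>y\<in>Y. (norm (g y))\<^sup>2))"
    by (simp only: of_real_mult of_real_sum of_real_of_nat_eq complex_norm_square sum_distrib_left mult.commute)
  finally show ?thesis by (simp only: of_real_eq_iff)
qed

text \<open>The Dirichlet pigeonhole: some difference of two points of \<open>{0..M} ^ d\<close> is almost
  annihilated by the character \<open>t\<close>, so that a long progression in that direction does not cancel.\<close>

lemma large_geometric_sum:
  fixes d M L :: nat
  assumes pig: "6 * L < (M + 1) ^ d" and L: "L \<ge> 1"
  obtains b where "b \<in> cube d {- int M..int M}" "b \<noteq> (\<lambda>_. 0)"
    "real L / 2 \<le> norm (\<Sum>l<L. cnj (phase d P t b) ^ l)"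
proof -
  define \<alpha> where "\<alpha> v = Arg2pi (phase d P t v)" for v
  have \<alpha>: "0 \<le> \<alpha> v" "\<alpha> v < 2 * pi" "phase d P t v = cis (\<alpha> v)" for v
    using Arg2pi[of "phase d P t v"] by (auto simp: \<alpha>_def cis_conv_exp is_Arg_def)
  \<comment> \<open>The circle is cut into \<open>6 * L\<close> arcs. Within one arc the angles
    differ by at most \<open>pi / (3 * L)\<close>, so all multiples with \<open>l < L\<close> stay
    within \<open>pi / 3\<close>, where the cosine is at least 1/2.\<close>
  define bin where "bin v = nat \<lfloor>\<alpha> v * (6 * L) / (2 * pi)\<rfloor>" for v
  let ?V = "cube d {0..int M}"
  have "bin ` ?V \<subseteq> {..<6 * L}"
  proof (rule image_subsetI)
    fix v
    have "\<alpha> v * (6 * L) / (2 * pi) < (2 * pi) * (6 * L) / (2 * pi)"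
      using \<alpha>(2)[of v] L by (intro divide_strict_right_mono mult_strict_right_mono) auto
    then have "\<alpha> v * (6 * L) / (2 * pi) < 6 * real L" by simp
    moreover have "0 \<le> \<alpha> v * (6 * L) / (2 * pi)" using \<alpha>(1)[of v] by simp
    ultimately show "bin v \<in> {..<6 * L}" by (simp add: bin_def nat_less_iff floor_less_iff)
  qed
  then have "card (bin ` ?V) \<le> 6 * L" using card_mono[of "{..<6 * L}"] by fastforce
  also have "\<dots> < card ?V" using pig by (simp add: card_cube nat_add_distrib)
  finally have "\<not> inj_on bin ?V" by (metis card_image less_irrefl)
  then obtain v v' where v: "v \<in> ?V" "v' \<in> ?V" "v \<noteq> v'" "bin v = bin v'" by (auto simp: inj_on_def)
  define b where "b = (\<lambda>i. v i - v' i)"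
  define \<phi> where "\<phi> = \<alpha> v - \<alpha> v'"
  have pb: "phase d P t b = cis \<phi>"
    using phase_mult_cnj[of d P t v v'] by (simp add: b_def \<phi>_def \<alpha>(3) cis_cnj cis_mult)
  have \<phi>: "\<bar>\<phi>\<bar> * (3 * L) \<le> pi"
  proof -
    define p where "p v = \<alpha> v * (6 * L) / (2 * pi)" for v
    have "\<lfloor>p v\<rfloor> = \<lfloor>p v'\<rfloor>"
    proof -
      have "\<lfloor>p v\<rfloor> \<ge> 0" "\<lfloor>p v'\<rfloor> \<ge> 0" using \<alpha>(1) by (auto simp: p_def)
      moreover have "nat \<lfloor>p v\<rfloor> = nat \<lfloor>p v'\<rfloor>" using v(4) unfolding bin_def p_def .
      ultimately show ?thesis by (simp only: eq_nat_nat_iff)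
    qed
    then have "\<bar>p v - p v'\<bar> < 1" by linarith
    moreover have "p v - p v' = \<phi> * (3 * L) / pi" by (simp add: p_def \<phi>_def field_simps)
    ultimately have "\<bar>\<phi> * (3 * L) / pi\<bar> < 1" by simp
    then have "\<bar>\<phi>\<bar> * (3 * L) / pi < 1" by (simp add: abs_mult)
    then show ?thesis by (simp add: divide_less_eq)
  qed
  have "real L / 2 = (\<Sum>l<L. 1/2)" by simp
  also have "\<dots> \<le> (\<Sum>l<L. Re (cnj (phase d P t b) ^ l))"
  proof (rule sum_mono)
    fix l assume l: "l \<in> {..<L}"
    have "\<bar>\<phi>\<bar> * (3 * l) \<le> \<bar>\<phi>\<bar> * (3 * L)" using l by (intro mult_left_mono) auto
    then have lp: "\<bar>real l * \<phi>\<bar> \<le> pi / 3" using \<phi> by (simp add: abs_mult mult_ac)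
    have "1/2 = cos (pi / 3)" by (simp add: cos_60)
    also have "\<dots> \<le> cos \<bar>real l * \<phi>\<bar>" using lp by (intro cos_monotone_0_pi_le) auto
    also have "\<dots> = cos (real l * \<phi>)" by simp
    also have "\<dots> = Re (cnj (phase d P t b) ^ l)" by (simp add: pb cis_cnj Complex.DeMoivre)
    finally show "1/2 \<le> Re (cnj (phase d P t b) ^ l)" .
  qed
  also have "\<dots> = Re (\<Sum>l<L. cnj (phase d P t b) ^ l)" by simp
  also have "\<dots> \<le> norm (\<Sum>l<L. cnj (phase d P t b) ^ l)" by (rule complex_Re_le_cmod)
  finally have n: "real L / 2 \<le> norm (\<Sum>l<L. cnj (phase d P t b) ^ l)" .
  have "b \<in> cube d {- int M..int M}" using v(1,2) by (force simp: cube_def b_def)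
  moreover have "b \<noteq> (\<lambda>_. 0)" using v(3) by (auto simp: b_def fun_eq_iff)
  ultimately show ?thesis using that n by blast
qed

text \<open>The grid is convex, so the indices at which the line is inside it form an interval, and
  the sum runs over a single progression or over nothing. This admits starting points outside the
  grid, which the convolution below requires.\<close>

lemma line_segment_sum_bound:
  fixes col :: "(nat \<Rightarrow> int) \<Rightarrow> int"
  assumes col: "\<And>x. x \<notin> grid d N \<Longrightarrow> col x = 0"
    and \<Delta>: "\<And>A. A \<in> APs d N \<Longrightarrow> \<bar>\<Sum>x\<in>A. col x\<bar> \<le> \<Delta>" "\<Delta> \<ge> 0"
    and y: "y \<in> zvec d" and b: "b \<in> zvec d" "b \<noteq> (\<lambda>_. 0)"
  shows "\<bar>\<Sum>l<L. col (line_pt y (int l) b)\<bar> \<le> \<Delta>"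
proof -
  define I where "I = {l. l < L \<and> line_pt y (int l) b \<in> grid d N}"
  have fI: "finite I" by (simp add: I_def)
  have eq: "(\<Sum>l<L. col (line_pt y (int l) b)) = (\<Sum>l\<in>I. col (line_pt y (int l) b))"
    by (rule sum.mono_neutral_right) (use col in \<open>auto simp: I_def\<close>)
  show ?thesis
  proof (cases "I = {}")
    case True
    then show ?thesis using eq \<Delta> by simp
  next
    case False
    define p where "p = Min I"
    define q where "q = Max I"
    have pq: "p \<in> I" "q \<in> I" "p \<le> q" using fI False by (auto simp: p_def q_def)
    have "I = {p..q}"
    proof (intro equalityI subsetI)
      fix l assume l: "l \<in> {p..q}"
      have "line_pt y (int l) b \<in> grid d N"
      proof -
        have g: "line_pt y (int p) b \<in> grid d N" "line_pt y (int q) b \<in> grid d N" using pq by (auto simp: I_def)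
        have "1 \<le> y i + int l * b i \<and> y i + int l * b i \<le> int N" if i: "i < d" for i
        proof -
          have g': "1 \<le> y i + int p * b i \<and> y i + int p * b i \<le> int N" "1 \<le> y i + int q * b i \<and> y i + int q * b i \<le> int N"
            using g i by (auto simp: grid_def line_pt_def)
          show ?thesis
          proof (cases "b i \<ge> 0")
            case True
            then have "int p * b i \<le> int l * b i" "int l * b i \<le> int q * b i" using l by (auto intro: mult_right_mono)
            then show ?thesis using g' by linarith
          next
            case False
            then have "int p * b i \<ge> int l * b i" "int l * b i \<ge> int q * b i" using l by (auto intro: mult_right_mono_neg)
            then show ?thesis using g' by linarith
          qed
        qed
        then show ?thesis using y b by (auto simp: grid_def line_pt_def zvec_def)
      qed
      then show "l \<in> I" using l pq by (auto simp: I_def)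
    qed (use fI in \<open>auto simp: p_def q_def\<close>)
    define A where "A = ap (line_pt y (int p) b) b (q - p + 1)"
    have A: "A = (\<lambda>l. line_pt y (int l) b) ` {p..q}"
    proof -
      have "A = (\<lambda>i. line_pt (line_pt y (int p) b) (int i) b) ` {..<q - p + 1}"
        by (auto simp: A_def ap_def line_pt_def)
      also have "\<dots> = (\<lambda>l. line_pt y (int l) b) ` ((\<lambda>i. p + i) ` {..<q - p + 1})"
        by (simp add: image_image)
      also have "(\<lambda>i. p + i) ` {..<q - p + 1} = {p..q}"
        using pq(3) image_add_atLeastLessThan[of p 0 "q - p + 1"] by (simp add: lessThan_atLeast0 atLeastLessThanSuc_atLeastAtMost)
      finally show ?thesis .
    qed
    have inj: "inj_on (\<lambda>l. line_pt y (int l) b) {p..q}" using b by (auto simp: inj_on_def line_pt_inj)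
    have Ag: "A \<subseteq> grid d N" unfolding A using \<open>I = {p..q}\<close> by (auto simp: I_def)
    have "line_pt y (int p) b \<in> zvec d" using y b by (simp add: zvec_def line_pt_def)
    then have "A \<in> APs d N" using Ag b unfolding APs_def A_def by fastforce
    moreover have "(\<Sum>x\<in>A. col x) = (\<Sum>l\<in>I. col (line_pt y (int l) b))"
      unfolding A \<open>I = {p..q}\<close> by (simp add: sum.reindex[OF inj])
    ultimately show ?thesis using \<Delta>(1)[of A] eq by simp
  qed
qed

text \<open>Summing along direction \<open>b\<close> is a convolution and multiplies the transform
  \<open>F\<close> by a geometric sum. The direction that makes this factor at least
  \<open>L / 2\<close> varies with the frequency, so all directions are summed. The bound reflects
  \<open>(2 * M + 1) ^ d\<close> directions, \<open>(3 * N) ^ d\<close> starting points, and the 4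
  from \<open>(L / 2)\<^sup>2\<close>.\<close>

lemma discrepancy_fourier_bound:
  fixes col :: "(nat \<Rightarrow> int) \<Rightarrow> int" and \<Delta> :: int
  assumes d: "d \<ge> 1" and N: "N \<ge> 1" and col: "col \<in> colorings d N"
    and \<Delta>: "\<And>A. A \<in> APs d N \<Longrightarrow> \<bar>\<Sum>x\<in>A. col x\<bar> \<le> \<Delta>" "\<Delta> \<ge> 0"
    and L: "L \<ge> 1" and LM: "L * M \<le> N" "6 * L < (M + 1) ^ d"
  shows "(real L)\<^sup>2 \<le> 4 * (3 * (2 * real M + 1)) ^ d * (real_of_int \<Delta>)\<^sup>2"
proof -
  \<comment> \<open>Larger than the side length \<open>3 * N\<close> of \<open>Y\<close>, so that
    nothing wraps around modulo \<open>P\<close>.\<close>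
  define P where "P = 4 * N"
  have P: "P > 0" using N by (simp add: P_def)
  let ?T = "PiE {..<d} (\<lambda>_. {..<P})"
  \<comment> \<open>By \<open>L * M \<le> N\<close> this box contains every \<open>x - l b\<close>
    with \<open>x\<close> in the grid and \<open>l < L\<close>, so the convolution loses no
    term.\<close>
  define Y where "Y = cube d {1 - int N..2 * int N}"
  define Bs where "Bs = cube d {- int M..int M} - {\<lambda>_. 0}"
  have fY: "finite Y" and fBs: "finite Bs" by (auto simp: Y_def Bs_def finite_cube)
  have fg: "finite (grid d N)" by (simp add: grid_eq_cube finite_cube)
  have fT: "finite ?T" by (intro finite_PiE) auto
  have c0: "col x = 0" if "x \<notin> grid d N" for x using col that by (auto simp: colorings_def)
  have c1: "col x = 1 \<or> col x = -1" if "x \<in> grid d N" for x using col that by (auto simp: colorings_def)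
  have gY: "grid d N \<subseteq> Y" unfolding grid_eq_cube Y_def by (rule cube_mono) auto
  define G where "G b y = (\<Sum>l<L. col (line_pt y (int l) b))" for b y
  define F where "F t = (\<Sum>x\<in>grid d N. of_int (col x) * phase d P t x)" for t
  have FG: "(\<Sum>y\<in>Y. of_int (G b y) * phase d P t y) = F t * (\<Sum>l<L. cnj (phase d P t b) ^ l)"
    if b: "b \<in> Bs" for b t
  proof -
    have "(\<Sum>y\<in>Y. of_int (col (line_pt y (int l) b)) * phase d P t y) = F t * cnj (phase d P t b) ^ l"
      if l: "l < L" for l
    proof -
      have inj: "inj_on (\<lambda>x. line_pt x (- int l) b) (grid d N)" by (auto simp: inj_on_def line_pt_cancel)
      have sub: "(\<lambda>x. line_pt x (- int l) b) ` grid d N \<subseteq> Y"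
      proof (rule image_subsetI)
        fix x assume x: "x \<in> grid d N"
        have "1 - int N \<le> x i - int l * b i \<and> x i - int l * b i \<le> 2 * int N" if i: "i < d" for i
        proof -
          have "\<bar>b i\<bar> \<le> int M" using b i by (force simp: Bs_def cube_def)
          then have "int l * \<bar>b i\<bar> \<le> int L * int M" using l by (intro mult_mono) auto
          also have "\<dots> \<le> int N" using LM(1) by (metis of_nat_le_iff of_nat_mult)
          finally have "\<bar>int l * b i\<bar> \<le> int N" by (simp add: abs_mult)
          moreover have "1 \<le> x i \<and> x i \<le> int N" using x i by (simp add: grid_def)
          ultimately show ?thesis by linarith
        qed
        then show "line_pt x (- int l) b \<in> Y" using x b by (simp add: Y_def cube_def line_pt_def grid_def Bs_def)
      qed
      have "(\<Sum>y\<in>Y. of_int (col (line_pt y (int l) b)) * phase d P t y)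
          = (\<Sum>y\<in>(\<lambda>x. line_pt x (- int l) b) ` grid d N. of_int (col (line_pt y (int l) b)) * phase d P t y)"
      proof (rule sum.mono_neutral_right[OF fY sub], rule ballI)
        fix y assume y: "y \<in> Y - (\<lambda>x. line_pt x (- int l) b) ` grid d N"
        have "line_pt y (int l) b \<notin> grid d N"
        proof
          assume "line_pt y (int l) b \<in> grid d N"
          moreover have "y = line_pt (line_pt y (int l) b) (- int l) b" by simp
          ultimately show False using y by blast
        qed
        then show "of_int (col (line_pt y (int l) b)) * phase d P t y = 0" by (simp add: c0)
      qed
      also have "\<dots> = (\<Sum>x\<in>grid d N. of_int (col x) * (phase d P t x * cnj (phase d P t b) ^ l))"
        by (simp add: sum.reindex[OF inj] phase_line_pt)
      also have "\<dots> = F t * cnj (phase d P t b) ^ l" by (simp add: F_def sum_distrib_right mult.assoc)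
      finally show ?thesis .
    qed
    then have "(\<Sum>l<L. \<Sum>y\<in>Y. of_int (col (line_pt y (int l) b)) * phase d P t y)
        = (\<Sum>l<L. F t * cnj (phase d P t b) ^ l)" by (intro sum.cong) auto
    moreover have "(\<Sum>y\<in>Y. of_int (G b y) * phase d P t y)
        = (\<Sum>l<L. \<Sum>y\<in>Y. of_int (col (line_pt y (int l) b)) * phase d P t y)"
      by (subst sum.swap) (simp add: G_def sum_distrib_right)
    ultimately show ?thesis by (simp add: sum_distrib_left)
  qed
  have parG: "(\<Sum>t\<in>?T. (norm (F t))\<^sup>2 * (norm (\<Sum>l<L. cnj (phase d P t b) ^ l))\<^sup>2)
      = real (P ^ d) * (\<Sum>y\<in>Y. (real_of_int (G b y))\<^sup>2)" if b: "b \<in> Bs" for b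
  proof -
    have "(\<Sum>t\<in>?T. (norm (\<Sum>y\<in>Y. of_int (G b y) * phase d P t y))\<^sup>2)
        = real (P ^ d) * (\<Sum>y\<in>Y. (norm (of_int (G b y) :: complex))\<^sup>2)"
      by (rule parseval[OF fY]) (use N in \<open>auto simp: Y_def P_def\<close>)
    then show ?thesis by (simp add: FG[OF b] norm_mult power_mult_distrib)
  qed
  have parF: "(\<Sum>t\<in>?T. (norm (F t))\<^sup>2) = real (P ^ d) * real N ^ d"
  proof -
    have "(\<Sum>t\<in>?T. (norm (F t))\<^sup>2) = real (P ^ d) * (\<Sum>x\<in>grid d N. (norm (of_int (col x) :: complex))\<^sup>2)"
      unfolding F_def by (rule parseval[OF fg, of d "1 - int N" "2 * int N"]) (use gY N in \<open>auto simp: Y_def P_def\<close>)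
    also have "(\<Sum>x\<in>grid d N. (norm (of_int (col x) :: complex))\<^sup>2) = (\<Sum>x\<in>grid d N. 1)"
      by (rule sum.cong) (use c1 in force)+
    also have "\<dots> = real N ^ d" by (simp add: grid_eq_cube card_cube)
    finally show ?thesis .
  qed
  have "real (P ^ d) * (real N ^ d * ((real L)\<^sup>2 / 4)) = (\<Sum>t\<in>?T. (norm (F t))\<^sup>2 * (real L / 2)\<^sup>2)"
    unfolding sum_distrib_right[symmetric] parF by (simp add: power_divide)
  also have "\<dots> \<le> (\<Sum>t\<in>?T. \<Sum>b\<in>Bs. (norm (F t))\<^sup>2 * (norm (\<Sum>l<L. cnj (phase d P t b) ^ l))\<^sup>2)"
  proof (rule sum_mono)
    fix t
    obtain b where b: "b \<in> cube d {- int M..int M}" "b \<noteq> (\<lambda>_. 0)"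
      "real L / 2 \<le> norm (\<Sum>l<L. cnj (phase d P t b) ^ l)"
      using large_geometric_sum[OF LM(2) L] by blast
    have "(norm (F t))\<^sup>2 * (real L / 2)\<^sup>2 \<le> (norm (F t))\<^sup>2 * (norm (\<Sum>l<L. cnj (phase d P t b) ^ l))\<^sup>2"
      using b(3) by (intro mult_left_mono power_mono) auto
    also have "\<dots> \<le> (\<Sum>b\<in>Bs. (norm (F t))\<^sup>2 * (norm (\<Sum>l<L. cnj (phase d P t b) ^ l))\<^sup>2)"
      using b fBs by (intro member_le_sum) (auto simp: Bs_def)
    finally show "(norm (F t))\<^sup>2 * (real L / 2)\<^sup>2 \<le> (\<Sum>b\<in>Bs. (norm (F t))\<^sup>2 * (norm (\<Sum>l<L. cnj (phase d P t b) ^ l))\<^sup>2)" .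
  qed
  also have "\<dots> = (\<Sum>b\<in>Bs. \<Sum>t\<in>?T. (norm (F t))\<^sup>2 * (norm (\<Sum>l<L. cnj (phase d P t b) ^ l))\<^sup>2)"
    by (rule sum.swap)
  also have "\<dots> = (\<Sum>b\<in>Bs. real (P ^ d) * (\<Sum>y\<in>Y. (real_of_int (G b y))\<^sup>2))"
    by (intro sum.cong refl parG)
  also have "\<dots> \<le> (\<Sum>b\<in>Bs. real (P ^ d) * (\<Sum>y\<in>Y. (real_of_int \<Delta>)\<^sup>2))"
  proof (intro sum_mono mult_left_mono)
    fix b y assume b: "b \<in> Bs" and y: "y \<in> Y"
    have "\<bar>G b y\<bar> \<le> \<Delta>"
      unfolding G_def
    proof (rule line_segment_sum_bound[OF c0 \<Delta>])
      show "y \<in> zvec d" "b \<in> zvec d" "b \<noteq> (\<lambda>_. 0)" using b y by (auto simp: Bs_def Y_def cube_def zvec_def)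
    qed
    then have "\<bar>real_of_int (G b y)\<bar> \<le> real_of_int \<Delta>" by linarith
    then show "(real_of_int (G b y))\<^sup>2 \<le> (real_of_int \<Delta>)\<^sup>2" by (metis abs_ge_zero power2_abs power_mono)
  qed auto
  also have "\<dots> = real (P ^ d) * (real (card Bs) * real (card Y) * (real_of_int \<Delta>)\<^sup>2)" by simp
  finally have main: "real N ^ d * ((real L)\<^sup>2 / 4) \<le> real (card Bs) * real (card Y) * (real_of_int \<Delta>)\<^sup>2"
    using P by (simp only: mult_le_cancel_left_pos of_nat_0_less_iff zero_less_power)
  have "real (card Bs) \<le> (2 * real M + 1) ^ d"
  proof -
    have "card Bs \<le> card (cube d {- int M..int M})" unfolding Bs_def by (intro card_mono finite_cube) auto
    then have "real (card Bs) \<le> real (card (cube d {- int M..int M}))" by simp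
    then show ?thesis by (simp add: card_cube)
  qed
  moreover have "real (card Y) = (3 * real N) ^ d" by (simp add: Y_def card_cube)
  ultimately have "real (card Bs) * real (card Y) * (real_of_int \<Delta>)\<^sup>2
      \<le> (2 * real M + 1) ^ d * (3 * real N) ^ d * (real_of_int \<Delta>)\<^sup>2"
    by (intro mult_right_mono mult_mono) auto
  then have "real N ^ d * ((real L)\<^sup>2 / 4) \<le> real N ^ d * ((3 * (2 * real M + 1)) ^ d * (real_of_int \<Delta>)\<^sup>2)"
  proof -
    have "(2 * real M + 1) ^ d * (3 * real N) ^ d * (real_of_int \<Delta>)\<^sup>2
        = real N ^ d * ((3 * (2 * real M + 1)) ^ d * (real_of_int \<Delta>)\<^sup>2)"
      by (simp only: power_mult_distrib mult_ac)
    then show ?thesis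
      using \<open>real N ^ d * ((real L)\<^sup>2 / 4) \<le> _\<close> \<open>real (card Bs) * real (card Y) * (real_of_int \<Delta>)\<^sup>2 \<le> _\<close>
      by linarith
  qed
  then have "(real L)\<^sup>2 / 4 \<le> (3 * (2 * real M + 1)) ^ d * (real_of_int \<Delta>)\<^sup>2"
    using N by (simp add: mult_le_cancel_left)
  then show ?thesis by simp
qed

lemma discrepancy_lower_bound:
  fixes col :: "(nat \<Rightarrow> int) \<Rightarrow> int" and \<Delta> :: int
  assumes d: "d \<ge> 1" and N: "N \<ge> 1" and col: "col \<in> colorings d N"
    and \<Delta>: "\<And>A. A \<in> APs d N \<Longrightarrow> \<bar>\<Sum>x\<in>A. col x\<bar> \<le> \<Delta>" "\<Delta> \<ge> 1"
  shows "sqrt (1 / (144 * 2 ^ (d + 2) * 9 ^ d)) * real N powr (real d / (2 * real d + 2)) \<le> real_of_int \<Delta>"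
proof -
  \<comment> \<open>The factor 144 is 24 times 6: 24 from the 4 of the Fourier bound and the 6 in
    \<open>X\<close>, and 6 from \<open>U / 6 \<le> X\<close>. The power of 2 comes from
    \<open>L \<ge> X / 2\<close>, and \<open>9 ^ d\<close> from
    \<open>3 * (2 * M + 1) \<le> 9 * (N / L)\<close>.\<close>
  define c where "c = 1 / (144 * 2 ^ (d + 2) * 9 ^ d :: real)"
  have c: "c > 0" by (simp add: c_def)
  define U where "U = real N powr (real d / (real d + 1))"
  have "c * U \<le> (real_of_int \<Delta>)\<^sup>2"
  \<comment> \<open>For such small \<open>N\<close> the length \<open>L\<close> below would be 0;
    there \<open>\<Delta> \<ge> 1\<close> suffices.\<close>
  proof (cases "real N ^ d < 6")
    case True
    have "U \<le> real N powr real d"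
      unfolding U_def using N by (intro powr_mono) (auto simp: divide_le_eq algebra_simps)
    also have "\<dots> = real N ^ d" using N by (simp add: powr_realpow)
    finally have "U \<le> 6" using True by simp
    moreover have "c \<le> 1/6"
    proof -
      have "1 * 1 \<le> 2 ^ (d + 2) * (9 ^ d :: real)" by (intro mult_mono one_le_power) auto
      then have "6 \<le> 144 * 2 ^ (d + 2) * (9 ^ d :: real)" by linarith
      then show ?thesis by (simp add: c_def divide_simps)
    qed
    ultimately have "c * U \<le> (1/6) * 6" using c by (intro mult_mono) (auto simp: U_def)
    also have "\<dots> \<le> (real_of_int \<Delta>)\<^sup>2" using \<Delta>(2) by (simp add: one_le_power)
    finally show ?thesis .
  next
    case False
    \<comment> \<open>The solution of \<open>6 * X = (N / X) ^ d\<close>. Its integer part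
      \<open>L\<close> satisfies \<open>6 * L \<le> (N / L) ^ d\<close>, and the pigeonhole
      condition follows strictly because \<open>N / L < M + 1\<close>.\<close>
    define X where "X = (real N ^ d / 6) powr (1 / (real d + 1))"
    have X1: "X \<ge> 1" using False by (simp add: X_def ge_one_powr_ge_zero)
    have Xp: "X ^ (d + 1) = real N ^ d / 6"
    proof -
      have "X ^ (d + 1) = X powr (real d + 1)" using X1 by (simp add: powr_realpow[symmetric] add.commute del: power_Suc)
      also have "\<dots> = real N ^ d / 6" using N by (simp add: X_def powr_powr)
      finally show ?thesis .
    qed
    have XU: "U / 6 \<le> X"
    proof -
      have "(1/6::real) powr 1 \<le> (1/6) powr (1 / (real d + 1))" by (intro powr_mono') auto
      then have "U * (1/6) \<le> U * (1/6) powr (1 / (real d + 1))" by (intro mult_left_mono) (auto simp: U_def)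
      also have "\<dots> = X"
      proof -
        have "U = (real N ^ d) powr (1 / (real d + 1))"
          using N by (simp add: U_def powr_powr flip: powr_realpow)
        then show ?thesis unfolding X_def by (simp only:) (subst powr_mult[symmetric], auto)
      qed
      finally show ?thesis by simp
    qed
    define L where "L = nat \<lfloor>X\<rfloor>"
    have Lr: "real L \<le> X" "X < real L + 1" "real L \<ge> 1"
    proof -
      have "real L = of_int \<lfloor>X\<rfloor>" using X1 by (simp add: L_def)
      then show "real L \<le> X" "X < real L + 1" by linarith+
      show "real L \<ge> 1" using X1 by (simp add: L_def Suc_le_eq le_nat_iff)
    qed
    have L2: "real L \<ge> X / 2" using Lr by linarith
    have Lp: "6 * real L ^ (d + 1) \<le> real N ^ d"
      using power_mono[OF Lr(1), of "d + 1"] Xp by simp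
    define M where "M = N div L"
    have LN: "real L \<le> real N"
    proof (rule ccontr)
      assume "\<not> real L \<le> real N"
      then have "real N ^ (d + 1) \<le> real L ^ (d + 1)" by (intro power_mono) auto
      moreover have "real N ^ d \<le> real N ^ (d + 1)" using N by (intro power_increasing) auto
      moreover have "real N ^ d > 0" using N by simp
      ultimately show False using Lp by linarith
    qed
    have L1: "L \<ge> 1" using Lr(3) by linarith
    have LM: "L * M \<le> N" by (simp add: M_def)
    have Mlt: "real N / L < real M + 1"
    proof -
      have "N < (M + 1) * L" using L1 dividend_less_div_times[of L N] by (simp add: M_def mult.commute)
      then have "real N < (real M + 1) * real L" by (metis of_nat_1 of_nat_add of_nat_less_iff of_nat_mult)
      then show ?thesis using L1 by (simp add: divide_less_eq)
    qed
    have "6 * real L \<le> (real N / L) ^ d"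
      using Lp L1 by (simp add: power_divide le_divide_eq)
    also have "\<dots> < (real M + 1) ^ d" using Mlt d by (intro power_strict_mono) auto
    finally have "6 * L < (M + 1) ^ d" by (metis (mono_tags) of_nat_1 of_nat_add of_nat_less_iff of_nat_mult of_nat_numeral of_nat_power)
    then have fb: "(real L)\<^sup>2 \<le> 4 * (3 * (2 * real M + 1)) ^ d * (real_of_int \<Delta>)\<^sup>2"
      using discrepancy_fourier_bound[OF d N col \<Delta>(1) _ L1 LM] \<Delta>(2) by simp
    have "real M \<le> real N / L" using of_nat_div_le_of_nat[of N L, where ?'a = real] by (simp add: M_def)
    moreover have "1 \<le> real N / L" using LN L1 by simp
    moreover have "3 * (2 * a + 1) \<le> 9 * z" if "a \<le> z" "1 \<le> z" for a z :: real
      using that by (simp add: distrib_left)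
    ultimately have "3 * (2 * real M + 1) \<le> 9 * (real N / L)" by blast
    then have "(3 * (2 * real M + 1)) ^ d \<le> (9 * (real N / L)) ^ d" by (intro power_mono) auto
    then have "4 * (3 * (2 * real M + 1)) ^ d * (real_of_int \<Delta>)\<^sup>2 \<le> 4 * (9 * (real N / L)) ^ d * (real_of_int \<Delta>)\<^sup>2"
      by (intro mult_right_mono mult_left_mono) auto
    with fb have "(real L)\<^sup>2 \<le> 4 * (9 * (real N / L)) ^ d * (real_of_int \<Delta>)\<^sup>2" by linarith
    then have "(real L)\<^sup>2 * real L ^ d \<le> 4 * 9 ^ d * real N ^ d * (real_of_int \<Delta>)\<^sup>2"
      using L1 by (simp add: power_mult_distrib power_divide field_simps)
    moreover have "(X / 2) ^ (d + 2) \<le> (real L)\<^sup>2 * real L ^ d"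
      using power_mono[OF L2, of "d + 2"] X1 by (simp add: power2_eq_square mult_ac)
    moreover have "(X / 2) ^ (d + 2) = X * (real N ^ d / 6) / 2 ^ (d + 2)"
    proof -
      have "(X / 2) ^ (d + 2) = X * X ^ (d + 1) / 2 ^ (d + 2)" by (simp add: power_divide)
      then show ?thesis unfolding Xp .
    qed
    ultimately have "X * (real N ^ d / 6) / 2 ^ (d + 2) \<le> 4 * 9 ^ d * real N ^ d * (real_of_int \<Delta>)\<^sup>2" by linarith
    then have "real N ^ d * (X / (24 * 2 ^ (d + 2) * 9 ^ d)) \<le> real N ^ d * (real_of_int \<Delta>)\<^sup>2"
      by (simp add: field_simps)
    moreover have "real N ^ d > 0" using N by simp
    ultimately have "X / (24 * 2 ^ (d + 2) * 9 ^ d) \<le> (real_of_int \<Delta>)\<^sup>2"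
      by (simp only: mult_le_cancel_left_pos)
    moreover have "c * U \<le> X / (24 * 2 ^ (d + 2) * 9 ^ d)"
    proof -
      have "c * U = (U / 6) / (24 * 2 ^ (d + 2) * 9 ^ d)" by (simp add: c_def)
      also have "\<dots> \<le> X / (24 * 2 ^ (d + 2) * 9 ^ d)" using XU by (intro divide_right_mono) auto
      finally show ?thesis .
    qed
    ultimately show ?thesis by linarith
  qed
  then have "sqrt (c * U) \<le> real_of_int \<Delta>" using \<Delta>(2) real_sqrt_le_mono by fastforce
  moreover have "sqrt U = real N powr (real d / (2 * real d + 2))"
    by (simp add: U_def powr_powr algebra_simps flip: powr_half_sqrt)
  ultimately show ?thesis by (simp only: real_sqrt_mult c_def)
qed

section \<open>Finiteness of the families, and the two bounds combined\<close>

lemma finite_APs: "finite (APs d N)"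
proof (rule finite_subset)
  show "APs d N \<subseteq> Pow (grid d N)" by (auto simp: APs_def)
  show "finite (Pow (grid d N))" by (simp add: grid_eq_cube finite_cube)
qed

lemma finite_colorings: "finite (colorings d N)"
proof -
  have "inj_on (\<lambda>c. restrict c (grid d N)) (colorings d N)"
  proof (rule inj_onI)
    fix c c' assume c: "c \<in> colorings d N" "c' \<in> colorings d N" "restrict c (grid d N) = restrict c' (grid d N)"
    show "c = c'"
    proof
      fix x show "c x = c' x"
      proof (cases "x \<in> grid d N")
        case True
        then show ?thesis using fun_cong[OF c(3), of x] by simp
      next
        case False
        then show ?thesis using c by (simp add: colorings_def)
      qed
    qed
  qed
  moreover have "(\<lambda>c. restrict c (grid d N)) ` colorings d N \<subseteq> signs (grid d N)"
    by (auto simp: colorings_def signs_def)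
  moreover have "finite (signs (grid d N))" by (simp add: finite_signs grid_eq_cube finite_cube)
  ultimately show ?thesis using inj_on_finite by blast
qed

text \<open>Guarantees that each maximum is over a nonempty family and is at least 1, as the lower
  bound assumes.\<close>

lemma singleton_in_APs:
  assumes d: "d \<ge> 1" and N: "N \<ge> 1"
  obtains x where "x \<in> grid d N" "{x} \<in> APs d N"
proof -
  define x where "x = (\<lambda>i. if i < d then 1 else 0 :: int)"
  define b where "b = (\<lambda>i::nat. if i = 0 then 1 else 0 :: int)"
  have x: "x \<in> grid d N" "x \<in> zvec d" using N by (auto simp: x_def grid_def zvec_def)
  have b: "b \<in> zvec d" "b \<noteq> (\<lambda>_. 0)"
    using d by (auto simp: b_def zvec_def fun_eq_iff)
  have s: "ap x b 1 = {x}" by (simp add: ap_def)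
  have "{x} \<in> APs d N"
    unfolding APs_def mem_Collect_eq
    by (rule exI[of _ x], rule exI[of _ b], rule exI[of _ 1]) (simp add: s b x del: One_nat_def)
  then show ?thesis using that x by blast
qed

theorem theorem1p1:
  fixes d :: nat
  assumes "d \<ge> 1"
  shows "\<exists>c C :: real. c > 0 \<and> C > 0 \<and>
           (\<forall>N::nat. N \<ge> 1 \<longrightarrow>
              c * real N powr (real d / (2 * real d + 2)) \<le> real_of_int (disc_AP d N) \<and>
              real_of_int (disc_AP d N) \<le> C * real N powr (real d / (2 * real d + 2)))"
proof -
  define e where "e = 1 / (32 * real d * (real d + 1) * (real d + 2))"
  define c0 where "c0 = sqrt (1 / (144 * 2 ^ (d + 2) * 9 ^ d))"
  have c0: "c0 > 0" by (simp add: c0_def)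
  obtain C where C: "C > 0" and upper: "\<forall>N\<ge>1. \<forall>X. X \<subseteq> grid d N \<longrightarrow>
    (\<exists>c. (\<forall>x\<in>X. c x \<in> {1, -1}) \<and> (\<forall>x. x \<notin> X \<longrightarrow> c x = 0) \<and>
      (\<forall>S\<in>APs d N. \<bar>real_of_int (\<Sum>x\<in>S. c x)\<bar>
         \<le> C * (real N powr (real d / (2 * real d + 2)) * (card X / real N ^ d) powr e)))"
    using full_ap_coloring[OF assms, folded e_def] by (elim exE conjE)
  show ?thesis
  proof (rule exI[of _ c0], rule exI[of _ C], intro conjI allI impI c0 C)
    fix N :: nat assume N: "1 \<le> N"
    define M where "M col = Max ((\<lambda>A. \<bar>\<Sum>x\<in>A. col x\<bar>) ` APs d N)" for col :: "(nat \<Rightarrow> int) \<Rightarrow> int"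
    obtain x0 where x0: "x0 \<in> grid d N" "{x0} \<in> APs d N" using singleton_in_APs[OF assms N] by blast
    have fin: "finite ((\<lambda>A. \<bar>\<Sum>x\<in>A. col x\<bar>) ` APs d N)" for col :: "(nat \<Rightarrow> int) \<Rightarrow> int"
      using finite_APs by simp
    have Mge: "\<bar>\<Sum>x\<in>A. col x\<bar> \<le> M col" if "A \<in> APs d N" for A and col :: "(nat \<Rightarrow> int) \<Rightarrow> int"
      unfolding M_def using fin that by (intro Max_ge) auto
    have disc: "disc_AP d N = Min (M ` colorings d N)" by (simp add: disc_AP_def M_def[abs_def])
    obtain col where col: "\<forall>x\<in>grid d N. col x \<in> {1, -1}" "\<forall>x. x \<notin> grid d N \<longrightarrow> col x = 0"
      "\<forall>S\<in>APs d N. \<bar>real_of_int (\<Sum>x\<in>S. col x)\<bar>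
         \<le> C * (real N powr (real d / (2 * real d + 2)) * (card (grid d N) / real N ^ d) powr e)"
      using upper[rule_format, OF N order_refl] by (elim exE conjE)
    have colc: "col \<in> colorings d N" using col by (simp add: colorings_def)
    have ratio: "card (grid d N) / real N ^ d = 1" using N by (simp add: grid_eq_cube card_cube)
    have "M col \<in> (\<lambda>A. \<bar>\<Sum>x\<in>A. col x\<bar>) ` APs d N"
      unfolding M_def using fin x0 by (intro Max_in) auto
    then obtain A where "A \<in> APs d N" "M col = \<bar>\<Sum>x\<in>A. col x\<bar>" by auto
    then have "real_of_int (M col) \<le> C * real N powr (real d / (2 * real d + 2))"
      using col(3)[rule_format, of A] unfolding ratio by simp
    moreover have "disc_AP d N \<le> M col"
      unfolding disc using finite_colorings colc by (intro Min_le) auto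
    ultimately show "real_of_int (disc_AP d N) \<le> C * real N powr (real d / (2 * real d + 2))"
      by linarith
    have "disc_AP d N \<in> M ` colorings d N"
      unfolding disc using finite_colorings colc by (intro Min_in) auto
    then obtain c where c: "c \<in> colorings d N" "disc_AP d N = M c" by auto
    have "\<bar>c x0\<bar> = 1" using c(1) x0(1) by (auto simp: colorings_def)
    then have "M c \<ge> 1" using Mge[OF x0(2), of c] by simp
    then show "c0 * real N powr (real d / (2 * real d + 2)) \<le> real_of_int (disc_AP d N)"
      unfolding c0_def c(2) using discrepancy_lower_bound[OF assms N c(1) Mge] by blast
  qed
qed

end
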